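(* Let $(M,g)$ be a Riemannian manifold of dimension $n\geq2$, let $G=a g^s+b g^h+c g^v$ with real constants $a,b,c$ such that $a\neq0$, $a+c\neq0$ and $a(a+c)-b^2\neq0$, let $Z$ be a vector field on $TM$ and $\bar\lambda\in\mathbb{R}$. Then $(TM,G,Z,\bar\lambda)$ is a Ricci soliton if and only if both of the following hold: 1. $(M,g)$ is flat; 2. $Z$ is a homothetic vector field on $(TM,G)$ with homothety factor $\bar\lambda$, i.e. $\mathcal{L}_ZG=2\bar\lambda G$.
   Context: Ricci soliton: $(N,h,V,\lambda)$ is a Ricci soliton if $h$ is a pseudo-Riemannian metric on the smooth manifold $N$, $V$ is a vector field on $N$, $\lambda\in\mathbb{R}$, and $\mathrm{Ric}+\frac12\mathcal{L}_Vh=\lambda h$, where $\mathrm{Ric}$ is the Ricci tensor of $h$. Lifts: for $(x,u)\in TM$ and $X\in T_xM$, $X^h$ denotes the horizontal lift (with respect to the Levi-Civita connection of $g$) and $X^v$ the vertical lift of $X$ to $(x,u)$; in induced coordinates $(x^i,u^i)$: $X^h=X^i\partial_{x^i}-\Gamma^i_{jk}u^jX^k\partial_{u^i}$, $X^v=X^i\partial_{u^i}$. Classical lifts of $g$ to $TM$, for $X,Y\in T_xM$: - Sasaki metric $g^s$: $g^s(X^h,Y^h)=g(X,Y)$, $g^s(X^h,Y^v)=g^s(X^v,Y^h)=0$, $g^s(X^v,Y^v)=g(X,Y)$; - horizontal lift $g^h$: $g^h(X^h,Y^h)=0$, $g^h(X^h,Y^v)=g^h(X^v,Y^h)=g(X,Y)$,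 $g^h(X^v,Y^v)=0$; - vertical lift $g^v$: $g^v(X^h,Y^h)=g(X,Y)$, $g^v(X^h,Y^v)=g^v(X^v,Y^h)=0$, $g^v(X^v,Y^v)=0$. *)

theory Defs
  imports "HOL-Analysis.Analysis"
begin

section \<open>Smooth maps between Euclidean spaces\<close>

abbreviation dir_deriv ::
  "('e::real_normed_vector \<Rightarrow> 'f::real_normed_vector) \<Rightarrow> 'e \<Rightarrow> 'e \<Rightarrow> 'f" where
  "dir_deriv f y a \<equiv> frechet_derivative f (at y) a"

text \<open>Only used for open \<open>S\<close>.\<close>
fun Ck_on :: "nat \<Rightarrow> ('e::real_normed_vector \<Rightarrow> 'f::real_normed_vector) \<Rightarrow> 'e set \<Rightarrow> bool" where
  "Ck_on 0 f S \<longleftrightarrow> continuous_on S f"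
| "Ck_on (Suc k) f S \<longleftrightarrow>
     (\<forall>y\<in>S. f differentiable (at y)) \<and> (\<forall>a. Ck_on k (\<lambda>y. dir_deriv f y a) S)"

definition smooth_on ::
  "('e::real_normed_vector \<Rightarrow> 'f::real_normed_vector) \<Rightarrow> 'e set \<Rightarrow> bool" where
  "smooth_on f S \<longleftrightarrow> (\<forall>k. Ck_on k f S)"

section \<open>Smooth manifolds\<close>

text \<open>A chart is a domain together with a coordinate map, of which only the values on the
  domain matter. A manifold is represented by an atlas: its points are the points covered by the
  charts, its topology is the one that makes all charts homeomorphisms onto their images, and its
  dimension is that of the Euclidean model space \<open>'e\<close>. The atlas need not be maximal.\<close>

type_synonym ('a, 'e) chart = "'a set \<times> ('a \<Rightarrow> 'e)"
type_synonym ('a, 'e) atlas = "('a, 'e) chart set"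

definition points :: "('a, 'e) atlas \<Rightarrow> 'a set" where
  "points M = (\<Union>\<phi>\<in>M. fst \<phi>)"

definition chart_image :: "('a, 'e) chart \<Rightarrow> 'e set" where
  "chart_image \<phi> = snd \<phi> ` fst \<phi>"

definition chart_inv :: "('a, 'e) chart \<Rightarrow> 'e \<Rightarrow> 'a" where
  "chart_inv \<phi> = inv_into (fst \<phi>) (snd \<phi>)"

definition transition :: "('a, 'e) chart \<Rightarrow> ('a, 'e) chart \<Rightarrow> 'e \<Rightarrow> 'e" where
  "transition \<phi> \<psi> = snd \<psi> \<circ> chart_inv \<phi>"

definition smooth_atlas :: "('a, 'e::euclidean_space) atlas \<Rightarrow> bool" where
  "smooth_atlas M \<longleftrightarrow>
     (\<forall>\<phi>\<in>M. inj_on (snd \<phi>) (fst \<phi>) \<and> open (chart_image \<phi>)) \<and>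
     (\<forall>\<phi>\<in>M. \<forall>\<psi>\<in>M. open (snd \<phi> ` (fst \<phi> \<inter> fst \<psi>)) \<and>
        smooth_on (transition \<phi> \<psi>) (snd \<phi> ` (fst \<phi> \<inter> fst \<psi>)))"

definition atlas_topology :: "('a, 'e::euclidean_space) atlas \<Rightarrow> 'a topology" where
  "atlas_topology M =
     topology (\<lambda>W. W \<subseteq> points M \<and> (\<forall>\<phi>\<in>M. open (snd \<phi> ` (W \<inter> fst \<phi>))))"

definition smooth_manifold :: "('a, 'e::euclidean_space) atlas \<Rightarrow> bool" where
  "smooth_manifold M \<longleftrightarrow> smooth_atlas M \<and>
     Hausdorff_space (atlas_topology M) \<and> second_countable (atlas_topology M)"

section \<open>Tangent vectors and the tangent bundle\<close>

text \<open>A tangent vector at \<open>p\<close> is the family of its component vectors in the charts around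
  \<open>p\<close>, which transform by the Jacobians of the coordinate changes. The value \<open>0\<close> at the
  remaining charts only makes the representation unique. Linear combinations of tangent vectors
  are taken chart by chart.\<close>

type_synonym ('a, 'e) tvec = "('a, 'e) chart \<Rightarrow> 'e"

definition tangent_space :: "('a, 'e::euclidean_space) atlas \<Rightarrow> 'a \<Rightarrow> ('a, 'e) tvec set" where
  "tangent_space M p = {u.
     (\<forall>\<phi>\<in>M. \<forall>\<psi>\<in>M. p \<in> fst \<phi> \<and> p \<in> fst \<psi> \<longrightarrow>
        u \<psi> = dir_deriv (transition \<phi> \<psi>) (snd \<phi> p) (u \<phi>)) \<and>
     (\<forall>\<phi>. \<not> (\<phi> \<in> M \<and> p \<in> fst \<phi>) \<longrightarrow> u \<phi> = 0)}"

text \<open>The tangent vector at \<open>p\<close> whose component vector in the chart \<open>\<phi>\<close> is \<open>a\<close>.\<close>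
definition chart_vector ::
  "('a, 'e::euclidean_space) atlas \<Rightarrow> ('a, 'e) chart \<Rightarrow> 'a \<Rightarrow> 'e \<Rightarrow> ('a, 'e) tvec" where
  "chart_vector M \<phi> p a =
     (\<lambda>\<psi>. if \<psi> \<in> M \<and> p \<in> fst \<psi> then dir_deriv (transition \<phi> \<psi>) (snd \<phi> p) a else 0)"

definition tangent_chart ::
  "('a, 'e::euclidean_space) atlas \<Rightarrow> ('a, 'e) chart \<Rightarrow> ('a \<times> ('a, 'e) tvec, 'e \<times> 'e) chart" where
  "tangent_chart M \<phi> =
     ({(p, u). p \<in> fst \<phi> \<and> u \<in> tangent_space M p}, \<lambda>(p, u). (snd \<phi> p, u \<phi>))"

definition tangent_bundle ::
  "('a, 'e::euclidean_space) atlas \<Rightarrow> ('a \<times> ('a, 'e) tvec, 'e \<times> 'e) atlas" where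
  "tangent_bundle M = tangent_chart M ` M"

section \<open>Vector fields and metrics\<close>

type_synonym ('a, 'e) vfield = "'a \<Rightarrow> ('a, 'e) tvec"
type_synonym ('a, 'e) tensor2 = "'a \<Rightarrow> ('a, 'e) tvec \<Rightarrow> ('a, 'e) tvec \<Rightarrow> real"

definition vfield_rep :: "('a, 'e) vfield \<Rightarrow> ('a, 'e) chart \<Rightarrow> 'e \<Rightarrow> 'e" where
  "vfield_rep V \<phi> y = V (chart_inv \<phi> y) \<phi>"

definition tensor_rep ::
  "('a, 'e::euclidean_space) atlas \<Rightarrow> ('a, 'e) tensor2 \<Rightarrow> ('a, 'e) chart \<Rightarrow>
     'e \<Rightarrow> 'e \<Rightarrow> 'e \<Rightarrow> real" where
  "tensor_rep M h \<phi> y a b = (let p = chart_inv \<phi> y in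
     h p (chart_vector M \<phi> p a) (chart_vector M \<phi> p b))"

definition vector_field :: "('a, 'e::euclidean_space) atlas \<Rightarrow> ('a, 'e) vfield \<Rightarrow> bool" where
  "vector_field M V \<longleftrightarrow> (\<forall>p\<in>points M. V p \<in> tangent_space M p) \<and>
     (\<forall>\<phi>\<in>M. smooth_on (vfield_rep V \<phi>) (chart_image \<phi>))"

definition pseudo_riemannian_metric ::
  "('a, 'e::euclidean_space) atlas \<Rightarrow> ('a, 'e) tensor2 \<Rightarrow> bool" where
  "pseudo_riemannian_metric M h \<longleftrightarrow>
     (\<forall>p\<in>points M.
        (\<forall>u\<in>tangent_space M p. \<forall>v\<in>tangent_space M p. \<forall>w\<in>tangent_space M p. \<forall>r.
           h p (\<lambda>\<phi>. r *\<^sub>R u \<phi> + v \<phi>) w = r * h p u w + h p v w) \<and>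
        (\<forall>u\<in>tangent_space M p. \<forall>v\<in>tangent_space M p. h p u v = h p v u) \<and>
        (\<forall>u\<in>tangent_space M p. (\<forall>v\<in>tangent_space M p. h p u v = 0) \<longrightarrow> u = (\<lambda>_. 0))) \<and>
     (\<forall>\<phi>\<in>M. \<forall>a b. smooth_on (\<lambda>y. tensor_rep M h \<phi> y a b) (chart_image \<phi>))"

definition riemannian_metric ::
  "('a, 'e::euclidean_space) atlas \<Rightarrow> ('a, 'e) tensor2 \<Rightarrow> bool" where
  "riemannian_metric M g \<longleftrightarrow> pseudo_riemannian_metric M g \<and>
     (\<forall>p\<in>points M. \<forall>u\<in>tangent_space M p. u \<noteq> (\<lambda>_. 0) \<longrightarrow> g p u u > 0)"

section \<open>Curvature and Lie derivative in coordinates\<close>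

text \<open>Here \<open>h\<close> is the coordinate representation of a metric. \<open>christoffel h y a b\<close> is the
  coordinate vector \<open>\<Gamma>\<^sup>i\<^sub>j\<^sub>k a\<^sup>j b\<^sup>k\<close>, i.e. \<open>\<nabla>\<^sub>a b\<close> at \<open>y\<close> for the vector fields with constant
  components \<open>a\<close>, \<open>b\<close>; the defining equation is the Koszul formula for such fields.
  The curvature is \<open>R(a, b)c = \<nabla>\<^sub>a \<nabla>\<^sub>b c - \<nabla>\<^sub>b \<nabla>\<^sub>a c\<close>, and the Ricci tensor is
  \<open>Ric(b, c) = tr (a \<mapsto> R(a, b)c)\<close>.\<close>

definition christoffel ::
  "('e::euclidean_space \<Rightarrow> 'e \<Rightarrow> 'e \<Rightarrow> real) \<Rightarrow> 'e \<Rightarrow> 'e \<Rightarrow> 'e \<Rightarrow> 'e" where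
  "christoffel h y a b = (THE v. \<forall>c. 2 * h y v c =
     dir_deriv (\<lambda>z. h z b c) y a + dir_deriv (\<lambda>z. h z a c) y b - dir_deriv (\<lambda>z. h z a b) y c)"

definition curvature_coord ::
  "('e::euclidean_space \<Rightarrow> 'e \<Rightarrow> 'e \<Rightarrow> real) \<Rightarrow> 'e \<Rightarrow> 'e \<Rightarrow> 'e \<Rightarrow> 'e \<Rightarrow> 'e" where
  "curvature_coord h y a b c =
     dir_deriv (\<lambda>z. christoffel h z b c) y a - dir_deriv (\<lambda>z. christoffel h z a c) y b
     + christoffel h y a (christoffel h y b c) - christoffel h y b (christoffel h y a c)"

definition ricci_coord ::
  "('e::euclidean_space \<Rightarrow> 'e \<Rightarrow> 'e \<Rightarrow> real) \<Rightarrow> 'e \<Rightarrow> 'e \<Rightarrow> 'e \<Rightarrow> real" where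
  "ricci_coord h y b c = (\<Sum>i\<in>Basis. curvature_coord h y i b c \<bullet> i)"

definition lie_deriv_coord ::
  "('e::euclidean_space \<Rightarrow> 'e) \<Rightarrow> ('e \<Rightarrow> 'e \<Rightarrow> 'e \<Rightarrow> real) \<Rightarrow> 'e \<Rightarrow> 'e \<Rightarrow> 'e \<Rightarrow> real" where
  "lie_deriv_coord V h y a b =
     dir_deriv (\<lambda>z. h z a b) y (V y) + h y (dir_deriv V y a) b + h y a (dir_deriv V y b)"

text \<open>The values of the tensors on tangent vectors at \<open>p\<close>, computed in the chart \<open>\<phi>\<close> around
  \<open>p\<close>. They do not depend on the chart; the notions below require their equations in all charts
  of the atlas.\<close>

definition ricci ::
  "('a, 'e::euclidean_space) atlas \<Rightarrow> ('a, 'e) tensor2 \<Rightarrow> ('a, 'e) chart \<Rightarrow> ('a, 'e) tensor2" where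
  "ricci M h \<phi> p u v = ricci_coord (tensor_rep M h \<phi>) (snd \<phi> p) (u \<phi>) (v \<phi>)"

definition lie_deriv ::
  "('a, 'e::euclidean_space) atlas \<Rightarrow> ('a, 'e) vfield \<Rightarrow> ('a, 'e) tensor2 \<Rightarrow> ('a, 'e) chart \<Rightarrow>
     ('a, 'e) tensor2" where
  "lie_deriv M V h \<phi> p u v =
     lie_deriv_coord (vfield_rep V \<phi>) (tensor_rep M h \<phi>) (snd \<phi> p) (u \<phi>) (v \<phi>)"

definition flat :: "('a, 'e::euclidean_space) atlas \<Rightarrow> ('a, 'e) tensor2 \<Rightarrow> bool" where
  "flat M h \<longleftrightarrow> (\<forall>\<phi>\<in>M. \<forall>p\<in>fst \<phi>.
     \<forall>u\<in>tangent_space M p. \<forall>v\<in>tangent_space M p. \<forall>w\<in>tangent_space M p.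
       curvature_coord (tensor_rep M h \<phi>) (snd \<phi> p) (u \<phi>) (v \<phi>) (w \<phi>) = 0)"

definition ricci_soliton ::
  "('a, 'e::euclidean_space) atlas \<Rightarrow> ('a, 'e) tensor2 \<Rightarrow> ('a, 'e) vfield \<Rightarrow> real \<Rightarrow> bool" where
  "ricci_soliton N h V lam \<longleftrightarrow>
     smooth_manifold N \<and> pseudo_riemannian_metric N h \<and> vector_field N V \<and>
     (\<forall>\<phi>\<in>N. \<forall>p\<in>fst \<phi>. \<forall>u\<in>tangent_space N p. \<forall>v\<in>tangent_space N p.
        ricci N h \<phi> p u v + 1 / 2 * lie_deriv N V h \<phi> p u v = lam * h p u v)"

definition homothetic_vector_field ::
  "('a, 'e::euclidean_space) atlas \<Rightarrow> ('a, 'e) tensor2 \<Rightarrow> ('a, 'e) vfield \<Rightarrow> real \<Rightarrow> bool" where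
  "homothetic_vector_field N h V lam \<longleftrightarrow> vector_field N V \<and>
     (\<forall>\<phi>\<in>N. \<forall>p\<in>fst \<phi>. \<forall>u\<in>tangent_space N p. \<forall>v\<in>tangent_space N p.
        lie_deriv N V h \<phi> p u v = 2 * lam * h p u v)"

section \<open>Lifts to the tangent bundle\<close>

text \<open>The lifts to \<open>(p, u)\<close> of a tangent vector \<open>X\<close> at \<open>p\<close>, given by their components in all
  induced charts around \<open>(p, u)\<close>.\<close>

definition horizontal_lift ::
  "('a, 'e::euclidean_space) atlas \<Rightarrow> ('a, 'e) tensor2 \<Rightarrow> 'a \<times> ('a, 'e) tvec \<Rightarrow> ('a, 'e) tvec \<Rightarrow>
     ('a \<times> ('a, 'e) tvec, 'e \<times> 'e) tvec" where
  "horizontal_lift M g = (\<lambda>(p, u) X.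
     THE \<xi>. \<xi> \<in> tangent_space (tangent_bundle M) (p, u) \<and>
       (\<forall>\<phi>\<in>M. p \<in> fst \<phi> \<longrightarrow> \<xi> (tangent_chart M \<phi>) =
          (X \<phi>, - christoffel (tensor_rep M g \<phi>) (snd \<phi> p) (u \<phi>) (X \<phi>))))"

definition vertical_lift ::
  "('a, 'e::euclidean_space) atlas \<Rightarrow> 'a \<times> ('a, 'e) tvec \<Rightarrow> ('a, 'e) tvec \<Rightarrow>
     ('a \<times> ('a, 'e) tvec, 'e \<times> 'e) tvec" where
  "vertical_lift M = (\<lambda>(p, u) X.
     THE \<xi>. \<xi> \<in> tangent_space (tangent_bundle M) (p, u) \<and>
       (\<forall>\<phi>\<in>M. p \<in> fst \<phi> \<longrightarrow> \<xi> (tangent_chart M \<phi>) = (0, X \<phi>)))"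

text \<open>The unique \<open>(X, Y)\<close> such that the given vector \<open>\<xi>\<close> at \<open>z\<close> is \<open>X\<^sup>h + Y\<^sup>v\<close>.\<close>
definition lift_parts ::
  "('a, 'e::euclidean_space) atlas \<Rightarrow> ('a, 'e) tensor2 \<Rightarrow> 'a \<times> ('a, 'e) tvec \<Rightarrow>
     ('a \<times> ('a, 'e) tvec, 'e \<times> 'e) tvec \<Rightarrow> ('a, 'e) tvec \<times> ('a, 'e) tvec" where
  "lift_parts M g z \<xi> = (THE (X, Y).
     X \<in> tangent_space M (fst z) \<and> Y \<in> tangent_space M (fst z) \<and>
     \<xi> = (\<lambda>\<Psi>. horizontal_lift M g z X \<Psi> + vertical_lift M z Y \<Psi>))"

text \<open>The classical lifts of a metric \<open>g\<close>, defined by their prescribed values on pairs of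
  horizontal and vertical lifts together with bilinearity.\<close>

definition sasaki_metric ::
  "('a, 'e::euclidean_space) atlas \<Rightarrow> ('a, 'e) tensor2 \<Rightarrow> ('a \<times> ('a, 'e) tvec, 'e \<times> 'e) tensor2" where
  "sasaki_metric M g z \<xi> \<eta> =
     (case (lift_parts M g z \<xi>, lift_parts M g z \<eta>) of
        ((X, Y), (X', Y')) \<Rightarrow> g (fst z) X X' + g (fst z) Y Y')"

definition horizontal_lift_metric ::
  "('a, 'e::euclidean_space) atlas \<Rightarrow> ('a, 'e) tensor2 \<Rightarrow> ('a \<times> ('a, 'e) tvec, 'e \<times> 'e) tensor2" where
  "horizontal_lift_metric M g z \<xi> \<eta> =
     (case (lift_parts M g z \<xi>, lift_parts M g z \<eta>) of
        ((X, Y), (X', Y')) \<Rightarrow> g (fst z) X Y' + g (fst z) Y X')"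

definition vertical_lift_metric ::
  "('a, 'e::euclidean_space) atlas \<Rightarrow> ('a, 'e) tensor2 \<Rightarrow> ('a \<times> ('a, 'e) tvec, 'e \<times> 'e) tensor2" where
  "vertical_lift_metric M g z \<xi> \<eta> =
     (case (lift_parts M g z \<xi>, lift_parts M g z \<eta>) of
        ((X, Y), (X', Y')) \<Rightarrow> g (fst z) X X')"

end

theory Submission
  imports Defs
begin

text \<open>
  Work over a chart of \<open>M\<close> and write \<open>\<Gamma>\<close> and \<open>R\<close> for the Christoffel symbols and the curvature of
  \<open>g\<close>. A tangent vector of \<open>TM\<close> at \<open>(p, u)\<close> has a horizontal and a vertical part, both in \<open>T\<^sub>pM\<close>,
  and \<open>G\<close> is a combination of \<open>g\<close> of these parts with constant coefficients. Differentiating the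
  two parts separately by the pulled back Levi-Civita connection of \<open>g\<close> therefore gives a metric
  connection for \<open>G\<close> (\<open>hconn\<close>), whose torsion is the vertical vector \<open>R(X, Y)u\<close>
  (\<open>torsion_hconn\<close>). The Koszul formula expresses the Levi-Civita connection of \<open>G\<close> through this
  connection and its torsion (\<open>koszul_lift\<close>), with two consequences.

  If \<open>g\<close> is flat, the torsion vanishes, so \<open>hconn\<close> is the Levi-Civita connection of \<open>G\<close>. Its
  curvature consists of two copies of \<open>R = 0\<close> (\<open>hconn_curvature\<close>). Hence \<open>Ric = 0\<close> on \<open>TM\<close>
  (\<open>ricci_lift_flat\<close>), and the soliton equation says exactly that \<open>Z\<close> is homothetic.

  In general the fibres are flat and totally geodesic, and \<open>Ric(X\<^sup>v, Y\<^sup>v) = - tr (P\<^sub>X P\<^sub>Y)\<close> at \<open>u\<close>,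
  where \<open>P\<^sub>X\<close> is the \<open>g\<close>-skew endomorphism with \<open>g(P\<^sub>X C, W) = \<kappa> g(X, R(C, W)u)\<close> and
  \<open>\<kappa> = a\<^sup>2 / (2 (a (a + c) - b\<^sup>2))\<close> (\<open>ricci_lift_vertical\<close>). Let \<open>Z\<close> satisfy the soliton
  equation. On the vector space \<open>T\<^sub>pM\<close> the one-form \<open>\<theta>(X) = G(Z, X\<^sup>v)\<close> then satisfies
  \<open>\<partial>\<^sub>X \<theta>(Y) + \<partial>\<^sub>Y \<theta>(X) = 2 \<lambda> a g(X, Y) + 2 tr (P\<^sub>X P\<^sub>Y)\<close>, whose right-hand side is a quadratic
  polynomial in \<open>u\<close>. A symmetrised derivative satisfies a second-order integrability condition; on
  the plane spanned by \<open>X\<close> and \<open>Y\<close> it reads \<open>tr (A\<^sup>2) = 0\<close> for the endomorphism \<open>A = P\<^sub>X\<close> at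
  \<open>u = Y\<close> (\<open>plane_killing_obstruction\<close>). Since \<open>A\<close> is skew and \<open>g\<close> is positive definite, \<open>A = 0\<close>,
  that is, \<open>g(X, R(C, W)Y) = 0\<close> for all arguments (\<open>flat_of_soliton_coord\<close>).

  To pass to manifolds, the horizontal lift has to be well defined, which is the transformation law
  of the Christoffel symbols (\<open>christoffel_transform\<close>). In an induced chart \<open>G\<close> is then the form
  \<open>lift\<close> used in the local argument (\<open>G_in_chart\<close>). A soliton moreover lives on a Hausdorff, second
  countable manifold, so these properties are carried over from \<open>M\<close> to \<open>TM\<close>.
\<close>

section \<open>Smooth functions\<close>

lemma has_derivative_cong_open:
  assumes "open S" "y \<in> S" "\<And>z. z \<in> S \<Longrightarrow> f z = g z"
  shows "(f has_derivative D) (at y) \<longleftrightarrow> (g has_derivative D) (at y)"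
proof
  assume "(f has_derivative D) (at y)"
  then show "(g has_derivative D) (at y)"
    by (rule has_derivative_transform_within_open[OF _ assms(1,2)]) (simp add: assms(3))
next
  assume "(g has_derivative D) (at y)"
  then show "(f has_derivative D) (at y)"
    by (rule has_derivative_transform_within_open[OF _ assms(1,2)]) (simp add: assms(3))
qed

lemma dir_deriv_cong_open:
  assumes "open S" "y \<in> S" "\<And>z. z \<in> S \<Longrightarrow> f z = g z"
  shows "dir_deriv f y a = dir_deriv g y a"
  using has_derivative_cong_open[OF assms] by (simp add: frechet_derivative_def)

lemma dir_deriv_eq:
  assumes "(f has_derivative D) (at y)"
  shows "dir_deriv f y a = D a"
  using frechet_derivative_at[OF assms] by simp

lemma has_derivative_dir_deriv:
  "f differentiable (at y) \<Longrightarrow> (f has_derivative dir_deriv f y) (at y)"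
  by (simp add: frechet_derivative_works)

lemma linear_dir_deriv: "f differentiable (at y) \<Longrightarrow> linear (dir_deriv f y)"
  by (rule linear_frechet_derivative)

lemma Ck_on_cong_imp:
  assumes "open S" "\<And>y. y \<in> S \<Longrightarrow> f y = g y" "Ck_on k f S"
  shows "Ck_on k g S"
  using assms(2,3)
proof (induction k arbitrary: f g)
  case 0
  then show ?case by (simp cong: continuous_on_cong)
next
  case (Suc k)
  have "g differentiable (at y)" if "y \<in> S" for y
    using Suc.prems(2) that has_derivative_cong_open[OF assms(1) that, of f g] Suc.prems(1)
    unfolding differentiable_def by (metis Ck_on.simps(2) differentiable_def)
  moreover have "Ck_on k (\<lambda>y. dir_deriv g y a) S" for a
    by (rule Suc.IH[of "\<lambda>y. dir_deriv f y a"])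
      (use Suc.prems dir_deriv_cong_open[OF assms(1) _ Suc.prems(1)] in auto)
  ultimately show ?case by simp
qed

lemma Ck_on_decr: "Ck_on (Suc k) f S \<Longrightarrow> Ck_on k f S"
proof (induction k arbitrary: f)
  case 0
  then show ?case
    by (auto intro: continuous_at_imp_continuous_on differentiable_imp_continuous_within)
qed auto

lemma Ck_on_const: "Ck_on k (\<lambda>_. c) S"
  by (induction k arbitrary: c) auto

lemma Ck_on_linear: "bounded_linear L \<Longrightarrow> Ck_on k L S"
  by (cases k) (auto simp: Ck_on_const dir_deriv_eq[OF bounded_linear_imp_has_derivative]
      bounded_linear_imp_differentiable linear_continuous_on)

lemma Ck_on_add:
  assumes "open S" "Ck_on k f S" "Ck_on k g S"
  shows "Ck_on k (\<lambda>y. f y + g y) S"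
  using assms(2,3)
proof (induction k arbitrary: f g)
  case (Suc k)
  have eq: "dir_deriv (\<lambda>y. f y + g y) y a = dir_deriv f y a + dir_deriv g y a" if "y \<in> S" for y a
    using Suc.prems that
    by (auto intro!: dir_deriv_eq[of _ "\<lambda>a. dir_deriv f y a + dir_deriv g y a"]
        has_derivative_add has_derivative_dir_deriv)
  have "Ck_on k (\<lambda>y. dir_deriv (\<lambda>y. f y + g y) y a) S" for a
    by (rule Ck_on_cong_imp[OF assms(1) _ Suc.IH[of "\<lambda>y. dir_deriv f y a" "\<lambda>y. dir_deriv g y a"]])
      (use Suc.prems eq in auto)
  with Suc.prems show ?case by auto
qed (auto intro: continuous_on_add)

lemma (in bounded_bilinear) Ck_on_prod:
  assumes "open S" "Ck_on k f S" "Ck_on k g S"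
  shows "Ck_on k (\<lambda>y. prod (f y) (g y)) S"
  using assms(2,3)
proof (induction k arbitrary: f g)
  case (Suc k)
  have D: "((\<lambda>y. prod (f y) (g y)) has_derivative (\<lambda>a. prod (f y) (dir_deriv g y a) + prod (dir_deriv f y a) (g y))) (at y)"
    if "y \<in> S" for y
    using Suc.prems that by (auto intro!: FDERIV has_derivative_dir_deriv)
  have "Ck_on k (\<lambda>y. dir_deriv (\<lambda>y. prod (f y) (g y)) y a) S" for a
  proof (rule Ck_on_cong_imp[OF assms(1)])
    show "Ck_on k (\<lambda>y. prod (f y) (dir_deriv g y a) + prod (dir_deriv f y a) (g y)) S"
      by (intro Ck_on_add Suc.IH assms(1)) (use Suc.prems Ck_on_decr in auto)
  qed (simp add: dir_deriv_eq[OF D])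
  with D show ?case by (auto simp: differentiable_def)
qed (auto intro: continuous_on)

lemma (in bounded_linear) Ck_on_comp:
  assumes "open S" "Ck_on k g S"
  shows "Ck_on k (\<lambda>y. f (g y)) S"
  using assms(2)
proof (induction k arbitrary: g)
  case (Suc k)
  have D: "((\<lambda>y. f (g y)) has_derivative (\<lambda>a. f (dir_deriv g y a))) (at y)" if "y \<in> S" for y
    using Suc.prems that by (auto intro!: has_derivative has_derivative_dir_deriv)
  have "Ck_on k (\<lambda>y. dir_deriv (\<lambda>y. f (g y)) y a) S" for a
    by (rule Ck_on_cong_imp[OF assms(1) _ Suc.IH[of "\<lambda>y. dir_deriv g y a"]])
      (use Suc.prems in \<open>auto simp: dir_deriv_eq[OF D]\<close>)
  with D show ?case by (auto simp: differentiable_def)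
qed (auto intro: continuous_on)

lemma Ck_on_sum:
  assumes "open S" "\<And>i. i \<in> I \<Longrightarrow> Ck_on k (f i) S"
  shows "Ck_on k (\<lambda>y. \<Sum>i\<in>I. f i y) S"
  using assms(2)
  by (induction I rule: infinite_finite_induct) (auto intro: Ck_on_const Ck_on_add assms(1))

text \<open>The chain rule writes the derivative of \<open>f \<circ> g\<close> through the finitely many partial
  derivatives of \<open>f\<close>, so that only the fixed directions of \<open>Basis\<close> occur in the induction.\<close>

lemma Ck_on_compose:
  fixes f :: "'e::euclidean_space \<Rightarrow> 'f::real_normed_vector"
  assumes "open S" "open T" "Ck_on k f T" "Ck_on k g S" "g ` S \<subseteq> T"
  shows "Ck_on k (\<lambda>y. f (g y)) S"
  using assms(3,4)
proof (induction k arbitrary: f)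
  case 0
  then show ?case using assms(5) by (auto intro: continuous_on_compose2)
next
  case (Suc k)
  have D: "((\<lambda>y. f (g y)) has_derivative (\<lambda>a. dir_deriv f (g y) (dir_deriv g y a))) (at y)"
    if "y \<in> S" for y
    using Suc.prems that assms(5)
    by (intro has_derivative_compose[of g _ _ _ f] has_derivative_dir_deriv) auto
  have eq: "dir_deriv (\<lambda>y. f (g y)) y a =
      (\<Sum>i\<in>Basis. (dir_deriv g y a \<bullet> i) *\<^sub>R dir_deriv f (g y) i)" if "y \<in> S" for y a
  proof -
    have "linear (dir_deriv f (g y))"
      using Suc.prems that assms(5) by (auto intro!: linear_dir_deriv)
    from linear_sum[OF this, of "\<lambda>i. (dir_deriv g y a \<bullet> i) *\<^sub>R i" Basis] show ?thesis
      by (simp add: dir_deriv_eq[OF D[OF that]] euclidean_representation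
          linear_cmul[OF \<open>linear (dir_deriv f (g y))\<close>])
  qed
  have "Ck_on k (\<lambda>y. dir_deriv (\<lambda>y. f (g y)) y a) S" for a
  proof (rule Ck_on_cong_imp[OF assms(1)])
    show "Ck_on k (\<lambda>y. \<Sum>i\<in>Basis. (dir_deriv g y a \<bullet> i) *\<^sub>R dir_deriv f (g y) i) S"
      using Suc.prems Ck_on_decr[OF Suc.prems(2)]
      by (intro Ck_on_sum bounded_bilinear.Ck_on_prod[OF bounded_bilinear_scaleR]
          bounded_linear.Ck_on_comp[OF bounded_linear_inner_left] Suc.IH assms(1)) auto
  qed (simp add: eq)
  with D show ?case by (auto simp: differentiable_def)
qed

lemma Ck_on_inverse:
  fixes f :: "'e::real_normed_vector \<Rightarrow> real"
  assumes "open S" "Ck_on k f S" "\<And>y. y \<in> S \<Longrightarrow> f y \<noteq> 0"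
  shows "Ck_on k (\<lambda>y. inverse (f y)) S"
  using assms(2)
proof (induction k)
  case 0
  then show ?case using assms(3) by (auto intro: continuous_on_inverse)
next
  case (Suc k)
  have D: "((\<lambda>y. inverse (f y)) has_derivative
      (\<lambda>a. - (inverse (f y) * dir_deriv f y a * inverse (f y)))) (at y)" if "y \<in> S" for y
    using Suc.prems that assms(3)
    by (intro Deriv.has_derivative_inverse has_derivative_dir_deriv) auto
  have "Ck_on k (\<lambda>y. dir_deriv (\<lambda>y. inverse (f y)) y a) S" for a
  proof (rule Ck_on_cong_imp[OF assms(1)])
    show "Ck_on k (\<lambda>y. - (inverse (f y) * dir_deriv f y a * inverse (f y))) S"
      using Suc.prems Suc.IH[OF Ck_on_decr[OF Suc.prems]]
      by (intro bounded_linear.Ck_on_comp[OF bounded_linear_minus[OF bounded_linear_ident]]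
          bounded_bilinear.Ck_on_prod[OF bounded_bilinear_mult] assms(1)) auto
  qed (simp add: dir_deriv_eq[OF D])
  with D show ?case by (auto simp: differentiable_def)
qed

lemma smooth_on_cong_imp:
  "open S \<Longrightarrow> (\<And>y. y \<in> S \<Longrightarrow> f y = g y) \<Longrightarrow> smooth_on f S \<Longrightarrow> smooth_on g S"
  unfolding smooth_on_def using Ck_on_cong_imp by blast

lemma smooth_on_differentiable: "smooth_on f S \<Longrightarrow> y \<in> S \<Longrightarrow> f differentiable (at y)"
  unfolding smooth_on_def by (metis Ck_on.simps(2))

lemma smooth_on_continuous: "smooth_on f S \<Longrightarrow> continuous_on S f"
  unfolding smooth_on_def by (metis Ck_on.simps(1))

lemma smooth_on_dir_deriv: "smooth_on f S \<Longrightarrow> smooth_on (\<lambda>y. dir_deriv f y a) S"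
  unfolding smooth_on_def by (metis Ck_on.simps(2))

lemma smooth_on_const: "smooth_on (\<lambda>_. c) S"
  by (simp add: smooth_on_def Ck_on_const)

lemma smooth_on_linear: "bounded_linear L \<Longrightarrow> smooth_on L S"
  by (simp add: smooth_on_def Ck_on_linear)

lemma smooth_on_add:
  "open S \<Longrightarrow> smooth_on f S \<Longrightarrow> smooth_on g S \<Longrightarrow> smooth_on (\<lambda>y. f y + g y) S"
  by (simp add: smooth_on_def Ck_on_add)

lemma (in bounded_bilinear) smooth_on_prod:
  "open S \<Longrightarrow> smooth_on f S \<Longrightarrow> smooth_on g S \<Longrightarrow> smooth_on (\<lambda>y. prod (f y) (g y)) S"
  by (simp add: smooth_on_def Ck_on_prod)

lemma (in bounded_linear) smooth_on_comp:
  "open S \<Longrightarrow> smooth_on g S \<Longrightarrow> smooth_on (\<lambda>y. f (g y)) S"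
  by (simp add: smooth_on_def Ck_on_comp)

lemma smooth_on_sum:
  "open S \<Longrightarrow> (\<And>i. i \<in> I \<Longrightarrow> smooth_on (f i) S) \<Longrightarrow> smooth_on (\<lambda>y. \<Sum>i\<in>I. f i y) S"
  by (simp add: smooth_on_def Ck_on_sum)

lemma smooth_on_compose:
  fixes f :: "'e::euclidean_space \<Rightarrow> 'f::real_normed_vector"
  shows "smooth_on f T \<Longrightarrow> open S \<Longrightarrow> open T \<Longrightarrow> smooth_on g S \<Longrightarrow> g ` S \<subseteq> T \<Longrightarrow>
    smooth_on (\<lambda>y. f (g y)) S"
  by (simp add: smooth_on_def Ck_on_compose)

lemma smooth_on_inverse:
  fixes f :: "'e::real_normed_vector \<Rightarrow> real"
  shows "open S \<Longrightarrow> smooth_on f S \<Longrightarrow> (\<And>y. y \<in> S \<Longrightarrow> f y \<noteq> 0) \<Longrightarrow> smooth_on (\<lambda>y. inverse (f y)) S"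
  by (simp add: smooth_on_def Ck_on_inverse)

lemmas smooth_on_scaleR = bounded_bilinear.smooth_on_prod[OF bounded_bilinear_scaleR]
lemmas smooth_on_mult = bounded_bilinear.smooth_on_prod[OF bounded_bilinear_mult]
lemmas smooth_on_inner_left = bounded_linear.smooth_on_comp[OF bounded_linear_inner_left]
lemmas smooth_on_fst = bounded_linear.smooth_on_comp[OF bounded_linear_fst]
lemmas smooth_on_snd = bounded_linear.smooth_on_comp[OF bounded_linear_snd]

lemma smooth_on_diff:
  "open S \<Longrightarrow> smooth_on f S \<Longrightarrow> smooth_on g S \<Longrightarrow> smooth_on (\<lambda>y. f y - g y) S"
  using smooth_on_add[of S f "\<lambda>y. - g y"]
    bounded_linear.smooth_on_comp[OF bounded_linear_minus[OF bounded_linear_ident], of S g]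
  by simp

lemma smooth_on_Pair:
  fixes f :: "'e::real_normed_vector \<Rightarrow> 'f::real_normed_vector"
    and g :: "'e \<Rightarrow> 'g::real_normed_vector"
  assumes "open S" "smooth_on f S" "smooth_on g S"
  shows "smooth_on (\<lambda>y. (f y, g y)) S"
proof -
  have f: "bounded_linear (\<lambda>x::'f. (x, 0::'g))"
    by (intro bounded_linear_Pair bounded_linear_ident bounded_linear_zero)
  have g: "bounded_linear (\<lambda>x::'g. (0::'f, x))"
    by (intro bounded_linear_Pair bounded_linear_ident bounded_linear_zero)
  have "smooth_on (\<lambda>y. (f y, 0) + (0, g y)) S"
    by (intro smooth_on_add assms bounded_linear.smooth_on_comp[OF f] bounded_linear.smooth_on_comp[OF g])
  then show ?thesis by simp
qed


lemma has_real_derivative_line: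
  fixes f :: "'e::real_normed_vector \<Rightarrow> real"
  assumes "f differentiable (at (p + s *\<^sub>R a))"
  shows "((\<lambda>s. f (p + s *\<^sub>R a)) has_real_derivative dir_deriv f (p + s *\<^sub>R a) a) (at s)"
proof -
  have "((\<lambda>s. p + s *\<^sub>R a) has_derivative (\<lambda>r. r *\<^sub>R a)) (at s)"
    by (auto intro!: derivative_eq_intros)
  from has_derivative_compose[OF this has_derivative_dir_deriv[OF assms]]
  show ?thesis
    unfolding has_field_derivative_def
    by (rule has_derivative_eq_rhs) (simp add: fun_eq_iff linear_cmul[OF linear_dir_deriv[OF assms]])
qed

text \<open>The second difference of \<open>f\<close> on a parallelogram is symmetric in the two edges, whereas two
  applications of the mean value theorem turn it into a mixed derivative taken in a prescribed
  order. Comparing the two orders on small parallelograms makes mixed derivatives commute.\<close>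

lemma second_difference_mean_value:
  fixes f :: "'e::real_normed_vector \<Rightarrow> real"
  assumes f: "smooth_on f S" and t: "0 < t"
    and S: "\<And>s r. 0 \<le> s \<Longrightarrow> s \<le> t \<Longrightarrow> 0 \<le> r \<Longrightarrow> r \<le> t \<Longrightarrow> y + s *\<^sub>R a + r *\<^sub>R b \<in> S"
  shows "\<exists>s r. 0 \<le> s \<and> s \<le> t \<and> 0 \<le> r \<and> r \<le> t \<and>
    f (y + t *\<^sub>R a + t *\<^sub>R b) - f (y + t *\<^sub>R a) - f (y + t *\<^sub>R b) + f y =
    t * t * dir_deriv (\<lambda>z. dir_deriv f z a) (y + s *\<^sub>R a + r *\<^sub>R b) b"
proof -
  have D: "((\<lambda>s. f (y + s *\<^sub>R a + r *\<^sub>R b)) has_real_derivative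
      dir_deriv f (y + s *\<^sub>R a + r *\<^sub>R b) a) (at s)"
    if "0 \<le> s" "s \<le> t" "0 \<le> r" "r \<le> t" for s r
    using has_real_derivative_line[of f "y + r *\<^sub>R b" s a]
      smooth_on_differentiable[OF f S[OF that]] by (simp add: ac_simps)
  have "\<exists>s>0. s < t \<and> (f (y + t *\<^sub>R a + t *\<^sub>R b) - f (y + t *\<^sub>R a + 0 *\<^sub>R b)) -
      (f (y + 0 *\<^sub>R a + t *\<^sub>R b) - f (y + 0 *\<^sub>R a + 0 *\<^sub>R b)) =
      (t - 0) * (dir_deriv f (y + s *\<^sub>R a + t *\<^sub>R b) a - dir_deriv f (y + s *\<^sub>R a + 0 *\<^sub>R b) a)"
    by (rule MVT2[OF t]) (use t in \<open>intro DERIV_diff D; simp\<close>)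
  then obtain s where s: "0 < s" "s < t" "f (y + t *\<^sub>R a + t *\<^sub>R b) - f (y + t *\<^sub>R a) - f (y + t *\<^sub>R b) + f y =
      t * (dir_deriv f (y + s *\<^sub>R a + t *\<^sub>R b) a - dir_deriv f (y + s *\<^sub>R a + 0 *\<^sub>R b) a)"
    by auto
  have "\<exists>r>0. r < t \<and> dir_deriv f (y + s *\<^sub>R a + t *\<^sub>R b) a - dir_deriv f (y + s *\<^sub>R a + 0 *\<^sub>R b) a =
      (t - 0) * dir_deriv (\<lambda>z. dir_deriv f z a) (y + s *\<^sub>R a + r *\<^sub>R b) b"
    by (rule MVT2[OF t])
      (use s S smooth_on_differentiable[OF smooth_on_dir_deriv[OF f]] in
        \<open>intro has_real_derivative_line[of "\<lambda>z. dir_deriv f z a"]; simp\<close>)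
  then obtain r where "0 < r" "r < t" "dir_deriv f (y + s *\<^sub>R a + t *\<^sub>R b) a - dir_deriv f (y + s *\<^sub>R a + 0 *\<^sub>R b) a =
      t * dir_deriv (\<lambda>z. dir_deriv f z a) (y + s *\<^sub>R a + r *\<^sub>R b) b"
    by auto
  with s show ?thesis by (intro exI[of _ s] exI[of _ r]) auto
qed

lemma mixed_dir_deriv_commute_real:
  fixes f :: "'e::real_normed_vector \<Rightarrow> real"
  assumes "open S" "smooth_on f S" "y \<in> S"
  shows "dir_deriv (\<lambda>z. dir_deriv f z a) y b = dir_deriv (\<lambda>z. dir_deriv f z b) y a"
proof (rule ccontr)
  let ?P = "\<lambda>z. dir_deriv (\<lambda>z. dir_deriv f z a) z b" and ?Q = "\<lambda>z. dir_deriv (\<lambda>z. dir_deriv f z b) z a"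
  assume neq: "?P y \<noteq> ?Q y"
  define e where "e = \<bar>?P y - ?Q y\<bar> / 2"
  have e: "e > 0" using neq by (simp add: e_def)
  have "continuous_on S ?P" "continuous_on S ?Q"
    by (intro smooth_on_continuous smooth_on_dir_deriv assms(2))+
  then have "isCont ?P y" "isCont ?Q y"
    using assms by (auto simp: continuous_on_eq_continuous_at)
  moreover have near_y: "\<exists>d>0. \<forall>x. dist x y < d \<longrightarrow> \<bar>F x - F y\<bar> < e" if "isCont F y" for F :: "'e \<Rightarrow> real"
    using that e unfolding continuous_at_eps_delta dist_real_def by blast
  ultimately obtain d1 d2 where d: "d1 > 0" "d2 > 0"
    "\<And>x. dist x y < d1 \<Longrightarrow> \<bar>?P x - ?P y\<bar> < e" "\<And>x. dist x y < d2 \<Longrightarrow> \<bar>?Q x - ?Q y\<bar> < e"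
    using near_y[of ?P] near_y[of ?Q] by blast
  obtain d3 where d3: "d3 > 0" "\<And>x. dist x y < d3 \<Longrightarrow> x \<in> S"
    using assms(1,3) unfolding open_dist by blast
  define d0 where "d0 = min d1 (min d2 d3)"
  \<comment> \<open>With this size all points of the parallelogram lie within \<open>d0 / 2\<close> of \<open>y\<close>.\<close>
  define t where "t = d0 / (2 * (norm a + norm b + 1))"
  have n: "norm a + norm b + 1 > 0" by (simp add: add_nonneg_pos)
  have d0: "d0 > 0" using d d3 by (simp add: d0_def)
  then have t: "t > 0" using n by (simp add: t_def)
  have near: "dist (y + s *\<^sub>R a + r *\<^sub>R b) y < d0" if "0 \<le> s" "s \<le> t" "0 \<le> r" "r \<le> t" for s r
  proof -
    have "dist (y + s *\<^sub>R a + r *\<^sub>R b) y = norm (s *\<^sub>R a + r *\<^sub>R b)"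
      by (simp add: dist_norm)
    also have "\<dots> \<le> s * norm a + r * norm b"
      using that by (metis abs_of_nonneg norm_scaleR norm_triangle_ineq)
    also have "\<dots> \<le> t * norm a + t * norm b"
      using that by (intro add_mono mult_right_mono) auto
    also have "\<dots> \<le> t * (norm a + norm b + 1)" using t by (simp add: algebra_simps)
    also have "\<dots> = d0 / 2" using n by (simp add: t_def field_simps)
    also have "\<dots> < d0" using d0 by simp
    finally show ?thesis .
  qed
  have near': "dist (y + r *\<^sub>R b + s *\<^sub>R a) y < d0" if "0 \<le> s" "s \<le> t" "0 \<le> r" "r \<le> t" for s r
    using near[OF that] by (simp add: ac_simps)
  have in_S: "y + s *\<^sub>R a + r *\<^sub>R b \<in> S" "y + r *\<^sub>R b + s *\<^sub>R a \<in> S"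
    if "0 \<le> s" "s \<le> t" "0 \<le> r" "r \<le> t" for s r
    using near[OF that] near'[OF that] by (auto intro!: d3(2) simp: d0_def)
  obtain s r where 1: "0 \<le> s" "s \<le> t" "0 \<le> r" "r \<le> t"
    "f (y + t *\<^sub>R a + t *\<^sub>R b) - f (y + t *\<^sub>R a) - f (y + t *\<^sub>R b) + f y = t * t * ?P (y + s *\<^sub>R a + r *\<^sub>R b)"
    using second_difference_mean_value[OF assms(2) t, of y a b] in_S(1) by blast
  obtain s' r' where 2: "0 \<le> s'" "s' \<le> t" "0 \<le> r'" "r' \<le> t"
    "f (y + t *\<^sub>R b + t *\<^sub>R a) - f (y + t *\<^sub>R b) - f (y + t *\<^sub>R a) + f y = t * t * ?Q (y + s' *\<^sub>R b + r' *\<^sub>R a)"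
    using second_difference_mean_value[OF assms(2) t, of y b a] in_S(2) by blast
  have "t * t * ?P (y + s *\<^sub>R a + r *\<^sub>R b) = t * t * ?Q (y + s' *\<^sub>R b + r' *\<^sub>R a)"
    unfolding 1(5)[symmetric] 2(5)[symmetric] by (simp add: ac_simps)
  then have "?P (y + s *\<^sub>R a + r *\<^sub>R b) = ?Q (y + s' *\<^sub>R b + r' *\<^sub>R a)" using t by simp
  moreover have "\<bar>?P (y + s *\<^sub>R a + r *\<^sub>R b) - ?P y\<bar> < e"
    using near[OF 1(1-4)] by (intro d) (simp add: d0_def)
  moreover have "\<bar>?Q (y + s' *\<^sub>R b + r' *\<^sub>R a) - ?Q y\<bar> < e"
    using near'[OF 2(3,4,1,2)] by (intro d) (simp add: d0_def)
  ultimately show False unfolding e_def by (simp add: abs_if split: if_splits)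
qed

lemma mixed_dir_deriv_commute:
  fixes f :: "'e::real_normed_vector \<Rightarrow> 'f::euclidean_space"
  assumes "open S" "smooth_on f S" "y \<in> S"
  shows "dir_deriv (\<lambda>z. dir_deriv f z a) y b = dir_deriv (\<lambda>z. dir_deriv f z b) y a"
proof (rule euclidean_eqI)
  fix i :: 'f assume "i \<in> Basis"
  have D: "dir_deriv (\<lambda>y. F y \<bullet> i) y a = dir_deriv F y a \<bullet> i"
    if "smooth_on F S" "y \<in> S" for F :: "'e \<Rightarrow> 'f" and y a
    by (rule dir_deriv_eq[OF has_derivative_inner_left[OF has_derivative_dir_deriv]])
      (rule smooth_on_differentiable[OF that])
  have D2: "dir_deriv (\<lambda>z. dir_deriv f z a) y b \<bullet> i = dir_deriv (\<lambda>z. dir_deriv (\<lambda>y. f y \<bullet> i) z a) y b" for a b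
    unfolding D[OF smooth_on_dir_deriv[OF assms(2)] assms(3), symmetric]
    by (rule dir_deriv_cong_open[OF assms(1,3)]) (simp add: D assms(2))
  show "dir_deriv (\<lambda>z. dir_deriv f z a) y b \<bullet> i = dir_deriv (\<lambda>z. dir_deriv f z b) y a \<bullet> i"
    unfolding D2 by (rule mixed_dir_deriv_commute_real[OF assms(1) smooth_on_inner_left assms(3)])
      (use assms in auto)
qed

section \<open>Smooth families of linear maps\<close>

lemma linear_eq_sum_Basis:
  fixes L :: "'e::euclidean_space \<Rightarrow> 'f::real_vector"
  assumes "linear L"
  shows "L x = (\<Sum>i\<in>Basis. (x \<bullet> i) *\<^sub>R L i)"
  using linear_sum[OF assms, of "\<lambda>i. (x \<bullet> i) *\<^sub>R i" Basis]
  by (simp add: euclidean_representation linear_cmul[OF assms])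

text \<open>The product rule for a linear map depending on a parameter, applied to a moving argument.
  The derivative of the family itself is \<open>dir_deriv (\<lambda>y. L y v)\<close> for a frozen argument \<open>v\<close>.\<close>

lemma has_derivative_linear_family:
  fixes L :: "'m::real_normed_vector \<Rightarrow> 'e::euclidean_space \<Rightarrow> 'f::real_normed_vector"
  assumes S: "open S" "\<phi> z \<in> S" "\<And>y. y \<in> S \<Longrightarrow> linear (L y)"
    and L: "\<And>i. i \<in> Basis \<Longrightarrow> (\<lambda>y. L y i) differentiable (at (\<phi> z))"
    and \<phi>: "(\<phi> has_derivative \<phi>') (at z)" and f: "(f has_derivative f') (at z)"
  shows "((\<lambda>x. L (\<phi> x) (f x)) has_derivative
    (\<lambda>\<xi>. L (\<phi> z) (f' \<xi>) + dir_deriv (\<lambda>y. L y (f z)) (\<phi> z) (\<phi>' \<xi>))) (at z)"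
proof -
  have inner: "((\<lambda>y. L y v) has_derivative (\<lambda>\<xi>. \<Sum>i\<in>Basis. (v \<bullet> i) *\<^sub>R dir_deriv (\<lambda>y. L y i) (\<phi> z) \<xi>)) (at (\<phi> z))" for v
  proof (subst has_derivative_cong_open[OF S(1,2)])
    show "L y v = (\<Sum>i\<in>Basis. (v \<bullet> i) *\<^sub>R L y i)" if "y \<in> S" for y
      by (rule linear_eq_sum_Basis[OF S(3)[OF that]])
  qed (auto intro!: derivative_eq_intros has_derivative_dir_deriv L)
  have "\<phi> \<midarrow>z\<rightarrow> \<phi> z" using has_derivative_continuous[OF \<phi>] by (simp add: continuous_within)
  then have ev: "\<forall>\<^sub>F x in at z. \<phi> x \<in> S" using S by (auto dest: topological_tendstoD)
  have "((\<lambda>x. \<Sum>i\<in>Basis. (f x \<bullet> i) *\<^sub>R L (\<phi> x) i) has_derivative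
      (\<lambda>\<xi>. \<Sum>i\<in>Basis. (f z \<bullet> i) *\<^sub>R dir_deriv (\<lambda>y. L y i) (\<phi> z) (\<phi>' \<xi>) + (f' \<xi> \<bullet> i) *\<^sub>R L (\<phi> z) i)) (at z)"
    by (intro has_derivative_sum has_derivative_scaleR has_derivative_inner_left f
        has_derivative_compose[OF \<phi>] has_derivative_dir_deriv L)
  then have D: "((\<lambda>x. L (\<phi> x) (f x)) has_derivative
      (\<lambda>\<xi>. \<Sum>i\<in>Basis. (f z \<bullet> i) *\<^sub>R dir_deriv (\<lambda>y. L y i) (\<phi> z) (\<phi>' \<xi>) + (f' \<xi> \<bullet> i) *\<^sub>R L (\<phi> z) i)) (at z)"
    by (rule has_derivative_transform_eventually)
      (use ev S in \<open>auto elim!: eventually_mono simp: linear_eq_sum_Basis[OF S(3), symmetric]\<close>)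
  have L': "L (\<phi> z) (f' \<xi>) = (\<Sum>i\<in>Basis. (f' \<xi> \<bullet> i) *\<^sub>R L (\<phi> z) i)" for \<xi>
    by (rule linear_eq_sum_Basis[OF S(3)[OF S(2)]])
  have d: "dir_deriv (\<lambda>y. L y (f z)) (\<phi> z) (\<phi>' \<xi>) =
      (\<Sum>i\<in>Basis. (f z \<bullet> i) *\<^sub>R dir_deriv (\<lambda>y. L y i) (\<phi> z) (\<phi>' \<xi>))" for \<xi>
    by (rule dir_deriv_eq[OF inner])
  show ?thesis
    by (rule has_derivative_eq_rhs[OF D]) (subst d, subst L', simp add: fun_eq_iff sum.distrib)
qed

lemma smooth_on_linear_family:
  fixes L :: "'m::real_normed_vector \<Rightarrow> 'e::euclidean_space \<Rightarrow> 'f::real_normed_vector"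
  assumes "open T" "\<And>z. z \<in> T \<Longrightarrow> linear (L z)"
    and "\<And>i. i \<in> Basis \<Longrightarrow> smooth_on (\<lambda>z. L z i) T" "smooth_on f T"
  shows "smooth_on (\<lambda>z. L z (f z)) T"
proof (rule smooth_on_cong_imp[OF assms(1)])
  show "smooth_on (\<lambda>z. \<Sum>i\<in>Basis. (f z \<bullet> i) *\<^sub>R L z i) T"
    by (intro smooth_on_sum smooth_on_scaleR smooth_on_inner_left assms)
  show "(\<Sum>i\<in>Basis. (f z \<bullet> i) *\<^sub>R L z i) = L z (f z)" if "z \<in> T" for z
    by (rule linear_eq_sum_Basis[OF assms(2)[OF that], symmetric])
qed


section \<open>Smooth families of bilinear maps\<close>

text \<open>Metrics, Christoffel symbols and the lifted metric are all smooth families of bilinear maps. The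
  locale collects their product rule, in which the base point moves together with the two
  arguments.\<close>

locale smooth_bilinear =
  fixes S :: "'m::euclidean_space set"
    and \<beta> :: "'m \<Rightarrow> 'e::euclidean_space \<Rightarrow> 'e \<Rightarrow> 'f::real_normed_vector"
  assumes open_S: "open S"
    and bilin: "y \<in> S \<Longrightarrow> bilinear (\<beta> y)"
    and smooth: "smooth_on (\<lambda>y. \<beta> y u v) S"
begin

lemmas add_left = bilinear_ladd[OF bilin]
  and add_right = bilinear_radd[OF bilin]
  and scale_left = bilinear_lmul[OF bilin]
  and scale_right = bilinear_rmul[OF bilin]
  and diff_left = bilinear_lsub[OF bilin]
  and diff_right = bilinear_rsub[OF bilin]
  and zero_left = bilinear_lzero[OF bilin]
  and zero_right = bilinear_rzero[OF bilin]
  and neg_left = bilinear_lneg[OF bilin]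
  and neg_right = bilinear_rneg[OF bilin]

lemma linear_left: "y \<in> S \<Longrightarrow> linear (\<lambda>u. \<beta> y u v)"
  using bilin[of y] by (simp add: bilinear_def)

lemma linear_right: "y \<in> S \<Longrightarrow> linear (\<beta> y u)"
  using bilin[of y] by (simp add: bilinear_def)

lemma differentiable: "y \<in> S \<Longrightarrow> (\<lambda>y. \<beta> y u v) differentiable (at y)"
  using smooth by (rule smooth_on_differentiable)

lemma smooth_comp:
  assumes T: "open T" "smooth_on \<phi> T" "\<phi> ` T \<subseteq> S" and f: "smooth_on f T" and g: "smooth_on g T"
  shows "smooth_on (\<lambda>x. \<beta> (\<phi> x) (f x) (g x)) T"
proof (rule smooth_on_linear_family[where L = "\<lambda>x. \<beta> (\<phi> x) (f x)", OF T(1) _ _ g])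
  show "smooth_on (\<lambda>z. \<beta> (\<phi> z) (f z) v) T" for v
  proof (rule smooth_on_linear_family[where L = "\<lambda>x u. \<beta> (\<phi> x) u v", OF T(1) _ _ f])
    show "smooth_on (\<lambda>z. \<beta> (\<phi> z) u v) T" for u
      by (rule smooth_on_compose[OF smooth T(1) open_S T(2,3)])
  qed (use T in \<open>auto intro!: linear_left\<close>)
qed (use T in \<open>auto intro!: linear_right\<close>)

lemma product_rule:
  assumes T: "open T" "z \<in> T" "\<phi> ` T \<subseteq> S"
    and \<phi>: "(\<phi> has_derivative \<phi>') (at z)"
    and f: "(f has_derivative f') (at z)" and g: "(g has_derivative g') (at z)"
  shows "((\<lambda>x. \<beta> (\<phi> x) (f x) (g x)) has_derivative
    (\<lambda>\<xi>. \<beta> (\<phi> z) (f' \<xi>) (g z) + \<beta> (\<phi> z) (f z) (g' \<xi>) +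
       dir_deriv (\<lambda>y. \<beta> y (f z) (g z)) (\<phi> z) (\<phi>' \<xi>))) (at z)"
proof -
  have \<phi>z: "\<phi> z \<in> S" using T by auto
  have D: "((\<lambda>x. \<beta> (\<phi> x) (f x) v) has_derivative
      (\<lambda>\<xi>. \<beta> (\<phi> z) (f' \<xi>) v + dir_deriv (\<lambda>y. \<beta> y (f z) v) (\<phi> z) (\<phi>' \<xi>))) (at z)" for v
    by (rule has_derivative_linear_family[where L = "\<lambda>y u. \<beta> y u v", OF open_S \<phi>z linear_left _ \<phi> f])
      (auto intro: differentiable \<phi>z)
  have "((\<lambda>x. \<beta> (\<phi> x) (f x) (g x)) has_derivative
      (\<lambda>\<xi>. \<beta> (\<phi> z) (f z) (g' \<xi>) + dir_deriv (\<lambda>x. \<beta> (\<phi> x) (f x) (g z)) z \<xi>)) (at z)"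
    by (rule has_derivative_linear_family[where L = "\<lambda>x. \<beta> (\<phi> x) (f x)" and \<phi> = "\<lambda>x. x",
          OF T(1,2) linear_right _ has_derivative_ident g])
      (use T D in \<open>auto simp: differentiable_def\<close>)
  then show ?thesis
    by (rule has_derivative_eq_rhs) (simp only: dir_deriv_eq[OF D] fun_eq_iff, simp add: ac_simps)
qed

lemma deriv_bilinear:
  assumes y: "y \<in> S"
  shows "bilinear (\<lambda>u v. dir_deriv (\<lambda>z. \<beta> z u v) y a)"
proof -
  note D = has_derivative_dir_deriv[OF differentiable[OF y]]
  have add_l: "dir_deriv (\<lambda>z. \<beta> z (u + u') v) y a = dir_deriv (\<lambda>z. \<beta> z u v) y a + dir_deriv (\<lambda>z. \<beta> z u' v) y a" for u u' v
    using dir_deriv_cong_open[OF open_S y, of "\<lambda>z. \<beta> z (u + u') v" "\<lambda>z. \<beta> z u v + \<beta> z u' v"]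
      dir_deriv_eq[OF has_derivative_add[OF D D]] by (simp add: add_left)
  have add_r: "dir_deriv (\<lambda>z. \<beta> z u (v + v')) y a = dir_deriv (\<lambda>z. \<beta> z u v) y a + dir_deriv (\<lambda>z. \<beta> z u v') y a" for u v v'
    using dir_deriv_cong_open[OF open_S y, of "\<lambda>z. \<beta> z u (v + v')" "\<lambda>z. \<beta> z u v + \<beta> z u v'"]
      dir_deriv_eq[OF has_derivative_add[OF D D]] by (simp add: add_right)
  have scale_l: "dir_deriv (\<lambda>z. \<beta> z (r *\<^sub>R u) v) y a = r *\<^sub>R dir_deriv (\<lambda>z. \<beta> z u v) y a" for r u v
    using dir_deriv_cong_open[OF open_S y, of "\<lambda>z. \<beta> z (r *\<^sub>R u) v" "\<lambda>z. r *\<^sub>R \<beta> z u v"]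
      dir_deriv_eq[OF has_derivative_scaleR_right[OF D]] by (simp add: scale_left)
  have scale_r: "dir_deriv (\<lambda>z. \<beta> z u (r *\<^sub>R v)) y a = r *\<^sub>R dir_deriv (\<lambda>z. \<beta> z u v) y a" for r u v
    using dir_deriv_cong_open[OF open_S y, of "\<lambda>z. \<beta> z u (r *\<^sub>R v)" "\<lambda>z. r *\<^sub>R \<beta> z u v"]
      dir_deriv_eq[OF has_derivative_scaleR_right[OF D]] by (simp add: scale_right)
  show ?thesis
    unfolding bilinear_def by (auto intro!: linearI simp: add_l add_r scale_l scale_r)
qed

lemma deriv_linear: "y \<in> S \<Longrightarrow> linear (\<lambda>a. dir_deriv (\<lambda>z. \<beta> z u v) y a)"
  using linear_dir_deriv[OF differentiable] by simp

end

section \<open>Riemannian geometry in a coordinate domain\<close>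

definition koszul ::
  "('e::euclidean_space \<Rightarrow> 'e \<Rightarrow> 'e \<Rightarrow> real) \<Rightarrow> 'e \<Rightarrow> 'e \<Rightarrow> 'e \<Rightarrow> 'e \<Rightarrow> real" where
  "koszul h y a b c =
     dir_deriv (\<lambda>z. h z b c) y a + dir_deriv (\<lambda>z. h z a c) y b - dir_deriv (\<lambda>z. h z a b) y c"

lemma christoffel_eqI:
  assumes "\<And>c. 2 * h y v c = koszul h y a b c"
    and "\<And>v w. (\<And>c. h y v c = h y w c) \<Longrightarrow> v = w"
  shows "christoffel h y a b = v"
  unfolding christoffel_def koszul_def[symmetric]
proof (rule the_equality)
  fix v' assume v': "\<forall>c. 2 * h y v' c = koszul h y a b c"
  have "h y v' c = h y v c" for c
    using v'[rule_format, of c] assms(1)[of c] by simp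
  then show "v' = v" by (rule assms(2))
qed (use assms(1) in auto)

locale local_metric = smooth_bilinear S h
  for S :: "'e::euclidean_space set" and h :: "'e \<Rightarrow> 'e \<Rightarrow> 'e \<Rightarrow> real" +
  assumes sym: "y \<in> S \<Longrightarrow> h y u v = h y v u"
    and pos: "y \<in> S \<Longrightarrow> u \<noteq> 0 \<Longrightarrow> h y u u > 0"
begin

lemma nondegenerate:
  assumes "y \<in> S" "\<And>w. h y v w = h y v' w"
  shows "v = v'"
proof (rule ccontr)
  assume "v \<noteq> v'"
  then have "h y (v - v') (v - v') > 0" by (intro pos assms(1)) simp
  then show False by (simp add: diff_left[OF assms(1)] assms(2)[of "v - v'"])
qed

text \<open>Gram-Schmidt orthogonalisation of the coordinate frame without normalisation uses only field
  operations, so it yields a smooth frame. The frame serves twice: it inverts the metric smoothly,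
  and it computes traces by means of the metric.\<close>

lemma orthogonal_frame_on:
  assumes "finite B" "B \<subseteq> Basis"
  shows "\<exists>e. (\<forall>b\<in>B. smooth_on (e b) S) \<and>
    (\<forall>y\<in>S. \<forall>b\<in>B. e b y \<noteq> 0) \<and>
    (\<forall>y\<in>S. \<forall>b\<in>B. \<forall>b'\<in>B. b \<noteq> b' \<longrightarrow> h y (e b y) (e b' y) = 0) \<and>
    (\<forall>y\<in>S. span ((\<lambda>b. e b y) ` B) = span B)"
  using assms
proof (induction B rule: finite_induct)
  case empty
  then show ?case by simp
next
  case (insert x B)
  obtain e :: "'e \<Rightarrow> 'e \<Rightarrow> 'e" where E: "\<forall>b\<in>B. smooth_on (e b) S" "\<forall>y\<in>S. \<forall>b\<in>B. e b y \<noteq> 0"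
    "\<forall>y\<in>S. \<forall>b\<in>B. \<forall>b'\<in>B. b \<noteq> b' \<longrightarrow> h y (e b y) (e b' y) = 0"
    "\<forall>y\<in>S. span ((\<lambda>b. e b y) ` B) = span B"
    using insert.IH[OF insert_subset[THEN iffD1, THEN conjunct2, OF insert.prems]]
    by (elim exE conjE) (erule (3) that)
  note smooth_e = E(1)[rule_format] and nz = E(2)[rule_format] and orth = E(3)[rule_format]
    and span_e = E(4)[rule_format]
  define w where "w y = (\<Sum>b\<in>B. (h y x (e b y) * inverse (h y (e b y) (e b y))) *\<^sub>R e b y)" for y
  define e' where "e' b = (if b = x then (\<lambda>y. x - w y) else e b)" for b
  have e'_B: "e' b = e b" if "b \<in> B" for b using that insert.hyps by (auto simp: e'_def)
  have e'_x: "e' x = (\<lambda>y. x - w y)" by (simp add: e'_def)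
  have pos_e: "h y (e b y) (e b y) > 0" if "y \<in> S" "b \<in> B" for y b
    using pos nz that by auto
  have "smooth_on w S"
    unfolding w_def using pos_e
    by (intro smooth_on_sum smooth_on_scaleR smooth_on_mult smooth_on_inverse open_S smooth_e smooth_comp
        smooth_on_linear smooth_on_const) (auto simp: less_imp_neq[THEN not_sym] intro: bounded_linear_ident)
  then have smooth': "smooth_on (e' b) S" if "b \<in> insert x B" for b
    using that insert.hyps by (auto simp: e'_def intro!: smooth_on_diff smooth_on_const open_S smooth_e)
  have w_span: "w y \<in> span ((\<lambda>b. e b y) ` B)" for y
    unfolding w_def by (intro span_sum span_scale span_base) auto
  have "x \<notin> span B"
    using independent_Basis insert.prems insert.hyps
    unfolding dependent_def by (metis Diff_empty Diff_insert0 insert_Diff_single insert_subset span_mono subsetD subset_insert_iff)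
  then have nz_x: "e' x y \<noteq> 0" if "y \<in> S" for y
    using w_span[of y] span_e[OF that] by (auto simp: e'_x)
  have orth_x: "h y (e' x y) (e b y) = 0" if y: "y \<in> S" and b: "b \<in> B" for y b
  proof -
    have "h y (w y) (e b y) = (\<Sum>b'\<in>B. h y x (e b' y) * inverse (h y (e b' y) (e b' y)) * h y (e b' y) (e b y))"
      unfolding w_def linear_sum[OF linear_left[OF y]] by (simp add: scale_left y mult.assoc)
    also have "\<dots> = (\<Sum>b'\<in>B. if b' = b then h y x (e b y) else 0)"
      using orth[OF y _ b] pos_e[OF y b] by (intro sum.cong) auto
    also have "\<dots> = h y x (e b y)" using b insert.hyps by (simp add: sum.delta)
    finally show ?thesis by (simp add: e'_x diff_left y)
  qed
  have "span ((\<lambda>b. e' b y) ` insert x B) = span (insert x B)" if y: "y \<in> S" for y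
  proof -
    have im: "(\<lambda>b. e' b y) ` B = (\<lambda>b. e b y) ` B" by (auto simp: e'_B)
    have "span (insert (e' x y) ((\<lambda>b. e b y) ` B)) = span (insert x ((\<lambda>b. e b y) ` B))"
      by (rule eq_span_insert_eq) (use span_neg[OF w_span[of y]] in \<open>simp add: e'_x\<close>)
    also have "\<dots> = span (insert x B)" by (simp add: span_insert span_e[OF y])
    finally show ?thesis by (simp add: im)
  qed
  with smooth' nz nz_x orth orth_x show ?case
    by (intro exI[of _ e']) (auto simp: e'_B sym)
qed

lemma orthogonal_frame:
  "\<exists>e :: 'e \<Rightarrow> 'e \<Rightarrow> 'e. (\<forall>b\<in>Basis. smooth_on (e b) S) \<and> (\<forall>y\<in>S. \<forall>b\<in>Basis. h y (e b y) (e b y) > 0) \<and>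
    (\<forall>y\<in>S. \<forall>v. v = (\<Sum>b\<in>Basis. (h y v (e b y) * inverse (h y (e b y) (e b y))) *\<^sub>R e b y))"
proof -
  obtain e :: "'e \<Rightarrow> 'e \<Rightarrow> 'e" where E: "\<forall>b\<in>Basis. smooth_on (e b) S" "\<forall>y\<in>S. \<forall>b\<in>Basis. e b y \<noteq> 0"
    "\<forall>y\<in>S. \<forall>b\<in>Basis. \<forall>b'\<in>Basis. b \<noteq> b' \<longrightarrow> h y (e b y) (e b' y) = 0"
    "\<forall>y\<in>S. span ((\<lambda>b. e b y) ` Basis) = span Basis"
    using orthogonal_frame_on[OF finite_Basis order_refl]
    by (elim exE conjE) (erule (3) that)
  note smooth_e = E(1)[rule_format] and nz = E(2)[rule_format] and orth = E(3)[rule_format]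
    and span_e = E(4)[rule_format, unfolded span_Basis]
  have pos_e: "h y (e b y) (e b y) > 0" if "y \<in> S" "b \<in> Basis" for y b
    using pos nz that by auto
  have "v = (\<Sum>b\<in>Basis. (h y v (e b y) * inverse (h y (e b y) (e b y))) *\<^sub>R e b y)"
    (is "v = ?w") if y: "y \<in> S" for y v
  proof (rule nondegenerate[OF y])
    fix c
    have "h y ?w (e b y) = h y v (e b y)" if b: "b \<in> Basis" for b
    proof -
      have "h y ?w (e b y) = (\<Sum>b'\<in>Basis. h y v (e b' y) * inverse (h y (e b' y) (e b' y)) * h y (e b' y) (e b y))"
        unfolding linear_sum[OF linear_left[OF y]] by (simp add: scale_left y mult.assoc)
      also have "\<dots> = (\<Sum>b'\<in>Basis. if b' = b then h y v (e b y) else 0)"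
        using orth[OF y _ b] pos_e[OF y b] by (intro sum.cong) auto
      also have "\<dots> = h y v (e b y)" using b by (simp add: sum.delta)
      finally show ?thesis .
    qed
    then show "h y v c = h y ?w c"
      by (intro linear_eq_on_span[of "h y v" "h y ?w" "(\<lambda>b. e b y) ` Basis" c])
        (auto simp only: linear_right[OF y] span_e[OF y])
  qed
  with smooth_e pos_e show ?thesis by (intro exI[of _ e]) blast
qed

definition riesz :: "'e \<Rightarrow> ('e \<Rightarrow> real) \<Rightarrow> 'e" where
  "riesz y \<alpha> = (THE v. \<forall>c. h y v c = \<alpha> c)"

lemma riesz_unique:
  assumes "y \<in> S" "\<And>c. h y v c = \<alpha> c"
  shows "riesz y \<alpha> = v"
  unfolding riesz_def
proof (rule the_equality)
  show "\<forall>c. h y v c = \<alpha> c" using assms(2) by blast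
  show "v' = v" if "\<forall>c. h y v' c = \<alpha> c" for v'
    by (rule nondegenerate[OF assms(1)]) (simp add: that assms(2))
qed

lemma metric_frame_sum:
  fixes e :: "'e \<Rightarrow> 'e"
  assumes y: "y \<in> S" and lin: "linear \<alpha>"
    and e: "\<And>v. v = (\<Sum>b\<in>Basis. (h y v (e b) * inverse (h y (e b) (e b))) *\<^sub>R e b)"
  shows "h y (\<Sum>b\<in>Basis. (\<alpha> (e b) * inverse (h y (e b) (e b))) *\<^sub>R e b) c = \<alpha> c"
proof -
  have "h y (\<Sum>b\<in>Basis. (\<alpha> (e b) * inverse (h y (e b) (e b))) *\<^sub>R e b) c =
      (\<Sum>b\<in>Basis. (h y c (e b) * inverse (h y (e b) (e b))) * \<alpha> (e b))"
    unfolding linear_sum[OF linear_left[OF y]] by (simp add: scale_left y sym[OF y, of c] ac_simps)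
  also have "\<dots> = \<alpha> (\<Sum>b\<in>Basis. (h y c (e b) * inverse (h y (e b) (e b))) *\<^sub>R e b)"
    by (simp add: linear_sum[OF lin] linear_cmul[OF lin])
  also have "\<dots> = \<alpha> c" using e[of c] by simp
  finally show ?thesis .
qed

lemma riesz_frame:
  fixes e :: "'e \<Rightarrow> 'e"
  assumes y: "y \<in> S" and lin: "linear \<alpha>"
    and e: "\<And>v. v = (\<Sum>b\<in>Basis. (h y v (e b) * inverse (h y (e b) (e b))) *\<^sub>R e b)"
  shows "riesz y \<alpha> = (\<Sum>b\<in>Basis. (\<alpha> (e b) * inverse (h y (e b) (e b))) *\<^sub>R e b)"
  by (rule riesz_unique[OF y metric_frame_sum[OF y lin e]])

lemma riesz:
  assumes y: "y \<in> S" and lin: "linear \<alpha>"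
  shows "h y (riesz y \<alpha>) c = \<alpha> c"
proof -
  obtain e :: "'e \<Rightarrow> 'e \<Rightarrow> 'e"
    where e: "\<And>v. v = (\<Sum>b\<in>Basis. (h y v (e b y) * inverse (h y (e b y) (e b y))) *\<^sub>R e b y)"
    using orthogonal_frame y by blast
  show ?thesis
    unfolding riesz_frame[OF y lin e] by (rule metric_frame_sum[OF y lin e])
qed

text \<open>This is the smoothness of the inverse metric: in the orthogonal frame the dual vector of a
  covector is given by field operations.\<close>

lemma smooth_on_riesz:
  assumes lin: "\<And>y. y \<in> S \<Longrightarrow> linear (\<alpha> y)" and smooth_\<alpha>: "\<And>v. smooth_on (\<lambda>y. \<alpha> y v) S"
  shows "smooth_on (\<lambda>y. riesz y (\<alpha> y)) S"
proof -
  obtain e :: "'e \<Rightarrow> 'e \<Rightarrow> 'e" where e: "\<And>b. b \<in> Basis \<Longrightarrow> smooth_on (e b) S"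
    "\<And>y b. y \<in> S \<Longrightarrow> b \<in> Basis \<Longrightarrow> h y (e b y) (e b y) > 0"
    "\<And>y v. y \<in> S \<Longrightarrow> v = (\<Sum>b\<in>Basis. (h y v (e b y) * inverse (h y (e b y) (e b y))) *\<^sub>R e b y)"
    using orthogonal_frame by blast
  have "smooth_on (\<lambda>y. h y (e b y) (e b y)) S" if "b \<in> Basis" for b
    by (rule smooth_comp[where \<phi> = "\<lambda>x. x"])
      (use that e(1) open_S in \<open>auto intro: smooth_on_linear bounded_linear_ident\<close>)
  moreover have "smooth_on (\<lambda>y. \<alpha> y (e b y)) S" if "b \<in> Basis" for b
    by (rule smooth_on_linear_family[OF open_S lin smooth_\<alpha>]) (use that e(1) in auto)
  ultimately have "smooth_on (\<lambda>y. \<Sum>b\<in>Basis. (\<alpha> y (e b y) * inverse (h y (e b y) (e b y))) *\<^sub>R e b y) S"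
    by (intro smooth_on_sum smooth_on_scaleR smooth_on_mult smooth_on_inverse open_S e(1)[rule_format])
      (use e(2) in fastforce)+
  then show ?thesis
    by (rule smooth_on_cong_imp[OF open_S, rotated]) (rule riesz_frame[OF _ lin e(3), symmetric])
qed

text \<open>The trace of an endomorphism in the standard basis equals its trace in an orthogonal frame. For
  a skew endomorphism the diagonal entries in that frame vanish, and those of its square are, up to
  positive factors, the numbers \<open>- h (A e) (A e)\<close>.\<close>

lemma trace_skew:
  assumes y: "y \<in> S" and lin: "linear A" and skew: "\<And>u v. h y (A u) v = - h y u (A v)"
  shows trace_skew_zero: "(\<Sum>i\<in>Basis. A i \<bullet> i) = 0"
    and trace_skew_square: "(\<Sum>i\<in>Basis. A (A i) \<bullet> i) = 0 \<Longrightarrow> A v = 0"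
proof -
  obtain e :: "'e \<Rightarrow> 'e \<Rightarrow> 'e" where pos_e: "\<And>b. b \<in> Basis \<Longrightarrow> h y (e b y) (e b y) > 0"
    and e: "\<And>v. v = (\<Sum>b\<in>Basis. (h y v (e b y) * inverse (h y (e b y) (e b y))) *\<^sub>R e b y)"
    using orthogonal_frame y by blast
  have trace: "(\<Sum>i\<in>Basis. L i \<bullet> i) = (\<Sum>b\<in>Basis. h y (L (e b y)) (e b y) * inverse (h y (e b y) (e b y)))"
    if L: "linear L" for L :: "'e \<Rightarrow> 'e"
  proof -
    have "L i \<bullet> i = (\<Sum>b\<in>Basis. h y (L i) (e b y) * inverse (h y (e b y) (e b y)) * (e b y \<bullet> i))" for i
      by (subst e[of "L i"]) (simp only: inner_sum_left inner_scaleR_left)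
    then have "(\<Sum>i\<in>Basis. L i \<bullet> i) =
        (\<Sum>i\<in>Basis. \<Sum>b\<in>Basis. h y (L i) (e b y) * inverse (h y (e b y) (e b y)) * (e b y \<bullet> i))"
      by simp
    also have "\<dots> = (\<Sum>b\<in>Basis. (\<Sum>i\<in>Basis. (e b y \<bullet> i) * h y (L i) (e b y)) * inverse (h y (e b y) (e b y)))"
      by (subst sum.swap) (simp add: sum_distrib_left sum_distrib_right ac_simps)
    also have "\<dots> = (\<Sum>b\<in>Basis. h y (L (e b y)) (e b y) * inverse (h y (e b y) (e b y)))"
    proof (intro sum.cong refl, goal_cases)
      case (1 b)
      have "linear (\<lambda>v. h y (L v) (e b y))"
        using linear_compose[OF L linear_left[OF y]] by (simp add: o_def)
      from linear_eq_sum_Basis[OF this, of "e b y"] show ?case by simp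
    qed
    finally show ?thesis .
  qed
  have "h y (A v) v = 0" for v using skew[of v v] sym[OF y, of v "A v"] by linarith
  then show "(\<Sum>i\<in>Basis. A i \<bullet> i) = 0" by (simp add: trace[OF lin])
  assume tr: "(\<Sum>i\<in>Basis. A (A i) \<bullet> i) = 0"
  have nonneg: "0 \<le> h y (A v) (A v)" for v using pos[OF y, of "A v"] zero_left[OF y]
    by (cases "A v = 0") auto
  have "(\<Sum>i\<in>Basis. A (A i) \<bullet> i) = - (\<Sum>b\<in>Basis. h y (A (e b y)) (A (e b y)) * inverse (h y (e b y) (e b y)))"
    using trace[OF linear_compose[OF lin lin]] by (simp add: skew sum_negf)
  with tr have "(\<Sum>b\<in>Basis. h y (A (e b y)) (A (e b y)) * inverse (h y (e b y) (e b y))) = 0" by simp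
  then have "\<forall>b\<in>Basis. h y (A (e b y)) (A (e b y)) * inverse (h y (e b y) (e b y)) = 0"
    by (subst (asm) sum_nonneg_eq_0_iff) (use pos_e nonneg in \<open>auto intro!: mult_nonneg_nonneg simp: less_imp_le\<close>)
  then have "A (e b y) = 0" if "b \<in> Basis" for b
    using that pos_e[OF that] pos[OF y, of "A (e b y)"] by (metis inverse_zero_imp_zero less_irrefl mult_eq_0_iff)
  then have "A (\<Sum>b\<in>Basis. (h y v (e b y) * inverse (h y (e b y) (e b y))) *\<^sub>R e b y) = 0"
    by (simp add: linear_sum[OF lin] linear_cmul[OF lin])
  then show "A v = 0" using e[of v] by simp
qed

subsection \<open>The Levi-Civita connection and its curvature\<close>

lemma linear_koszul: "y \<in> S \<Longrightarrow> linear (koszul h y u v)"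
  by (rule linearI)
    (simp_all add: koszul_def linear_add[OF deriv_linear] linear_cmul[OF deriv_linear]
      bilinear_radd[OF deriv_bilinear] bilinear_rmul[OF deriv_bilinear] algebra_simps)

lemma linear_koszul_half: "y \<in> S \<Longrightarrow> linear (\<lambda>c. koszul h y u v c / 2)"
  by (rule linearI)
    (simp_all add: linear_add[OF linear_koszul] linear_cmul[OF linear_koszul] add_divide_distrib)

lemma christoffel_eq_riesz:
  assumes y: "y \<in> S"
  shows "christoffel h y u v = riesz y (\<lambda>c. koszul h y u v c / 2)"
proof (rule christoffel_eqI)
  show "2 * h y (riesz y (\<lambda>c. koszul h y u v c / 2)) c = koszul h y u v c" for c
    by (simp add: riesz[OF y linear_koszul_half[OF y]])
qed (rule nondegenerate[OF y])

lemma christoffel_koszul: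
  assumes y: "y \<in> S"
  shows "2 * h y (christoffel h y u v) c = koszul h y u v c"
  by (simp add: christoffel_eq_riesz[OF y] riesz[OF y linear_koszul_half[OF y]])

lemma deriv_sym: "y \<in> S \<Longrightarrow> dir_deriv (\<lambda>z. h z u v) y a = dir_deriv (\<lambda>z. h z v u) y a"
  by (rule dir_deriv_cong_open[OF open_S]) (auto intro: sym)

lemma christoffel_sym: "y \<in> S \<Longrightarrow> christoffel h y u v = christoffel h y v u"
  by (simp add: christoffel_eq_riesz koszul_def deriv_sym[of y u v] add.commute)

lemma christoffel_metric:
  assumes y: "y \<in> S"
  shows "dir_deriv (\<lambda>z. h z u v) y a = h y (christoffel h y a u) v + h y u (christoffel h y a v)"
  using christoffel_koszul[OF y, of a u v] christoffel_koszul[OF y, of a v u]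
    sym[OF y, of u "christoffel h y a v"] deriv_sym[OF y, of v u a] deriv_sym[OF y, of a u v]
    deriv_sym[OF y, of a v u] unfolding koszul_def by linarith

sublocale conn: smooth_bilinear S "christoffel h"
proof
  show "open S" by (rule open_S)
  show "bilinear (christoffel h y)" if y: "y \<in> S" for y
  proof -
    note bl = bilinear_ladd[OF deriv_bilinear[OF y]] bilinear_radd[OF deriv_bilinear[OF y]]
      bilinear_lmul[OF deriv_bilinear[OF y]] bilinear_rmul[OF deriv_bilinear[OF y]]
      linear_add[OF deriv_linear[OF y]] linear_cmul[OF deriv_linear[OF y]]
    have add: "christoffel h y (u + u') v = christoffel h y u v + christoffel h y u' v" for u u' v
    proof (rule nondegenerate[OF y])
      fix c
      have "2 * h y (christoffel h y (u + u') v) c =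
          2 * h y (christoffel h y u v) c + 2 * h y (christoffel h y u' v) c"
        unfolding christoffel_koszul[OF y] by (simp add: koszul_def bl)
      then show "h y (christoffel h y (u + u') v) c = h y (christoffel h y u v + christoffel h y u' v) c"
        by (simp add: add_left[OF y])
    qed
    have scale: "christoffel h y (r *\<^sub>R u) v = r *\<^sub>R christoffel h y u v" for r u v
    proof (rule nondegenerate[OF y])
      fix c
      have "2 * h y (christoffel h y (r *\<^sub>R u) v) c = r * (2 * h y (christoffel h y u v) c)"
        unfolding christoffel_koszul[OF y] by (simp add: koszul_def bl algebra_simps)
      then show "h y (christoffel h y (r *\<^sub>R u) v) c = h y (r *\<^sub>R christoffel h y u v) c"
        by (simp add: scale_left[OF y])
    qed
    have lin: "linear (\<lambda>u. christoffel h y u v)" for v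
      by (rule linearI) (simp_all add: add scale)
    moreover have "christoffel h y u = (\<lambda>v. christoffel h y v u)" for u
      by (rule ext) (rule christoffel_sym[OF y])
    ultimately show ?thesis unfolding bilinear_def by metis
  qed
  show "smooth_on (\<lambda>y. christoffel h y u v) S" for u v
  proof (rule smooth_on_cong_imp[OF open_S])
    show "smooth_on (\<lambda>y. riesz y (\<lambda>c. koszul h y u v c / 2)) S"
    proof (rule smooth_on_riesz)
      show "linear (\<lambda>c. koszul h y u v c / 2)" if "y \<in> S" for y
        by (rule linear_koszul_half[OF that])
      show "smooth_on (\<lambda>y. koszul h y u v c / 2) S" for c
        unfolding koszul_def divide_inverse
        by (intro smooth_on_mult smooth_on_const smooth_on_add smooth_on_diff smooth_on_dir_deriv smooth open_S)
    qed
  qed (simp add: christoffel_eq_riesz)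
qed

lemma smooth_curvature: "smooth_on (\<lambda>y. curvature_coord h y a b c) S"
  unfolding curvature_coord_def
  by (intro smooth_on_add smooth_on_diff smooth_on_dir_deriv conn.smooth open_S
      conn.smooth_comp[where \<phi> = "\<lambda>x. x"] smooth_on_const smooth_on_linear[OF bounded_linear_ident])
    auto

lemma curvature_skew: "curvature_coord h y a b c = - curvature_coord h y b a c"
  by (simp add: curvature_coord_def)

lemma linear_curvature:
  assumes y: "y \<in> S"
  shows linear_curvature1: "linear (\<lambda>a. curvature_coord h y a b c)"
    and linear_curvature2: "linear (\<lambda>b. curvature_coord h y a b c)"
    and linear_curvature3: "linear (\<lambda>c. curvature_coord h y a b c)"
proof -
  note bl = linear_add[OF conn.deriv_linear[OF y]] linear_cmul[OF conn.deriv_linear[OF y]]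
    bilinear_ladd[OF conn.deriv_bilinear[OF y]] bilinear_radd[OF conn.deriv_bilinear[OF y]]
    bilinear_lmul[OF conn.deriv_bilinear[OF y]] bilinear_rmul[OF conn.deriv_bilinear[OF y]]
    conn.add_left[OF y] conn.add_right[OF y] conn.scale_left[OF y] conn.scale_right[OF y]
  show "linear (\<lambda>a. curvature_coord h y a b c)" "linear (\<lambda>b. curvature_coord h y a b c)"
    "linear (\<lambda>c. curvature_coord h y a b c)"
    by (rule linearI; simp add: curvature_coord_def bl scaleR_add_right scaleR_diff_right)+
qed

end


section \<open>The tangent bundle over a coordinate domain\<close>

context local_metric
begin

abbreviation T :: "('e \<times> 'e) set" where "T \<equiv> S \<times> UNIV"

lemma open_T: "open T"
  by (simp add: open_S open_Times)

lemma smooth_fst: "smooth_on fst T" and smooth_snd: "smooth_on snd T"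
  by (intro smooth_on_linear bounded_linear_fst bounded_linear_snd)+

lemma metric_smooth: "smooth_on f T \<Longrightarrow> smooth_on f' T \<Longrightarrow> smooth_on (\<lambda>z. h (fst z) (f z) (f' z)) T"
  by (rule smooth_comp[OF open_T smooth_fst]) auto

lemma conn_smooth: "smooth_on f T \<Longrightarrow> smooth_on f' T \<Longrightarrow> smooth_on (\<lambda>z. christoffel h (fst z) (f z) (f' z)) T"
  by (rule conn.smooth_comp[OF open_T smooth_fst]) auto

text \<open>An \<open>'e\<close>-valued function on the tangent bundle is regarded as a section of the tangent bundle
  pulled back to itself along its projection; \<open>cov\<close> is the pulled back Levi-Civita connection.\<close>

definition cov :: "('e \<times> 'e \<Rightarrow> 'e) \<Rightarrow> 'e \<times> 'e \<Rightarrow> 'e \<times> 'e \<Rightarrow> 'e" where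
  "cov f z \<xi> = dir_deriv f z \<xi> + christoffel h (fst z) (fst \<xi>) (f z)"

lemma smooth_on_has_derivative:
  "smooth_on f T \<Longrightarrow> z \<in> T \<Longrightarrow> (f has_derivative dir_deriv f z) (at z)"
  by (intro has_derivative_dir_deriv smooth_on_differentiable)

lemma has_derivative_fst_at: "(fst has_derivative fst) (at z)"
  by (rule bounded_linear_imp_has_derivative[OF bounded_linear_fst])

lemma metric_deriv:
  assumes "smooth_on f T" "smooth_on f' T" "z \<in> T"
  shows "((\<lambda>z. h (fst z) (f z) (f' z)) has_derivative
    (\<lambda>\<xi>. h (fst z) (cov f z \<xi>) (f' z) + h (fst z) (f z) (cov f' z \<xi>))) (at z)"
proof -
  have z: "fst z \<in> S" using assms by auto
  show ?thesis
    by (rule has_derivative_eq_rhs[OF product_rule[OF open_T assms(3) _ has_derivative_fst_at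
          smooth_on_has_derivative[OF assms(1,3)] smooth_on_has_derivative[OF assms(2,3)]]])
      (use z in \<open>auto simp: fun_eq_iff christoffel_metric cov_def add_left add_right\<close>)
qed

lemma conn_deriv:
  assumes "smooth_on f T" "smooth_on f' T" "z \<in> T"
  shows "dir_deriv (\<lambda>z. christoffel h (fst z) (f z) (f' z)) z \<xi> =
    christoffel h (fst z) (dir_deriv f z \<xi>) (f' z) + christoffel h (fst z) (f z) (dir_deriv f' z \<xi>) +
    dir_deriv (\<lambda>y. christoffel h y (f z) (f' z)) (fst z) (fst \<xi>)"
  by (rule dir_deriv_eq[OF conn.product_rule[OF open_T assms(3) _ has_derivative_fst_at
        smooth_on_has_derivative[OF assms(1,3)] smooth_on_has_derivative[OF assms(2,3)]]]) auto

lemma smooth_cov: "smooth_on f T \<Longrightarrow> smooth_on (\<lambda>z. cov f z \<xi>) T"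
  unfolding cov_def by (intro smooth_on_add open_T smooth_on_dir_deriv conn_smooth smooth_on_const)

lemma cov_cong:
  assumes "\<And>z. z \<in> T \<Longrightarrow> f z = f' z" "z \<in> T"
  shows "cov f z \<xi> = cov f' z \<xi>"
  using dir_deriv_cong_open[OF open_T assms(2,1)] assms by (simp add: cov_def)

text \<open>The curvature of a pulled back connection is the pulled back curvature: second derivatives of
  \<open>f\<close> cancel because they commute, and first derivatives cancel in pairs.\<close>

lemma cov_curvature:
  assumes f: "smooth_on f T" and z: "z \<in> T"
  shows "cov (\<lambda>z. cov f z \<eta>) z \<xi> - cov (\<lambda>z. cov f z \<xi>) z \<eta> =
    curvature_coord h (fst z) (fst \<xi>) (fst \<eta>) (f z)"
proof -
  have S: "fst z \<in> S" using z by auto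
  have "cov (\<lambda>z. cov f z \<eta>) z \<xi> = dir_deriv (\<lambda>z. dir_deriv f z \<eta>) z \<xi> +
      (christoffel h (fst z) (fst \<eta>) (dir_deriv f z \<xi>) +
       dir_deriv (\<lambda>y. christoffel h y (fst \<eta>) (f z)) (fst z) (fst \<xi>)) +
      (christoffel h (fst z) (fst \<xi>) (dir_deriv f z \<eta>) +
       christoffel h (fst z) (fst \<xi>) (christoffel h (fst z) (fst \<eta>) (f z)))" for \<xi> \<eta>
  proof -
    have "dir_deriv (\<lambda>z. cov f z \<eta>) z \<xi> = dir_deriv (\<lambda>z. dir_deriv f z \<eta>) z \<xi> +
        dir_deriv (\<lambda>z. christoffel h (fst z) (fst \<eta>) (f z)) z \<xi>"
      unfolding cov_def
      by (rule dir_deriv_eq[OF has_derivative_add])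
        (intro smooth_on_has_derivative z smooth_on_dir_deriv conn_smooth smooth_on_const f)+
    then show ?thesis
      by (simp add: cov_def conn_deriv[OF smooth_on_const f z] conn.add_right[OF S] conn.zero_left[OF S])
  qed
  then show ?thesis
    by (simp add: curvature_coord_def mixed_dir_deriv_commute[OF open_T f z, of \<xi> \<eta>])
qed

text \<open>The second derivatives of the function \<open>h (c, c)\<close>, for a constant field \<open>c\<close>, commute. Expressed
  through the connection their commutator is \<open>2 h (R(a, b)c, c)\<close>.\<close>

lemma curvature_metric_skew:
  assumes y: "y \<in> S"
  shows "h y (curvature_coord h y a b c) c = 0"
proof -
  define z :: "'e \<times> 'e" where "z = (y, 0)"
  define f where "f = (\<lambda>_::'e \<times> 'e. c)"
  have z: "z \<in> T" and f: "smooth_on f T" using y by (auto simp: z_def f_def smooth_on_const)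
  have D: "dir_deriv (\<lambda>z. dir_deriv (\<lambda>z. h (fst z) (f z) (f z)) z \<eta>) z \<xi> =
      2 * (h (fst z) (cov (\<lambda>z. cov f z \<eta>) z \<xi>) (f z) + h (fst z) (cov f z \<eta>) (cov f z \<xi>))" for \<xi> \<eta>
  proof -
    have "dir_deriv (\<lambda>z. dir_deriv (\<lambda>z. h (fst z) (f z) (f z)) z \<eta>) z \<xi> =
        dir_deriv (\<lambda>z. 2 * h (fst z) (cov f z \<eta>) (f z)) z \<xi>"
      by (rule dir_deriv_cong_open[OF open_T z])
        (auto simp: dir_deriv_eq[OF metric_deriv[OF f f]] sym)
    also have "\<dots> = 2 * (h (fst z) (cov (\<lambda>z. cov f z \<eta>) z \<xi>) (f z) + h (fst z) (cov f z \<eta>) (cov f z \<xi>))"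
      by (rule dir_deriv_eq[OF has_derivative_mult_right[OF metric_deriv[OF smooth_cov[OF f] f z]]])
    finally show ?thesis .
  qed
  have "h (fst z) (cov (\<lambda>z. cov f z (b, 0)) z (a, 0)) (f z) = h (fst z) (cov (\<lambda>z. cov f z (a, 0)) z (b, 0)) (f z)"
    using mixed_dir_deriv_commute[OF open_T metric_smooth[OF f f] z, of "(b, 0)" "(a, 0)"]
      sym[OF y, of "cov f z (b, 0)" "cov f z (a, 0)"] unfolding D by (simp add: z_def)
  then have "h (fst z) (cov (\<lambda>z. cov f z (b, 0)) z (a, 0) - cov (\<lambda>z. cov f z (a, 0)) z (b, 0)) (f z) = 0"
    using y by (simp add: diff_left z_def)
  then show ?thesis unfolding cov_curvature[OF f z] by (simp add: z_def f_def)
qed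

lemma curvature_metric_skew':
  assumes y: "y \<in> S"
  shows "h y d (curvature_coord h y a b c) = - h y c (curvature_coord h y a b d)"
  using curvature_metric_skew[OF y, of a b "c + d"] curvature_metric_skew[OF y, of a b c]
    curvature_metric_skew[OF y, of a b d] sym[OF y]
  by (simp add: linear_add[OF linear_curvature3[OF y]] add_left[OF y] add_right[OF y])

text \<open>The decomposition \<open>\<eta> = X\<^sup>h + Y\<^sup>v\<close> of a tangent vector at \<open>z = (y, u)\<close> has \<open>X = fst \<eta>\<close> and
  \<open>Y = vpart z \<eta>\<close>, since \<open>X\<^sup>h = (X, - \<Gamma>(u, X))\<close>.\<close>

definition vpart :: "'e \<times> 'e \<Rightarrow> 'e \<times> 'e \<Rightarrow> 'e" where
  "vpart z \<eta> = snd \<eta> + christoffel h (fst z) (snd z) (fst \<eta>)"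

lemma linear_vpart: "z \<in> T \<Longrightarrow> linear (vpart z)"
  unfolding vpart_def
  by (rule linearI) (auto simp: conn.add_right conn.scale_right scaleR_add_right)

lemma vpart_vertical: "z \<in> T \<Longrightarrow> vpart z (0, v) = v"
  by (auto simp: vpart_def conn.zero_right)

lemma parts_eqI: "fst \<xi> = fst \<eta> \<Longrightarrow> vpart z \<xi> = vpart z \<eta> \<Longrightarrow> \<xi> = \<eta>"
  by (simp add: vpart_def prod_eq_iff)

lemma smooth_vpart: "smooth_on f T \<Longrightarrow> smooth_on (\<lambda>z. vpart z (f z)) T"
  unfolding vpart_def
  by (intro smooth_on_add open_T smooth_on_snd smooth_on_fst conn_smooth smooth_snd)

lemma cov_vpart:
  assumes z: "z \<in> T"
  shows "cov (\<lambda>z. vpart z \<eta>) z \<xi> =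
    christoffel h (fst z) (snd \<xi>) (fst \<eta>) + christoffel h (fst z) (fst \<xi>) (snd \<eta>)
    + dir_deriv (\<lambda>y. christoffel h y (snd z) (fst \<eta>)) (fst z) (fst \<xi>)
    + christoffel h (fst z) (fst \<xi>) (christoffel h (fst z) (snd z) (fst \<eta>))"
proof -
  have S: "fst z \<in> S" using z by auto
  have "dir_deriv (\<lambda>z. vpart z \<eta>) z \<xi> = dir_deriv (\<lambda>z. christoffel h (fst z) (snd z) (fst \<eta>)) z \<xi>"
    unfolding vpart_def
    by (rule trans[OF dir_deriv_eq[OF has_derivative_add[OF has_derivative_const
          smooth_on_has_derivative[OF conn_smooth[OF smooth_snd smooth_on_const] z]]]]) simp
  also have "\<dots> = christoffel h (fst z) (snd \<xi>) (fst \<eta>) +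
      dir_deriv (\<lambda>y. christoffel h y (snd z) (fst \<eta>)) (fst z) (fst \<xi>)"
    using conn_deriv[OF smooth_snd smooth_on_const z, of "fst \<eta>" \<xi>]
      dir_deriv_eq[OF bounded_linear_imp_has_derivative[OF bounded_linear_snd], of z]
    by (simp add: conn.zero_right[OF S])
  finally show ?thesis by (simp add: cov_def vpart_def conn.add_right[OF S])
qed

text \<open>This connection on the tangent bundle acts by \<open>cov\<close> on the horizontal and on the vertical part
  of a vector field separately. The subtracted term in the second coordinate converts a vertical
  part back into a coordinate component.\<close>

definition hconn :: "'e \<times> 'e \<Rightarrow> 'e \<times> 'e \<Rightarrow> 'e \<times> 'e \<Rightarrow> 'e \<times> 'e" where
  "hconn z \<xi> \<eta> = (christoffel h (fst z) (fst \<xi>) (fst \<eta>),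
     cov (\<lambda>z. vpart z \<eta>) z \<xi> - christoffel h (fst z) (snd z) (christoffel h (fst z) (fst \<xi>) (fst \<eta>)))"

lemma fst_hconn: "fst (hconn z \<xi> \<eta>) = christoffel h (fst z) (fst \<xi>) (fst \<eta>)"
  by (simp add: hconn_def)

lemma vpart_hconn: "vpart z (hconn z \<xi> \<eta>) = cov (\<lambda>z. vpart z \<eta>) z \<xi>"
  by (simp add: vpart_def[of z] hconn_def)

lemma smooth_hconn: "smooth_on (\<lambda>z. hconn z \<xi> \<eta>) T"
  unfolding hconn_def
  by (intro smooth_on_Pair smooth_on_diff open_T conn_smooth smooth_on_const smooth_cov smooth_vpart smooth_snd)

text \<open>The torsion of \<open>hconn\<close> measures the non-integrability of the horizontal distribution, so it is
  vertical and given by the curvature of the base.\<close>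

lemma torsion_hconn:
  assumes z: "z \<in> T"
  shows "hconn z \<xi> \<eta> - hconn z \<eta> \<xi> = (0, curvature_coord h (fst z) (fst \<xi>) (fst \<eta>) (snd z))"
proof (rule parts_eqI[of _ _ z])
  have S: "fst z \<in> S" using z by auto
  have sym': "dir_deriv (\<lambda>y. christoffel h y u v) (fst z) w = dir_deriv (\<lambda>y. christoffel h y v u) (fst z) w" for u v w
    by (rule dir_deriv_cong_open[OF open_S S]) (rule christoffel_sym)
  show "fst (hconn z \<xi> \<eta> - hconn z \<eta> \<xi>) = fst (0, curvature_coord h (fst z) (fst \<xi>) (fst \<eta>) (snd z))"
    by (simp add: fst_hconn christoffel_sym[OF S, of "fst \<xi>"])
  show "vpart z (hconn z \<xi> \<eta> - hconn z \<eta> \<xi>) =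
      vpart z (0, curvature_coord h (fst z) (fst \<xi>) (fst \<eta>) (snd z))"
    unfolding linear_diff[OF linear_vpart[OF z]] vpart_hconn vpart_vertical[OF z] cov_vpart[OF z]
      curvature_coord_def
    by (simp add: christoffel_sym[OF S, of "snd z"] christoffel_sym[OF S, of "snd \<xi>"]
        christoffel_sym[OF S, of "snd \<eta>"] sym'[of "snd z"])
qed

lemma cov_vpart_moving:
  assumes F: "smooth_on F T" and z: "z \<in> T"
  shows "cov (\<lambda>z. vpart z (F z)) z \<xi> = vpart z (dir_deriv F z \<xi> + hconn z \<xi> (F z))"
proof -
  have S: "fst z \<in> S" using z by auto
  have "((\<lambda>x. vpart x (F x)) has_derivative
      (\<lambda>\<xi>. vpart z (dir_deriv F z \<xi>) + dir_deriv (\<lambda>x. vpart x (F z)) z \<xi>)) (at z)"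
    by (rule has_derivative_linear_family[where \<phi> = "\<lambda>x. x", OF open_T z linear_vpart _ has_derivative_ident
          smooth_on_has_derivative[OF F z]])
      (assumption, rule smooth_on_differentiable[OF smooth_vpart[OF smooth_on_const] z])
  from dir_deriv_eq[OF this] show ?thesis
    by (simp add: linear_add[OF linear_vpart[OF z]] vpart_hconn) (simp add: cov_def)
qed

text \<open>Since \<open>hconn\<close> acts on each part as the pulled back connection, its curvature acts on each part as
  the curvature of the base.\<close>

lemma hconn_curvature:
  fixes \<xi> \<eta> \<zeta> z :: "'e \<times> 'e"
  assumes z: "z \<in> T"
  defines "Rm \<equiv> dir_deriv (\<lambda>z. hconn z \<eta> \<zeta>) z \<xi> - dir_deriv (\<lambda>z. hconn z \<xi> \<zeta>) z \<eta>
     + hconn z \<xi> (hconn z \<eta> \<zeta>) - hconn z \<eta> (hconn z \<xi> \<zeta>)"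
  shows "fst Rm = curvature_coord h (fst z) (fst \<xi>) (fst \<eta>) (fst \<zeta>)"
    and "vpart z Rm = curvature_coord h (fst z) (fst \<xi>) (fst \<eta>) (vpart z \<zeta>)"
proof -
  have S: "fst z \<in> S" using z by auto
  have "fst (dir_deriv (\<lambda>z. hconn z \<eta> \<zeta>) z \<xi>) =
      dir_deriv (\<lambda>y. christoffel h y (fst \<eta>) (fst \<zeta>)) (fst z) (fst \<xi>)" for \<xi> \<eta>
  proof -
    have "fst (dir_deriv (\<lambda>z. hconn z \<eta> \<zeta>) z \<xi>) = dir_deriv (\<lambda>z. fst (hconn z \<eta> \<zeta>)) z \<xi>"
      by (rule dir_deriv_eq[OF has_derivative_fst[OF smooth_on_has_derivative[OF smooth_hconn z]], symmetric])
    also have "\<dots> = dir_deriv (\<lambda>z. christoffel h (fst z) (fst \<eta>) (fst \<zeta>)) z \<xi>"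
      by (simp add: fst_hconn)
    also have "\<dots> = dir_deriv (\<lambda>y. christoffel h y (fst \<eta>) (fst \<zeta>)) (fst z) (fst \<xi>)"
      using conn_deriv[OF smooth_on_const smooth_on_const z, of "fst \<eta>" "fst \<zeta>" \<xi>]
      by (simp add: conn.zero_left[OF S] conn.zero_right[OF S])
    finally show ?thesis .
  qed
  then show "fst Rm = curvature_coord h (fst z) (fst \<xi>) (fst \<eta>) (fst \<zeta>)"
    by (simp add: Rm_def fst_hconn curvature_coord_def)
  have v: "vpart z (dir_deriv (\<lambda>z. hconn z \<eta> \<zeta>) z \<xi> + hconn z \<xi> (hconn z \<eta> \<zeta>)) =
      cov (\<lambda>z. cov (\<lambda>z. vpart z \<zeta>) z \<eta>) z \<xi>" for \<xi> \<eta>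
    unfolding cov_vpart_moving[OF smooth_hconn z, symmetric] vpart_hconn ..
  have "Rm = (dir_deriv (\<lambda>z. hconn z \<eta> \<zeta>) z \<xi> + hconn z \<xi> (hconn z \<eta> \<zeta>)) -
      (dir_deriv (\<lambda>z. hconn z \<xi> \<zeta>) z \<eta> + hconn z \<eta> (hconn z \<xi> \<zeta>))"
    by (simp add: Rm_def)
  then show "vpart z Rm = curvature_coord h (fst z) (fst \<xi>) (fst \<eta>) (vpart z \<zeta>)"
    by (simp only: linear_diff[OF linear_vpart[OF z]] v cov_curvature[OF smooth_vpart[OF smooth_on_const] z])
qed

end

section \<open>The lifted metric in coordinates\<close>

locale lifted_metric = local_metric S h
  for S :: "'e::euclidean_space set" and h +
  fixes a b c :: real
  assumes a_nz: "a \<noteq> 0" and det_nz: "a * (a + c) - b\<^sup>2 \<noteq> 0"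
begin

text \<open>The coordinate expression of \<open>a g\<^sup>s + b g\<^sup>h + c g\<^sup>v\<close>.\<close>

definition lift :: "'e \<times> 'e \<Rightarrow> 'e \<times> 'e \<Rightarrow> 'e \<times> 'e \<Rightarrow> real" where
  "lift z \<xi> \<eta> =
     a * (h (fst z) (fst \<xi>) (fst \<eta>) + h (fst z) (vpart z \<xi>) (vpart z \<eta>)) +
     b * (h (fst z) (fst \<xi>) (vpart z \<eta>) + h (fst z) (vpart z \<xi>) (fst \<eta>)) +
     c * h (fst z) (fst \<xi>) (fst \<eta>)"

sublocale L: smooth_bilinear T lift
proof
  show "open T" by (rule open_T)
  show "bilinear (lift z)" if z: "z \<in> T" for z
  proof -
    have S: "fst z \<in> S" using z by auto
    note lin = linear_add[OF linear_vpart[OF z]] linear_cmul[OF linear_vpart[OF z]]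
      add_left[OF S] add_right[OF S] scale_left[OF S] scale_right[OF S]
    show ?thesis unfolding bilinear_def
      by (intro allI conjI linearI) (simp_all add: lift_def lin algebra_simps)
  qed
  show "smooth_on (\<lambda>z. lift z \<xi> \<eta>) T" for \<xi> \<eta>
    unfolding lift_def
    by (intro smooth_on_add smooth_on_mult smooth_on_const metric_smooth smooth_vpart open_T)
qed

lemma lift_sym: "z \<in> T \<Longrightarrow> lift z \<xi> \<eta> = lift z \<eta> \<xi>"
  by (auto simp: lift_def sym)

text \<open>Pairing with vertical and with horizontal vectors yields two linear equations for the two parts,
  with determinant \<open>a (a + c) - b\<^sup>2\<close>.\<close>

lemma lift_nondegenerate:
  assumes z: "z \<in> T" and eq: "\<And>\<zeta>. lift z \<xi> \<zeta> = lift z \<eta> \<zeta>"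
  shows "\<xi> = \<eta>"
proof -
  have S: "fst z \<in> S" using z by auto
  define \<delta> where "\<delta> = \<xi> - \<eta>"
  have 0: "lift z \<delta> \<zeta> = 0" for \<zeta> using eq by (simp add: \<delta>_def L.diff_left[OF z])
  have "h (fst z) (b *\<^sub>R fst \<delta> + a *\<^sub>R vpart z \<delta>) w = h (fst z) 0 w" for w
    using 0[of "(0, w)"] by (simp add: lift_def vpart_vertical[OF z] zero_right[OF S] zero_left[OF S]
        add_left[OF S] scale_left[OF S])
  then have 1: "b *\<^sub>R fst \<delta> + a *\<^sub>R vpart z \<delta> = 0" by (rule nondegenerate[OF S])
  have "h (fst z) ((a + c) *\<^sub>R fst \<delta> + b *\<^sub>R vpart z \<delta>) w = h (fst z) 0 w" for w
    using 0[of "(w, - christoffel h (fst z) (snd z) w)"]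
    by (simp add: lift_def vpart_def[of z "(w, _)"] zero_right[OF S] zero_left[OF S]
        add_left[OF S] scale_left[OF S] algebra_simps)
  then have 2: "(a + c) *\<^sub>R fst \<delta> + b *\<^sub>R vpart z \<delta> = 0" by (rule nondegenerate[OF S])
  have "(a * (a + c) - b\<^sup>2) *\<^sub>R fst \<delta> =
      a *\<^sub>R ((a + c) *\<^sub>R fst \<delta> + b *\<^sub>R vpart z \<delta>) - b *\<^sub>R (b *\<^sub>R fst \<delta> + a *\<^sub>R vpart z \<delta>)"
    by (simp add: algebra_simps power2_eq_square)
  then have "fst \<delta> = 0" using 1 2 det_nz by simp
  moreover from this 1 have "vpart z \<delta> = 0" using a_nz by simp
  ultimately have "\<delta> = 0"
    by (intro parts_eqI[of _ _ z]) (simp_all add: linear_0[OF linear_vpart[OF z]])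
  then show ?thesis by (simp add: \<delta>_def)
qed

text \<open>The form \<open>lift\<close> has constant coefficients in terms of the parts, and \<open>h\<close> is parallel for \<open>cov\<close>; so
  \<open>hconn\<close> is a metric connection.\<close>

lemma lift_parallel:
  assumes z: "z \<in> T"
  shows "dir_deriv (\<lambda>z. lift z \<eta> \<zeta>) z \<xi> = lift z (hconn z \<xi> \<eta>) \<zeta> + lift z \<eta> (hconn z \<xi> \<zeta>)"
proof -
  have cov_const: "cov (\<lambda>_. fst \<eta>) z \<xi> = fst (hconn z \<xi> \<eta>)" for \<xi> \<eta>
    by (simp add: cov_def fst_hconn)
  note D = metric_deriv[OF smooth_on_const[of "fst \<eta>"] smooth_on_const[of "fst \<zeta>"] z]
    metric_deriv[OF smooth_vpart[OF smooth_on_const[of \<eta>]] smooth_vpart[OF smooth_on_const[of \<zeta>]] z]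
    metric_deriv[OF smooth_on_const[of "fst \<eta>"] smooth_vpart[OF smooth_on_const[of \<zeta>]] z]
    metric_deriv[OF smooth_vpart[OF smooth_on_const[of \<eta>]] smooth_on_const[of "fst \<zeta>"] z]
  have "((\<lambda>z. lift z \<eta> \<zeta>) has_derivative (\<lambda>\<xi>. lift z (hconn z \<xi> \<eta>) \<zeta> + lift z \<eta> (hconn z \<xi> \<zeta>))) (at z)"
    unfolding lift_def
    by (rule has_derivative_eq_rhs[OF has_derivative_add[OF has_derivative_add[OF
          has_derivative_mult_right[OF has_derivative_add[OF D(1,2)]]
          has_derivative_mult_right[OF has_derivative_add[OF D(3,4)]]]
          has_derivative_mult_right[OF D(1)]]])
      (simp add: fun_eq_iff cov_const vpart_hconn algebra_simps)
  then show ?thesis by (rule dir_deriv_eq)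
qed

text \<open>Substituting a metric connection into the Koszul formula leaves its symmetric part and two torsion
  terms.\<close>

lemma koszul_lift:
  assumes z: "z \<in> T"
  shows "koszul lift z \<xi> \<eta> \<zeta> = lift z (hconn z \<xi> \<eta> + hconn z \<eta> \<xi>) \<zeta>
    + lift z \<eta> (0, curvature_coord h (fst z) (fst \<xi>) (fst \<zeta>) (snd z))
    + lift z \<xi> (0, curvature_coord h (fst z) (fst \<eta>) (fst \<zeta>) (snd z))"
  unfolding koszul_def lift_parallel[OF z] torsion_hconn[OF z, symmetric]
  by (simp add: L.add_left[OF z] L.diff_right[OF z] lift_sym[OF z, of \<xi> "hconn z \<eta> \<zeta>"]
      lift_sym[OF z, of \<eta> "hconn z \<xi> \<zeta>"] lift_sym[OF z, of \<xi> "hconn z \<zeta> \<eta>"]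
      lift_sym[OF z, of \<eta> "hconn z \<zeta> \<xi>"])

lemma lift_vertical:
  "z \<in> T \<Longrightarrow> lift z (0, v) \<eta> = b * h (fst z) v (fst \<eta>) + a * h (fst z) v (vpart z \<eta>)"
  by (auto simp: lift_def vpart_vertical zero_left)

lemma christoffel_lift_eqI:
  assumes "z \<in> T" "\<And>\<zeta>. 2 * lift z v \<zeta> = koszul lift z \<xi> \<eta> \<zeta>"
  shows "christoffel lift z \<xi> \<eta> = v"
  using assms(2) lift_nondegenerate[OF assms(1)] by (rule christoffel_eqI) 

text \<open>Over a flat base \<open>hconn\<close> is torsion free, hence the Levi-Civita connection.\<close>

lemma christoffel_lift_flat:
  assumes flat: "\<And>u v w. curvature_coord h (fst z) u v w = 0" and z: "z \<in> T"
  shows "christoffel lift z \<xi> \<eta> = hconn z \<xi> \<eta>"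
proof (rule christoffel_lift_eqI[OF z])
  have "hconn z \<eta> \<xi> = hconn z \<xi> \<eta>"
    using torsion_hconn[OF z, of \<xi> \<eta>] by (simp add: flat zero_prod_def[symmetric])
  then show "2 * lift z (hconn z \<xi> \<eta>) \<zeta> = koszul lift z \<xi> \<eta> \<zeta>" for \<zeta>
    unfolding koszul_lift[OF z] flat
    by (simp add: zero_prod_def[symmetric] L.zero_right[OF z] L.add_left[OF z])
qed

lemma ricci_lift_flat:
  assumes flat: "\<And>y u v w. y \<in> S \<Longrightarrow> curvature_coord h y u v w = 0" and z: "z \<in> T"
  shows "ricci_coord lift z \<eta> \<zeta> = 0"
proof -
  have "curvature_coord lift z \<xi> \<eta> \<zeta> = 0" for \<xi> \<eta> \<zeta>
  proof -
    have chr: "christoffel lift z \<xi> \<eta> = hconn z \<xi> \<eta>" if "z \<in> T" for z \<xi> \<eta>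
      by (rule christoffel_lift_flat[OF flat that]) (use that in auto)
    have "dir_deriv (\<lambda>z. christoffel lift z \<eta> \<zeta>) z \<xi> = dir_deriv (\<lambda>z. hconn z \<eta> \<zeta>) z \<xi>" for \<xi> \<eta>
      by (rule dir_deriv_cong_open[OF open_T z chr])
    then have "curvature_coord lift z \<xi> \<eta> \<zeta> =
        dir_deriv (\<lambda>z. hconn z \<eta> \<zeta>) z \<xi> - dir_deriv (\<lambda>z. hconn z \<xi> \<zeta>) z \<eta>
        + hconn z \<xi> (hconn z \<eta> \<zeta>) - hconn z \<eta> (hconn z \<xi> \<zeta>)"
      by (simp add: curvature_coord_def chr[OF z])
    moreover have "\<dots> = 0"
    proof (rule parts_eqI[of _ _ z])
      have "curvature_coord h (fst z) u v w = 0" for u v w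
        using z by (intro flat) auto
      then show "fst (dir_deriv (\<lambda>z. hconn z \<eta> \<zeta>) z \<xi> - dir_deriv (\<lambda>z. hconn z \<xi> \<zeta>) z \<eta>
          + hconn z \<xi> (hconn z \<eta> \<zeta>) - hconn z \<eta> (hconn z \<xi> \<zeta>)) = fst 0"
        "vpart z (dir_deriv (\<lambda>z. hconn z \<eta> \<zeta>) z \<xi> - dir_deriv (\<lambda>z. hconn z \<xi> \<zeta>) z \<eta>
          + hconn z \<xi> (hconn z \<eta> \<zeta>) - hconn z \<eta> (hconn z \<xi> \<zeta>)) = vpart z 0"
        unfolding hconn_curvature[OF z] linear_0[OF linear_vpart[OF z]] by simp_all
    qed
    ultimately show ?thesis by simp
  qed
  then show ?thesis by (simp add: ricci_coord_def)
qed

end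


section \<open>Flatness from the soliton equation on the fibres\<close>

text \<open>The pair \<open>(p, q)\<close> is a one-form on the plane with prescribed symmetrised derivative
  \<open>(\<alpha> + t\<^sup>2 N, \<beta> + s\<^sup>2 N, \<gamma> - 2 s t N)\<close>. Such data must satisfy an integrability condition of second
  order, here \<open>2 N + 2 N + 2 N = 0\<close>. Integrating the two diagonal equations and inserting the result
  into the third one at the corners of the unit square avoids third derivatives.\<close>

lemma plane_killing_obstruction:
  fixes p q :: "real \<Rightarrow> real \<Rightarrow> real"
  assumes ps: "\<And>s t. ((\<lambda>s. p s t) has_real_derivative \<alpha> + t\<^sup>2 * N) (at s)"
    and qt: "\<And>s t. ((\<lambda>t. q s t) has_real_derivative \<beta> + s\<^sup>2 * N) (at t)"
    and pt: "\<And>s t. ((\<lambda>t. p s t) has_real_derivative pt s t) (at t)"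
    and qs: "\<And>s t. ((\<lambda>s. q s t) has_real_derivative qs s t) (at s)"
    and eq: "\<And>s t. pt s t + qs s t = \<gamma> - 2 * s * t * N"
  shows "N = 0"
proof -
  have affine: "f x = f 0 + x * k" if "\<And>x. (f has_real_derivative k) (at x)" for f :: "real \<Rightarrow> real" and x k
  proof -
    have "((\<lambda>x. f x - x * k) has_real_derivative 0) (at x)" for x
      by (rule derivative_eq_intros that refl)+ simp
    then have "f x - x * k = f 0 - 0 * k" by (intro DERIV_isconst_all[of "\<lambda>x. f x - x * k"]) auto
    then show ?thesis by simp
  qed
  have p_eq: "(\<lambda>t. p s t) = (\<lambda>t. p 0 t + s * (\<alpha> + t\<^sup>2 * N))" for s
    by (rule ext) (rule affine[OF ps])
  have q_eq: "(\<lambda>s. q s t) = (\<lambda>s. q s 0 + t * (\<beta> + s\<^sup>2 * N))" for t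
    by (rule ext) (rule affine[OF qt])
  have "((\<lambda>t. p 0 t + s * (\<alpha> + t\<^sup>2 * N)) has_real_derivative pt 0 t + s * (2 * t * N)) (at t)" for s t
    by (rule derivative_eq_intros pt refl)+ simp
  then have pt': "((\<lambda>t. p s t) has_real_derivative pt 0 t + s * (2 * t * N)) (at t)" for s t
    by (simp only: p_eq[of s])
  then have pt_eq: "pt s t = pt 0 t + 2 * s * t * N" for s t
    using DERIV_unique[OF pt pt', of s t] by (simp add: mult.assoc mult.left_commute)
  have "((\<lambda>s. q s 0 + t * (\<beta> + s\<^sup>2 * N)) has_real_derivative qs s 0 + t * (2 * s * N)) (at s)" for s t
    by (rule derivative_eq_intros qs refl)+ simp
  then have qs': "((\<lambda>s. q s t) has_real_derivative qs s 0 + t * (2 * s * N)) (at s)" for s t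
    by (simp only: q_eq[of t])
  then have qs_eq: "qs s t = qs s 0 + 2 * s * t * N" for s t
    using DERIV_unique[OF qs qs', of s t] by (simp add: mult.assoc mult.left_commute)
  have "pt 0 t + qs s 0 + 6 * s * t * N = \<gamma>" for s t
    using eq[of s t] pt_eq[of s t] qs_eq[of s t] by (simp add: algebra_simps)
  from this[of 0 0] this[of 0 1] this[of 1 0] this[of 1 1] show ?thesis by simp
qed

context lifted_metric
begin

text \<open>The factor \<open>a / (a (a + c) - b\<^sup>2)\<close> comes from inverting the Gram matrix of the horizontal and
  vertical parts, and \<open>a / 2\<close> from the torsion term of the Koszul formula.\<close>

definition mixed_coeff :: real where
  "mixed_coeff = a\<^sup>2 / (2 * (a * (a + c) - b\<^sup>2))"

lemma mixed_coeff: "mixed_coeff \<noteq> 0" "(a * (a + c) - b\<^sup>2) * mixed_coeff = a\<^sup>2 / 2"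
proof -
  have "d \<noteq> 0 \<Longrightarrow> d * (a\<^sup>2 / (2 * d)) = a\<^sup>2 / 2" for d by simp
  then show "(a * (a + c) - b\<^sup>2) * mixed_coeff = a\<^sup>2 / 2"
    unfolding mixed_coeff_def using det_nz by blast
  then show "mixed_coeff \<noteq> 0" using a_nz by auto
qed

text \<open>The horizontal part of the covariant derivative of the vertical field \<open>B\<^sup>v\<close> in the direction of a
  vector with horizontal part \<open>C\<close>. It is the endomorphism called \<open>P\<^sub>B\<close> in the introduction.\<close>

definition mixed :: "'e \<times> 'e \<Rightarrow> 'e \<Rightarrow> 'e \<Rightarrow> 'e" where
  "mixed z B C = mixed_coeff *\<^sub>R
     riesz (fst z) (\<lambda>W. h (fst z) B (curvature_coord h (fst z) C W (snd z)))"

lemma linear_mixed_form: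
  assumes y: "y \<in> S"
  shows "linear (\<lambda>W. h y B (curvature_coord h y C W u))"
  using linear_compose[OF linear_curvature2[OF y] linear_right[OF y]] by (simp add: o_def)

lemma metric_mixed:
  assumes "z \<in> T"
  shows "h (fst z) (mixed z B C) W =
    mixed_coeff * h (fst z) B (curvature_coord h (fst z) C W (snd z))"
  using assms by (auto simp: mixed_def scale_left riesz linear_mixed_form)

lemma linear_mixed:
  assumes z: "z \<in> T"
  shows linear_mixed_right: "linear (mixed z B)"
    and linear_mixed_left: "linear (\<lambda>B. mixed z B C)"
proof -
  have S: "fst z \<in> S" using z by auto
  have *: "mixed z B C = v \<longleftrightarrow> (\<forall>W. h (fst z) (mixed z B C) W = h (fst z) v W)" for B C v
    using nondegenerate[OF S] by blast
  note bl = linear_add[OF linear_curvature1[OF S]] linear_cmul[OF linear_curvature1[OF S]]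
    add_left[OF S] add_right[OF S] scale_left[OF S] scale_right[OF S] metric_mixed[OF z]
  show "linear (mixed z B)" "linear (\<lambda>B. mixed z B C)"
    by (rule linearI; subst *; simp add: bl algebra_simps)+
qed

lemma mixed_skew:
  assumes z: "z \<in> T"
  shows "h (fst z) (mixed z B C) W = - h (fst z) C (mixed z B W)"
proof -
  have S: "fst z \<in> S" using z by auto
  have "h (fst z) (mixed z B C) W = - h (fst z) (mixed z B W) C"
    unfolding metric_mixed[OF z] by (subst curvature_skew) (simp add: neg_right[OF S])
  also have "h (fst z) (mixed z B W) C = h (fst z) C (mixed z B W)" by (rule sym[OF S])
  finally show ?thesis .
qed

lemma smooth_mixed: "smooth_on (\<lambda>z. mixed z B C) T"
proof -
  have "smooth_on (\<lambda>y. riesz y (\<lambda>W. h y B (curvature_coord h y C W u))) S" for u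
    by (rule smooth_on_riesz[OF linear_mixed_form])
      (auto intro: smooth_comp[OF open_S smooth_on_linear[OF bounded_linear_ident] _ smooth_on_const smooth_curvature])
  then have sm: "smooth_on (\<lambda>z. riesz (fst z) (\<lambda>W. h (fst z) B (curvature_coord h (fst z) C W u))) T" for u
    by (rule smooth_on_compose[OF _ open_T open_S smooth_fst]) auto
  have lin: "linear (\<lambda>u. riesz y (\<lambda>W. h y B (curvature_coord h y C W u)))" if y: "y \<in> S" for y
  proof -
    have *: "riesz y (\<lambda>W. h y B (curvature_coord h y C W u)) = v \<longleftrightarrow>
        (\<forall>W. h y B (curvature_coord h y C W u) = h y v W)" for u v
      using riesz[OF y linear_mixed_form[OF y]] riesz_unique[OF y] by metis
    show ?thesis
      by (rule linearI; subst *; simp add: add_left[OF y] scale_left[OF y] add_right[OF y] scale_right[OF y]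
          riesz[OF y linear_mixed_form[OF y]] linear_add[OF linear_curvature3[OF y]] linear_cmul[OF linear_curvature3[OF y]])
  qed
  have "smooth_on (\<lambda>z. riesz (fst z) (\<lambda>W. h (fst z) B (curvature_coord h (fst z) C W (snd z)))) T"
    by (rule smooth_on_linear_family[where L = "\<lambda>z u. riesz (fst z) (\<lambda>W. h (fst z) B (curvature_coord h (fst z) C W u))",
          OF open_T _ sm smooth_snd]) (use lin in auto)
  then show ?thesis unfolding mixed_def by (intro smooth_on_scaleR open_T smooth_on_const)
qed

text \<open>The difference between the Levi-Civita connection and \<open>hconn\<close> on \<open>B\<^sup>v\<close>. Its vertical part is
  forced by the vanishing of its \<open>lift\<close>-product with vertical vectors.\<close>

definition mixed_vector :: "'e \<times> 'e \<Rightarrow> 'e \<Rightarrow> 'e \<Rightarrow> 'e \<times> 'e" where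
  "mixed_vector z B C = (mixed z B C,
     - (b / a) *\<^sub>R mixed z B C - christoffel h (fst z) (snd z) (mixed z B C))"

lemma fst_mixed_vector: "fst (mixed_vector z B C) = mixed z B C"
  and vpart_mixed_vector: "vpart z (mixed_vector z B C) = - (b / a) *\<^sub>R mixed z B C"
  by (simp_all add: mixed_vector_def vpart_def)

lemma christoffel_lift_vertical:
  assumes z: "z \<in> T"
  shows "christoffel lift z \<xi> (0, B) = hconn z \<xi> (0, B) + mixed_vector z B (fst \<xi>)"
proof (rule christoffel_lift_eqI[OF z])
  fix \<zeta> :: "'e \<times> 'e"
  have S: "fst z \<in> S" using z by auto
  have "curvature_coord h (fst z) (fst \<xi>) 0 (snd z) = 0" "curvature_coord h (fst z) 0 (fst \<zeta>) (snd z) = 0"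
    using linear_0[OF linear_curvature2[OF S]] linear_0[OF linear_curvature1[OF S]] by auto
  then have sym': "hconn z (0, B) \<xi> = hconn z \<xi> (0, B)"
    and kz: "koszul lift z \<xi> (0, B) \<zeta> = 2 * lift z (hconn z \<xi> (0, B)) \<zeta>
      + a * h (fst z) B (curvature_coord h (fst z) (fst \<xi>) (fst \<zeta>) (snd z))"
    using torsion_hconn[OF z, of \<xi> "(0, B)"] unfolding koszul_lift[OF z]
    by (simp_all add: zero_prod_def[symmetric] L.add_left[OF z] L.zero_right[OF z] lift_vertical[OF z]
        vpart_vertical[OF z] zero_right[OF S])
  let ?P = "mixed z B (fst \<xi>)"
  have "a * lift z (mixed_vector z B (fst \<xi>)) \<zeta> = (a * (a + c) - b\<^sup>2) * h (fst z) ?P (fst \<zeta>)"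
    using a_nz
    by (simp add: lift_def fst_mixed_vector vpart_mixed_vector neg_left[OF S] scale_left[OF S]
        field_simps power2_eq_square)
  also have "2 * \<dots> = a * (a * h (fst z) B (curvature_coord h (fst z) (fst \<xi>) (fst \<zeta>) (snd z)))"
    unfolding metric_mixed[OF z] mult.assoc[symmetric] mixed_coeff(2) by (simp add: power2_eq_square)
  finally have "2 * lift z (mixed_vector z B (fst \<xi>)) \<zeta> =
      a * h (fst z) B (curvature_coord h (fst z) (fst \<xi>) (fst \<zeta>) (snd z))"
    using a_nz by simp
  then show "2 * lift z (hconn z \<xi> (0, B) + mixed_vector z B (fst \<xi>)) \<zeta> = koszul lift z \<xi> (0, B) \<zeta>"
    unfolding kz by (simp add: L.add_left[OF z])
qed

lemma hconn_vertical:
  assumes z: "z \<in> T"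
  shows "hconn z \<xi> (0, B) = (0, christoffel h (fst z) (fst \<xi>) B)"
proof (rule parts_eqI[of _ _ z])
  have S: "fst z \<in> S" using z by auto
  show "fst (hconn z \<xi> (0, B)) = fst (0, christoffel h (fst z) (fst \<xi>) B)"
    by (simp add: fst_hconn conn.zero_right[OF S])
  have "cov (\<lambda>z. vpart z (0, B)) z \<xi> = cov (\<lambda>_. B) z \<xi>"
    by (rule cov_cong[OF vpart_vertical z])
  then show "vpart z (hconn z \<xi> (0, B)) = vpart z (0, christoffel h (fst z) (fst \<xi>) B)"
    by (simp add: vpart_hconn vpart_vertical[OF z] cov_def)
qed

text \<open>The fibres are flat and totally geodesic.\<close>

lemma christoffel_lift_vertical_vertical:
  assumes z: "z \<in> T"
  shows "christoffel lift z (0, B) (0, B') = 0"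
proof -
  have S: "fst z \<in> S" using z by auto
  show ?thesis
    unfolding christoffel_lift_vertical[OF z] hconn_vertical[OF z]
    by (simp add: mixed_vector_def linear_0[OF linear_mixed_right[OF z]] conn.zero_left[OF S]
        conn.zero_right[OF S] zero_prod_def)
qed

lemma koszul_lift_sym: "z \<in> T \<Longrightarrow> koszul lift z \<xi> \<eta> \<zeta> = koszul lift z \<eta> \<xi> \<zeta>"
  by (simp add: koszul_lift L.add_left)

lemma koszul_lift_vertical_vertical: "z \<in> T \<Longrightarrow> koszul lift z (0, B) (0, B') \<zeta> = 0"
proof -
  assume z: "z \<in> T"
  then have S: "fst z \<in> S" by auto
  show ?thesis
    unfolding koszul_lift[OF z] hconn_vertical[OF z]
    by (simp add: conn.zero_left[OF S] linear_0[OF linear_curvature1[OF S]] zero_prod_def[symmetric]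
        L.zero_left[OF z] L.zero_right[OF z])
qed

text \<open>In the trace defining the Ricci tensor vertical directions drop out because the fibres are totally
  geodesic and flat. In the horizontal directions the derivative term is the derivative of the trace
  of \<open>mixed z B'\<close>, which vanishes as this endomorphism is skew; the quadratic term remains.\<close>

lemma ricci_lift_vertical:
  assumes z: "z \<in> T"
  shows "ricci_coord lift z (0, B) (0, B') = - (\<Sum>j\<in>Basis. mixed z B (mixed z B' j) \<bullet> j)"
proof -
  have S: "fst z \<in> S" using z by auto
  let ?\<Gamma> = "christoffel lift"
  have fst_chr: "fst (?\<Gamma> z \<xi> (0, B)) = mixed z B (fst \<xi>)" if "z \<in> T" for z \<xi> B
    by (simp add: christoffel_lift_vertical[OF that] hconn_vertical[OF that] fst_mixed_vector)
  have sym': "?\<Gamma> z (0, B) \<xi> = ?\<Gamma> z \<xi> (0, B)" for \<xi>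
    unfolding christoffel_def koszul_def[symmetric] koszul_lift_sym[OF z, of "(0, B)"] ..
  have vv: "?\<Gamma> z \<xi> 0 = 0" for \<xi>
    using christoffel_lift_vertical[OF z, of \<xi> 0] hconn_vertical[OF z, of \<xi> 0] 
    by (simp add: mixed_vector_def linear_0[OF linear_mixed_left[OF z]] conn.zero_right[OF S] zero_prod_def)
  have chr_smooth: "smooth_on (\<lambda>z. ?\<Gamma> z \<xi> (0, B')) T" for \<xi>
  proof (rule smooth_on_cong_imp[OF open_T])
    show "smooth_on (\<lambda>z. hconn z \<xi> (0, B') + mixed_vector z B' (fst \<xi>)) T"
      unfolding mixed_vector_def
      by (intro smooth_on_add smooth_on_diff smooth_on_Pair smooth_on_scaleR smooth_on_const open_T
          smooth_hconn smooth_mixed conn_smooth smooth_snd)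
  qed (simp add: christoffel_lift_vertical)
  define D where "D \<xi> = dir_deriv (\<lambda>z. ?\<Gamma> z \<xi> (0, B')) z (0, B)" for \<xi>
  have fst_D: "fst (D \<xi>) = dir_deriv (\<lambda>z. mixed z B' (fst \<xi>)) z (0, B)" for \<xi>
  proof -
    have "fst (D \<xi>) = dir_deriv (\<lambda>z. fst (?\<Gamma> z \<xi> (0, B'))) z (0, B)"
      unfolding D_def
      by (rule dir_deriv_eq[OF has_derivative_fst[OF smooth_on_has_derivative[OF chr_smooth z]], symmetric])
    also have "\<dots> = dir_deriv (\<lambda>z. mixed z B' (fst \<xi>)) z (0, B)"
      by (rule dir_deriv_cong_open[OF open_T z fst_chr])
    finally show ?thesis .
  qed
  have chr_vv: "?\<Gamma> z (0, j) (0, B') = 0" if "z \<in> T" for z j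
    by (rule christoffel_lift_vertical_vertical[OF that])
  have D_vv: "D (0, j) = 0" for j
    unfolding D_def using dir_deriv_cong_open[OF open_T z chr_vv] by simp
  have first: "dir_deriv (\<lambda>z. ?\<Gamma> z (0, B) (0, B')) z \<xi> = 0" for \<xi>
    using dir_deriv_cong_open[OF open_T z chr_vv] by simp
  have curv: "curvature_coord lift z \<xi> (0, B) (0, B') = - D \<xi> - ?\<Gamma> z (?\<Gamma> z \<xi> (0, B')) (0, B)" for \<xi>
    by (simp add: curvature_coord_def D_def first chr_vv[OF z] vv sym')
  have "ricci_coord lift z (0, B) (0, B') =
      (\<Sum>j\<in>Basis. curvature_coord lift z (j, 0) (0, B) (0, B') \<bullet> (j, 0)) +
      (\<Sum>j\<in>Basis. curvature_coord lift z (0, j) (0, B) (0, B') \<bullet> (0, j))"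
    unfolding ricci_coord_def Basis_prod_def
    by (subst sum.union_disjoint) (auto simp: sum.reindex inj_on_def)
  also have "(\<Sum>j\<in>Basis. curvature_coord lift z (0, j) (0, B) (0, B') \<bullet> (0, j)) = 0"
    unfolding curv D_vv chr_vv[OF z] using christoffel_lift_vertical_vertical[OF z, of 0 B]
    by (simp add: zero_prod_def[symmetric])
  also have "(\<Sum>j\<in>Basis. curvature_coord lift z (j, 0) (0, B) (0, B') \<bullet> (j, 0)) =
      - (\<Sum>j\<in>Basis. dir_deriv (\<lambda>z. mixed z B' j) z (0, B) \<bullet> j) - (\<Sum>j\<in>Basis. mixed z B (mixed z B' j) \<bullet> j)"
    by (simp add: curv inner_prod_def fst_D fst_chr[OF z] inner_diff_left sum_subtractf sum_negf)
  also have "(\<Sum>j\<in>Basis. dir_deriv (\<lambda>z. mixed z B' j) z (0, B) \<bullet> j) =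
      dir_deriv (\<lambda>z. \<Sum>j\<in>Basis. mixed z B' j \<bullet> j) z (0, B)"
    by (rule dir_deriv_eq[symmetric, OF has_derivative_sum[OF has_derivative_inner_left[OF
            smooth_on_has_derivative[OF smooth_mixed z]]]])
  also have "\<dots> = dir_deriv (\<lambda>z. 0) z (0, B)"
  proof (rule dir_deriv_cong_open[OF open_T z])
    fix z assume z: "z \<in> T"
    then have "fst z \<in> S" by auto
    then show "(\<Sum>j\<in>Basis. mixed z B' j \<bullet> j) = 0"
      by (rule trace_skew_zero[OF _ linear_mixed_right[OF z] mixed_skew[OF z]])
  qed
  finally show ?thesis by simp
qed

text \<open>On a totally geodesic flat fibre the Lie derivative of the metric is the symmetrised ordinary
  derivative of the dual one-form of the vector field.\<close>

lemma lie_lift_vertical: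
  assumes V: "smooth_on V T" and z: "z \<in> T"
  shows "lie_deriv_coord V lift z (0, B) (0, B') =
    dir_deriv (\<lambda>z. lift z (V z) (0, B)) z (0, B') + dir_deriv (\<lambda>z. lift z (V z) (0, B')) z (0, B)"
proof -
  have D: "dir_deriv (\<lambda>z. lift z (V z) \<eta>) z \<xi> =
      lift z (dir_deriv V z \<xi>) \<eta> + dir_deriv (\<lambda>x. lift x (V z) \<eta>) z \<xi>" for \<xi> \<eta>
    by (rule trans[OF dir_deriv_eq[OF L.product_rule[OF open_T z _ has_derivative_ident
            smooth_on_has_derivative[OF V z] has_derivative_const]]])
      (simp_all add: L.zero_right[OF z])
  have s: "dir_deriv (\<lambda>x. lift x (V z) \<eta>) z \<xi> = dir_deriv (\<lambda>x. lift x \<eta> (V z)) z \<xi>" for \<xi> \<eta>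
    by (rule dir_deriv_cong_open[OF open_T z lift_sym])
  show ?thesis
    using koszul_lift_vertical_vertical[OF z, of B B' "V z"]
    by (simp add: D s lie_deriv_coord_def koszul_def lift_sym[OF z, of "(0, B)" "dir_deriv V z (0, B')"])
qed

text \<open>The soliton equation is restricted to the plane \<open>s X + t Y\<close> in the fibre over \<open>y\<close>, where the
  vertical Ricci curvature involves only the endomorphism \<open>A = mixed (y, Y) X\<close>.\<close>

lemma flat_of_soliton_coord:
  assumes V: "smooth_on V T"
    and soliton: "\<And>z B B'. z \<in> T \<Longrightarrow> ricci_coord lift z (0, B) (0, B') +
      1 / 2 * lie_deriv_coord V lift z (0, B) (0, B') = lam * lift z (0, B) (0, B')"
    and y: "y \<in> S"
  shows "curvature_coord h y C W Y = 0"
proof (rule nondegenerate[OF y])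
  fix X
  define A where "A = mixed (y, Y) X"
  define N where "N = (\<Sum>j\<in>Basis. A (A j) \<bullet> j)"
  define z where "z s t = (y, s *\<^sub>R X + t *\<^sub>R Y)" for s t
  define \<theta> where "\<theta> B z = lift z (V z) (0, B)" for B z
  have zT: "z s t \<in> T" "(y, Y) \<in> T" for s t using y by (auto simp: z_def)
  have linA: "linear A" unfolding A_def by (rule linear_mixed_right[OF zT(2)])
  have skewA: "h y (A u) v = - h y u (A v)" for u v
    unfolding A_def using mixed_skew[OF zT(2)] by simp
  \<comment> \<open>Skewness of the curvature kills the summand \<open>g(X, R(C, W)X)\<close>, and likewise for \<open>Y\<close> below.\<close>
  have mX: "mixed (z s t) X = (\<lambda>C. t *\<^sub>R A C)" for s t
  proof (rule ext, rule nondegenerate[OF y])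
    fix C W
    show "h y (mixed (z s t) X C) W = h y (t *\<^sub>R A C) W"
      using metric_mixed[OF zT(1)[of s t], of X C W] metric_mixed[OF zT(2), of X C W]
        curvature_metric_skew'[OF y, of X C W X]
      by (simp add: A_def z_def linear_add[OF linear_curvature3[OF y]] linear_cmul[OF linear_curvature3[OF y]]
          add_right[OF y] scale_right[OF y] scale_left[OF y] algebra_simps)
  qed
  have mY: "mixed (z s t) Y = (\<lambda>C. - s *\<^sub>R A C)" for s t
  proof (rule ext, rule nondegenerate[OF y])
    fix C W
    show "h y (mixed (z s t) Y C) W = h y (- s *\<^sub>R A C) W"
      using metric_mixed[OF zT(1)[of s t], of Y C W] metric_mixed[OF zT(2), of X C W]
        curvature_metric_skew'[OF y, of Y C W Y] curvature_metric_skew'[OF y, of Y C W X]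
      by (simp add: A_def z_def linear_add[OF linear_curvature3[OF y]] linear_cmul[OF linear_curvature3[OF y]]
          add_right[OF y] scale_right[OF y] scale_left[OF y] neg_left[OF y] algebra_simps)
  qed
  have \<theta>_diff: "\<theta> B differentiable (at z)" if "z \<in> T" for B z
    unfolding \<theta>_def
    by (rule smooth_on_differentiable[OF L.smooth_comp[OF open_T smooth_on_linear[OF bounded_linear_ident] _ V smooth_on_const] that]) auto
  have sol: "dir_deriv (\<theta> B) z (0, B') + dir_deriv (\<theta> B') z (0, B) =
      2 * lam * a * h (fst z) B B' + 2 * (\<Sum>j\<in>Basis. mixed z B (mixed z B' j) \<bullet> j)" if "z \<in> T" for z B B'
  proof -
    have "fst z \<in> S" using that by auto
    then show ?thesis
      using soliton[OF that, of B B']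
      unfolding ricci_lift_vertical[OF that] lie_lift_vertical[OF V that] \<theta>_def lift_vertical[OF that]
      by (simp add: vpart_vertical[OF that] zero_right algebra_simps)
  qed
  have ds: "((\<lambda>s. \<theta> B (z s t)) has_real_derivative dir_deriv (\<theta> B) (z s t) (0, X)) (at s)" for B s t
    using has_real_derivative_line[of "\<theta> B" "(y, t *\<^sub>R Y)" s "(0, X)"] \<theta>_diff[OF zT(1)[of s t], of B]
    by (simp add: z_def add.commute)
  have dt: "((\<lambda>t. \<theta> B (z s t)) has_real_derivative dir_deriv (\<theta> B) (z s t) (0, Y)) (at t)" for B s t
    using has_real_derivative_line[of "\<theta> B" "(y, s *\<^sub>R X)" t "(0, Y)"] \<theta>_diff[OF zT(1)[of s t], of B]
    by (simp add: z_def add.commute)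
  have fz: "fst (z s t) = y" for s t by (simp add: z_def)
  note cm = linear_cmul[OF linA] linear_neg[OF linA]
  have trace_XX: "(\<Sum>j\<in>Basis. mixed (z s t) X (mixed (z s t) X j) \<bullet> j) = t\<^sup>2 * N"
    and trace_YY: "(\<Sum>j\<in>Basis. mixed (z s t) Y (mixed (z s t) Y j) \<bullet> j) = s\<^sup>2 * N"
    and trace_XY: "(\<Sum>j\<in>Basis. mixed (z s t) X (mixed (z s t) Y j) \<bullet> j) = - (s * t * N)" for s t
    unfolding N_def sum_distrib_left sum_negf[symmetric]
    by (intro sum.cong refl; simp add: mX mY cm power2_eq_square)+
  have "N = 0"
  proof (rule plane_killing_obstruction)
    show "((\<lambda>s. \<theta> X (z s t)) has_real_derivative lam * a * h y X X + t\<^sup>2 * N) (at s)" for s t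
    proof -
      have "dir_deriv (\<theta> X) (z s t) (0, X) = lam * a * h y X X + t\<^sup>2 * N"
        using sol[OF zT(1)[of s t], of X X] unfolding trace_XX fz by linarith
      with ds[of X t s] show ?thesis by simp
    qed
    show "((\<lambda>t. \<theta> Y (z s t)) has_real_derivative lam * a * h y Y Y + s\<^sup>2 * N) (at t)" for s t
    proof -
      have "dir_deriv (\<theta> Y) (z s t) (0, Y) = lam * a * h y Y Y + s\<^sup>2 * N"
        using sol[OF zT(1)[of s t], of Y Y] unfolding trace_YY fz by linarith
      with dt[of Y s t] show ?thesis by simp
    qed
    show "((\<lambda>t. \<theta> X (z s t)) has_real_derivative dir_deriv (\<theta> X) (z s t) (0, Y)) (at t)" for s t
      by (rule dt)
    show "((\<lambda>s. \<theta> Y (z s t)) has_real_derivative dir_deriv (\<theta> Y) (z s t) (0, X)) (at s)" for s t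
      by (rule ds)
    show "dir_deriv (\<theta> X) (z s t) (0, Y) + dir_deriv (\<theta> Y) (z s t) (0, X) =
        2 * lam * a * h y X Y - 2 * s * t * N" for s t
      unfolding sol[OF zT(1)] trace_XY fz by simp
  qed
  then have "A C = 0" unfolding N_def by (rule trace_skew_square[OF y linA skewA])
  then have "h y X (curvature_coord h y C W Y) = 0"
    using metric_mixed[OF zT(2), of X C W] mixed_coeff(1) zero_left[OF y] by (simp add: A_def)
  then show "h y (curvature_coord h y C W Y) X = h y 0 X"
    using zero_left[OF y, of X] sym[OF y, of X "curvature_coord h y C W Y"] by simp
qed

end


section \<open>Charts, tangent vectors and the tangent bundle\<close>

locale atlas =
  fixes M :: "('a, 'e::euclidean_space) atlas"
  assumes smooth_atlas: "smooth_atlas M"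
begin

lemma chart_inj: "\<phi> \<in> M \<Longrightarrow> inj_on (snd \<phi>) (fst \<phi>)"
  and open_chart_image: "\<phi> \<in> M \<Longrightarrow> open (chart_image \<phi>)"
  and open_overlap: "\<phi> \<in> M \<Longrightarrow> \<psi> \<in> M \<Longrightarrow> open (snd \<phi> ` (fst \<phi> \<inter> fst \<psi>))"
  and smooth_transition: "\<phi> \<in> M \<Longrightarrow> \<psi> \<in> M \<Longrightarrow> smooth_on (transition \<phi> \<psi>) (snd \<phi> ` (fst \<phi> \<inter> fst \<psi>))"
  using smooth_atlas unfolding smooth_atlas_def by blast+

lemma chart_inv_chart: "\<phi> \<in> M \<Longrightarrow> p \<in> fst \<phi> \<Longrightarrow> chart_inv \<phi> (snd \<phi> p) = p"
  by (simp add: chart_inv_def chart_inj)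

lemma chart_inv_in: "y \<in> chart_image \<phi> \<Longrightarrow> chart_inv \<phi> y \<in> fst \<phi>"
  and chart_chart_inv: "y \<in> chart_image \<phi> \<Longrightarrow> snd \<phi> (chart_inv \<phi> y) = y"
  by (simp_all add: chart_image_def chart_inv_def inv_into_into f_inv_into_f)

lemma chart_in_image: "p \<in> fst \<phi> \<Longrightarrow> snd \<phi> p \<in> chart_image \<phi>"
  by (simp add: chart_image_def)

lemma transition_chart: "\<phi> \<in> M \<Longrightarrow> p \<in> fst \<phi> \<Longrightarrow> transition \<phi> \<psi> (snd \<phi> p) = snd \<psi> p"
  by (simp add: transition_def chart_inv_chart)

lemma transition_has_derivative:
  "\<phi> \<in> M \<Longrightarrow> \<psi> \<in> M \<Longrightarrow> p \<in> fst \<phi> \<Longrightarrow> p \<in> fst \<psi> \<Longrightarrow>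
    (transition \<phi> \<psi> has_derivative dir_deriv (transition \<phi> \<psi>) (snd \<phi> p)) (at (snd \<phi> p))"
  by (intro has_derivative_dir_deriv smooth_on_differentiable[OF smooth_transition]) auto

lemma linear_jacobian:
  "\<phi> \<in> M \<Longrightarrow> \<psi> \<in> M \<Longrightarrow> p \<in> fst \<phi> \<Longrightarrow> p \<in> fst \<psi> \<Longrightarrow> linear (dir_deriv (transition \<phi> \<psi>) (snd \<phi> p))"
  by (rule has_derivative_linear[OF transition_has_derivative])

lemma jacobian_self:
  assumes "\<phi> \<in> M" "p \<in> fst \<phi>"
  shows "dir_deriv (transition \<phi> \<phi>) (snd \<phi> p) v = v"
proof -
  have "dir_deriv (transition \<phi> \<phi>) (snd \<phi> p) v = dir_deriv (\<lambda>x. x) (snd \<phi> p) v"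
    using assms by (intro dir_deriv_cong_open[OF open_chart_image chart_in_image])
      (auto simp: chart_image_def transition_chart)
  then show ?thesis by simp
qed

lemma jacobian_cocycle:
  assumes "\<phi> \<in> M" "\<psi> \<in> M" "\<rho> \<in> M" "p \<in> fst \<phi>" "p \<in> fst \<psi>" "p \<in> fst \<rho>"
  shows "dir_deriv (transition \<psi> \<rho>) (snd \<psi> p) (dir_deriv (transition \<phi> \<psi>) (snd \<phi> p) v) =
    dir_deriv (transition \<phi> \<rho>) (snd \<phi> p) v"
proof -
  let ?U = "snd \<phi> ` (fst \<phi> \<inter> fst \<psi>) \<inter> snd \<phi> ` (fst \<phi> \<inter> fst \<rho>)"
  have eq: "transition \<psi> \<rho> (transition \<phi> \<psi> z) = transition \<phi> \<rho> z" if "z \<in> ?U" for z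
  proof -
    obtain q where "z = snd \<phi> q" "q \<in> fst \<phi>" "q \<in> fst \<psi>" "q \<in> fst \<rho>"
      using \<open>z \<in> ?U\<close> chart_inj[OF assms(1)] by (auto dest: inj_onD)
    then show ?thesis using assms by (simp add: transition_chart)
  qed
  have "dir_deriv (transition \<phi> \<rho>) (snd \<phi> p) v = dir_deriv (\<lambda>z. transition \<psi> \<rho> (transition \<phi> \<psi> z)) (snd \<phi> p) v"
    by (rule dir_deriv_cong_open[where S = ?U], intro open_Int open_overlap assms)
      (use assms eq in \<open>auto simp del: split_paired_All\<close>)
  also have "\<dots> = dir_deriv (transition \<psi> \<rho>) (snd \<psi> p) (dir_deriv (transition \<phi> \<psi>) (snd \<phi> p) v)"
    by (rule dir_deriv_eq[OF has_derivative_compose[OF transition_has_derivative]])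
      (use assms in \<open>auto simp: transition_chart intro!: transition_has_derivative\<close>)
  finally show ?thesis by simp
qed

lemma jacobian_inverse:
  assumes "\<phi> \<in> M" "\<psi> \<in> M" "p \<in> fst \<phi>" "p \<in> fst \<psi>"
  shows "dir_deriv (transition \<phi> \<psi>) (snd \<phi> p) (dir_deriv (transition \<psi> \<phi>) (snd \<psi> p) v) = v"
  using jacobian_cocycle[of \<psi> \<phi> \<psi> p v] jacobian_self[of \<psi> p v] assms by simp

lemma tangent_component:
  "u \<in> tangent_space M p \<Longrightarrow> \<phi> \<in> M \<Longrightarrow> \<psi> \<in> M \<Longrightarrow> p \<in> fst \<phi> \<Longrightarrow> p \<in> fst \<psi> \<Longrightarrow>
    u \<psi> = dir_deriv (transition \<phi> \<psi>) (snd \<phi> p) (u \<phi>)"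
  unfolding tangent_space_def by blast

lemma tangent_spaceI:
  assumes "\<And>\<phi> \<psi>. \<phi> \<in> M \<Longrightarrow> \<psi> \<in> M \<Longrightarrow> p \<in> fst \<phi> \<Longrightarrow> p \<in> fst \<psi> \<Longrightarrow>
      u \<psi> = dir_deriv (transition \<phi> \<psi>) (snd \<phi> p) (u \<phi>)"
    and "\<And>\<phi>. \<not> (\<phi> \<in> M \<and> p \<in> fst \<phi>) \<Longrightarrow> u \<phi> = 0"
  shows "u \<in> tangent_space M p"
  using assms unfolding tangent_space_def by blast

lemma tangent_outside: "u \<in> tangent_space M p \<Longrightarrow> \<not> (\<phi> \<in> M \<and> p \<in> fst \<phi>) \<Longrightarrow> u \<phi> = 0"
  unfolding tangent_space_def by blast

lemma tangent_eqI:
  assumes "u \<in> tangent_space M p" "v \<in> tangent_space M p" "\<phi> \<in> M" "p \<in> fst \<phi>" "u \<phi> = v \<phi>"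
  shows "u = v"
proof
  fix \<psi>
  show "u \<psi> = v \<psi>"
  proof (cases "\<psi> \<in> M \<and> p \<in> fst \<psi>")
    case True
    then show ?thesis
      using tangent_component[OF assms(1,3)] tangent_component[OF assms(2,3)] assms(4,5) by simp
  next
    case False
    then show ?thesis using assms(1,2)[THEN tangent_outside] by simp
  qed
qed

lemma chart_vector_in:
  assumes "\<phi> \<in> M" "p \<in> fst \<phi>"
  shows "chart_vector M \<phi> p v \<in> tangent_space M p"
  by (rule tangent_spaceI) (use assms in \<open>auto simp: chart_vector_def jacobian_cocycle\<close>)

lemma chart_vector_component: "\<phi> \<in> M \<Longrightarrow> p \<in> fst \<phi> \<Longrightarrow> chart_vector M \<phi> p v \<phi> = v"
  by (simp add: chart_vector_def jacobian_self)

lemma chart_vector_tangent: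
  "u \<in> tangent_space M p \<Longrightarrow> \<phi> \<in> M \<Longrightarrow> p \<in> fst \<phi> \<Longrightarrow> chart_vector M \<phi> p (u \<phi>) = u"
  by (rule tangent_eqI[OF chart_vector_in]) (assumption | simp add: chart_vector_component)+

lemma tangent_combination:
  assumes "u \<in> tangent_space M p" "v \<in> tangent_space M p"
  shows "(\<lambda>\<phi>. r *\<^sub>R u \<phi> + v \<phi>) \<in> tangent_space M p"
proof (rule tangent_spaceI)
  fix \<phi> \<psi> assume *: "\<phi> \<in> M" "\<psi> \<in> M" "p \<in> fst \<phi>" "p \<in> fst \<psi>"
  show "r *\<^sub>R u \<psi> + v \<psi> = dir_deriv (transition \<phi> \<psi>) (snd \<phi> p) (r *\<^sub>R u \<phi> + v \<phi>)"
    using linear_jacobian[OF *] tangent_component[OF assms(1) *] tangent_component[OF assms(2) *]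
    by (simp add: linear_add linear_cmul)
qed (simp add: assms[THEN tangent_outside])

lemma tangent_zero: "(\<lambda>_. 0) \<in> tangent_space M p"
  by (rule tangent_spaceI) (simp_all add: linear_0[OF linear_jacobian])

lemma chart_vector_combination:
  assumes "\<phi> \<in> M" "p \<in> fst \<phi>"
  shows "chart_vector M \<phi> p (r *\<^sub>R v + w) = (\<lambda>\<psi>. r *\<^sub>R chart_vector M \<phi> p v \<psi> + chart_vector M \<phi> p w \<psi>)"
  by (rule tangent_eqI[where \<phi> = \<phi>, OF chart_vector_in tangent_combination[OF chart_vector_in chart_vector_in]])
    (simp_all add: assms chart_vector_component)

lemma chart_vector_transition:
  assumes "\<phi> \<in> M" "\<psi> \<in> M" "p \<in> fst \<phi>" "p \<in> fst \<psi>"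
  shows "chart_vector M \<psi> p (dir_deriv (transition \<phi> \<psi>) (snd \<phi> p) v) = chart_vector M \<phi> p v"
  by (rule tangent_eqI[where \<phi> = \<psi>, OF chart_vector_in chart_vector_in])
    (simp_all add: assms chart_vector_component, simp add: assms chart_vector_def)

subsection \<open>The tangent bundle as an atlas\<close>

lemma fst_tangent_chart: "z \<in> fst (tangent_chart M \<phi>) \<longleftrightarrow> fst z \<in> fst \<phi> \<and> snd z \<in> tangent_space M (fst z)"
  by (auto simp: tangent_chart_def)

lemma snd_tangent_chart: "snd (tangent_chart M \<phi>) z = (snd \<phi> (fst z), snd z \<phi>)"
  by (simp add: tangent_chart_def split_beta)

text \<open>The set \<open>W\<close> of base points will be a chart domain when overlaps of induced charts are computed, and
  an open set when the projection of the bundle is shown to be continuous.\<close>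

lemma tangent_chart_overlap:
  assumes "\<phi> \<in> M"
  shows "snd (tangent_chart M \<phi>) ` (fst (tangent_chart M \<phi>) \<inter> {z. fst z \<in> W}) = (snd \<phi> ` (fst \<phi> \<inter> W)) \<times> UNIV"
proof (intro equalityI subsetI)
  fix x assume "x \<in> (snd \<phi> ` (fst \<phi> \<inter> W)) \<times> (UNIV :: 'e set)"
  then obtain p w where p: "x = (snd \<phi> p, w)" "p \<in> fst \<phi>" "p \<in> W" by auto
  then have "x = snd (tangent_chart M \<phi>) (p, chart_vector M \<phi> p w)"
    using assms by (simp add: snd_tangent_chart chart_vector_component)
  moreover have "(p, chart_vector M \<phi> p w) \<in> fst (tangent_chart M \<phi>)"
    using p assms by (simp add: fst_tangent_chart chart_vector_in)
  ultimately show "x \<in> snd (tangent_chart M \<phi>) ` (fst (tangent_chart M \<phi>) \<inter> {z. fst z \<in> W})"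
    using p by auto
qed (auto simp: fst_tangent_chart snd_tangent_chart)

lemma tangent_chart_image: "\<phi> \<in> M \<Longrightarrow> chart_image (tangent_chart M \<phi>) = chart_image \<phi> \<times> UNIV"
  using tangent_chart_overlap[of \<phi> UNIV] by (simp add: chart_image_def)

lemma tangent_chart_overlap2:
  assumes "\<phi> \<in> M"
  shows "snd (tangent_chart M \<phi>) ` (fst (tangent_chart M \<phi>) \<inter> fst (tangent_chart M \<psi>)) =
    (snd \<phi> ` (fst \<phi> \<inter> fst \<psi>)) \<times> UNIV"
proof -
  have "fst (tangent_chart M \<phi>) \<inter> fst (tangent_chart M \<psi>) = fst (tangent_chart M \<phi>) \<inter> {z. fst z \<in> fst \<psi>}"
    by (auto simp: fst_tangent_chart)
  then show ?thesis by (simp add: tangent_chart_overlap[OF assms])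
qed

lemma tangent_chart_inj:
  assumes "\<phi> \<in> M"
  shows "inj_on (snd (tangent_chart M \<phi>)) (fst (tangent_chart M \<phi>))"
proof (rule inj_onI)
  fix z z' assume z: "z \<in> fst (tangent_chart M \<phi>)" "z' \<in> fst (tangent_chart M \<phi>)"
    and eq: "snd (tangent_chart M \<phi>) z = snd (tangent_chart M \<phi>) z'"
  then have "fst z = fst z'"
    using inj_onD[OF chart_inj[OF assms]] by (simp add: fst_tangent_chart snd_tangent_chart)
  moreover from this have "snd z = snd z'"
    using z eq by (intro tangent_eqI[of "snd z" "fst z" "snd z'" \<phi>])
      (simp_all add: assms fst_tangent_chart snd_tangent_chart)
  ultimately show "z = z'" by (rule prod_eqI)
qed

lemma tangent_transition:
  assumes "\<phi> \<in> M" "\<psi> \<in> M" "p \<in> fst \<phi>" "p \<in> fst \<psi>"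
  shows "transition (tangent_chart M \<phi>) (tangent_chart M \<psi>) (snd \<phi> p, w) =
    (transition \<phi> \<psi> (snd \<phi> p), dir_deriv (transition \<phi> \<psi>) (snd \<phi> p) w)"
proof -
  have "chart_inv (tangent_chart M \<phi>) (snd \<phi> p, w) = (p, chart_vector M \<phi> p w)"
    unfolding chart_inv_def
    by (rule inv_into_f_eq[OF tangent_chart_inj])
      (use assms in \<open>auto simp: fst_tangent_chart snd_tangent_chart chart_vector_in chart_vector_component\<close>)
  then show ?thesis
    using assms by (simp add: transition_def snd_tangent_chart chart_inv_chart) (simp add: chart_vector_def transition_def)
qed

lemma smooth_tangent_transition:
  assumes "\<phi> \<in> M" "\<psi> \<in> M"
  shows "smooth_on (transition (tangent_chart M \<phi>) (tangent_chart M \<psi>)) ((snd \<phi> ` (fst \<phi> \<inter> fst \<psi>)) \<times> UNIV)"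
proof -
  let ?U = "snd \<phi> ` (fst \<phi> \<inter> fst \<psi>)" and ?\<tau> = "transition \<phi> \<psi>"
  have U: "open ?U" "open (?U \<times> (UNIV :: 'e set))" using open_overlap[OF assms] by (auto intro: open_Times)
  have fst: "smooth_on fst (?U \<times> (UNIV :: 'e set))" and snd: "smooth_on snd (?U \<times> (UNIV :: 'e set))"
    by (intro smooth_on_linear bounded_linear_fst bounded_linear_snd)+
  have "smooth_on (\<lambda>z. (?\<tau> (fst z), dir_deriv ?\<tau> (fst z) (snd z))) (?U \<times> UNIV)"
  proof (intro smooth_on_Pair U)
    show "smooth_on (\<lambda>z. ?\<tau> (fst z)) (?U \<times> (UNIV :: 'e set))"
      by (rule smooth_on_compose[OF smooth_transition[OF assms] U(2,1) fst]) auto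
    show "smooth_on (\<lambda>z. dir_deriv ?\<tau> (fst z) (snd z)) (?U \<times> UNIV)"
    proof (rule smooth_on_linear_family[where L = "\<lambda>z. dir_deriv ?\<tau> (fst z)", OF U(2) _ _ snd])
      show "linear (dir_deriv ?\<tau> (fst z))" if "z \<in> ?U \<times> (UNIV :: 'e set)" for z
        using that linear_jacobian[OF assms] by auto
      show "smooth_on (\<lambda>z. dir_deriv ?\<tau> (fst z) i) (?U \<times> (UNIV :: 'e set))" for i
        by (rule smooth_on_compose[OF smooth_on_dir_deriv[OF smooth_transition[OF assms]] U(2,1) fst]) auto
    qed
  qed
  then show ?thesis
    by (rule smooth_on_cong_imp[OF U(2), rotated]) (use assms in \<open>auto simp: tangent_transition\<close>)
qed

text \<open>The second derivative in the lower left block is the term that makes the Christoffel symbols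
  non-tensorial and horizontal lifts tensorial.\<close>

lemma tangent_jacobian:
  assumes "\<phi> \<in> M" "\<psi> \<in> M" "p \<in> fst \<phi>" "p \<in> fst \<psi>"
  shows "dir_deriv (transition (tangent_chart M \<phi>) (tangent_chart M \<psi>)) (snd \<phi> p, w) (A, B) =
    (dir_deriv (transition \<phi> \<psi>) (snd \<phi> p) A,
     dir_deriv (transition \<phi> \<psi>) (snd \<phi> p) B + dir_deriv (\<lambda>y. dir_deriv (transition \<phi> \<psi>) y w) (snd \<phi> p) A)"
proof -
  let ?U = "snd \<phi> ` (fst \<phi> \<inter> fst \<psi>)" and ?\<tau> = "transition \<phi> \<psi>"
  have U: "open ?U" "open (?U \<times> (UNIV :: 'e set))" using open_overlap[OF assms(1,2)] by (auto intro: open_Times)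
  have y: "snd \<phi> p \<in> ?U" using assms by auto
  have fst: "(fst has_derivative fst) (at (snd \<phi> p, w))" and snd: "(snd has_derivative snd) (at (snd \<phi> p, w))"
    by (intro bounded_linear_imp_has_derivative bounded_linear_fst bounded_linear_snd)+
  have "((\<lambda>z. (?\<tau> (fst z), dir_deriv ?\<tau> (fst z) (snd z))) has_derivative
      (\<lambda>\<xi>. (dir_deriv ?\<tau> (fst (snd \<phi> p, w)) (fst \<xi>),
        dir_deriv ?\<tau> (fst (snd \<phi> p, w)) (snd \<xi>) + dir_deriv (\<lambda>y. dir_deriv ?\<tau> y (snd (snd \<phi> p, w))) (fst (snd \<phi> p, w)) (fst \<xi>)))) (at (snd \<phi> p, w))"
  proof (rule has_derivative_Pair)
    show "((\<lambda>z. ?\<tau> (fst z)) has_derivative (\<lambda>\<xi>. dir_deriv ?\<tau> (fst (snd \<phi> p, w)) (fst \<xi>))) (at (snd \<phi> p, w))"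
      by (rule has_derivative_compose[OF fst]) (simp add: transition_has_derivative assms)
    show "((\<lambda>z. dir_deriv ?\<tau> (fst z) (snd z)) has_derivative
      (\<lambda>\<xi>. dir_deriv ?\<tau> (fst (snd \<phi> p, w)) (snd \<xi>) +
         dir_deriv (\<lambda>y. dir_deriv ?\<tau> y (snd (snd \<phi> p, w))) (fst (snd \<phi> p, w)) (fst \<xi>))) (at (snd \<phi> p, w))"
    proof (rule has_derivative_linear_family[where L = "dir_deriv ?\<tau>", OF U(1) _ _ _ fst snd])
      show "linear (dir_deriv ?\<tau> x)" if "x \<in> ?U" for x
        using that linear_jacobian[OF assms(1,2)] by auto
      show "(\<lambda>y. dir_deriv ?\<tau> y i) differentiable at (fst (snd \<phi> p, w))" for i
        using smooth_on_differentiable[OF smooth_on_dir_deriv[OF smooth_transition[OF assms(1,2)]] y] by simp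
    qed (use y in simp)
  qed
  from dir_deriv_eq[OF this, of "(A, B)"]
  have D: "dir_deriv (\<lambda>z. (?\<tau> (fst z), dir_deriv ?\<tau> (fst z) (snd z))) (snd \<phi> p, w) (A, B) =
    (dir_deriv ?\<tau> (snd \<phi> p) A, dir_deriv ?\<tau> (snd \<phi> p) B + dir_deriv (\<lambda>y. dir_deriv ?\<tau> y w) (snd \<phi> p) A)"
    by simp
  show ?thesis
    unfolding D[symmetric]
    by (rule dir_deriv_cong_open[OF U(2)]) (use assms in \<open>auto simp: tangent_transition\<close>)
qed

lemma smooth_atlas_tangent_bundle: "smooth_atlas (tangent_bundle M)"
  unfolding smooth_atlas_def tangent_bundle_def ball_simps
  by (intro conjI ballI; simp only: tangent_chart_inj tangent_chart_image tangent_chart_overlap2)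
    (intro open_Times open_UNIV open_chart_image open_overlap smooth_tangent_transition; assumption)+

lemma points_tangent_bundle: "z \<in> points (tangent_bundle M) \<longleftrightarrow> fst z \<in> points M \<and> snd z \<in> tangent_space M (fst z)"
  by (auto simp: points_def tangent_bundle_def fst_tangent_chart)

subsection \<open>Topology\<close>

lemma openin_atlas_topology:
  "openin (atlas_topology M) W \<longleftrightarrow> W \<subseteq> points M \<and> (\<forall>\<phi>\<in>M. open (snd \<phi> ` (W \<inter> fst \<phi>)))"
proof -
  have "istopology (\<lambda>W. W \<subseteq> points M \<and> (\<forall>\<phi>\<in>M. open (snd \<phi> ` (W \<inter> fst \<phi>))))"
    unfolding istopology_def
  proof (intro conjI allI impI)
    fix S T assume S: "S \<subseteq> points M \<and> (\<forall>\<phi>\<in>M. open (snd \<phi> ` (S \<inter> fst \<phi>)))"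
      and T: "T \<subseteq> points M \<and> (\<forall>\<phi>\<in>M. open (snd \<phi> ` (T \<inter> fst \<phi>)))"
    then show "S \<inter> T \<subseteq> points M" by auto
    show "\<forall>\<phi>\<in>M. open (snd \<phi> ` (S \<inter> T \<inter> fst \<phi>))"
    proof
      fix \<phi> assume \<phi>: "\<phi> \<in> M"
      have "snd \<phi> ` (S \<inter> T \<inter> fst \<phi>) = snd \<phi> ` (S \<inter> fst \<phi>) \<inter> snd \<phi> ` (T \<inter> fst \<phi>)"
        using chart_inj[OF \<phi>] by (auto dest: inj_onD)
      then show "open (snd \<phi> ` (S \<inter> T \<inter> fst \<phi>))" using S T \<phi> by auto
    qed
  next
    fix K assume K: "\<forall>S\<in>K. S \<subseteq> points M \<and> (\<forall>\<phi>\<in>M. open (snd \<phi> ` (S \<inter> fst \<phi>)))"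
    then show "\<Union> K \<subseteq> points M" by auto
    show "\<forall>\<phi>\<in>M. open (snd \<phi> ` (\<Union> K \<inter> fst \<phi>))"
    proof
      fix \<phi> assume \<phi>: "\<phi> \<in> M"
      have "snd \<phi> ` (\<Union> K \<inter> fst \<phi>) = (\<Union>S\<in>K. snd \<phi> ` (S \<inter> fst \<phi>))" by auto
      then show "open (snd \<phi> ` (\<Union> K \<inter> fst \<phi>))" using K \<phi> by auto
    qed
  qed
  then show ?thesis unfolding atlas_topology_def by simp
qed

lemma openin_chart_preimage:
  assumes \<phi>: "\<phi> \<in> M" and Q: "open Q"
  shows "openin (atlas_topology M) {p \<in> fst \<phi>. snd \<phi> p \<in> Q}"
  unfolding openin_atlas_topology
proof (intro conjI ballI)
  show "{p \<in> fst \<phi>. snd \<phi> p \<in> Q} \<subseteq> points M" using \<phi> by (auto simp: points_def)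
  fix \<psi> assume \<psi>: "\<psi> \<in> M"
  have "snd \<psi> ` ({p \<in> fst \<phi>. snd \<phi> p \<in> Q} \<inter> fst \<psi>) =
      snd \<psi> ` (fst \<psi> \<inter> fst \<phi>) \<inter> transition \<psi> \<phi> -` Q"
    using \<psi> by (auto simp: transition_chart)
  then show "open (snd \<psi> ` ({p \<in> fst \<phi>. snd \<phi> p \<in> Q} \<inter> fst \<psi>))"
    using continuous_open_preimage[OF smooth_on_continuous[OF smooth_transition[OF \<psi> \<phi>]] open_overlap[OF \<psi> \<phi>] Q]
    by simp
qed

lemma openin_chart_domain: "\<phi> \<in> M \<Longrightarrow> openin (atlas_topology M) (fst \<phi>)"
  using openin_chart_preimage[of \<phi> UNIV] by simp

lemma topspace_atlas_topology: "topspace (atlas_topology M) = points M"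
proof
  show "topspace (atlas_topology M) \<subseteq> points M"
    using openin_topspace[of "atlas_topology M"] unfolding openin_atlas_topology by blast
  show "points M \<subseteq> topspace (atlas_topology M)"
    using openin_chart_domain openin_subset unfolding points_def by fastforce
qed

end


context atlas
begin

interpretation TM: atlas "tangent_bundle M"
  by unfold_locales (rule smooth_atlas_tangent_bundle)

lemma openin_bundle_preimage:
  assumes "openin (atlas_topology M) W"
  shows "openin (atlas_topology (tangent_bundle M)) {z \<in> points (tangent_bundle M). fst z \<in> W}"
  unfolding TM.openin_atlas_topology
proof (intro conjI ballI)
  fix \<Phi> assume "\<Phi> \<in> tangent_bundle M"
  then obtain \<phi> where \<phi>: "\<phi> \<in> M" "\<Phi> = tangent_chart M \<phi>" by (auto simp: tangent_bundle_def)
  have "{z \<in> points (tangent_bundle M). fst z \<in> W} \<inter> fst \<Phi> = fst (tangent_chart M \<phi>) \<inter> {z. fst z \<in> W}"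
    using \<phi> by (auto simp: points_def tangent_bundle_def)
  moreover have "open (snd \<phi> ` (fst \<phi> \<inter> W))"
    using assms \<phi>(1) unfolding openin_atlas_topology by (simp add: Int_commute)
  ultimately show "open (snd \<Phi> ` ({z \<in> points (tangent_bundle M). fst z \<in> W} \<inter> fst \<Phi>))"
    using \<phi> by (simp add: tangent_chart_overlap open_Times)
qed auto

text \<open>Points over different base points are separated by preimages of open sets of the base; points of
  the same fibre lie in the domain of one induced chart.\<close>

lemma Hausdorff_tangent_bundle:
  assumes "Hausdorff_space (atlas_topology M)"
  shows "Hausdorff_space (atlas_topology (tangent_bundle M))"
  unfolding Hausdorff_space_def TM.topspace_atlas_topology
proof (intro allI impI)
  fix z z' assume z: "z \<in> points (tangent_bundle M) \<and> z' \<in> points (tangent_bundle M) \<and> z \<noteq> z'"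
  let ?open = "openin (atlas_topology (tangent_bundle M))"
  show "\<exists>U V. ?open U \<and> ?open V \<and> z \<in> U \<and> z' \<in> V \<and> disjnt U V"
  proof (cases "fst z = fst z'")
    case False
    then obtain U V where UV: "openin (atlas_topology M) U" "openin (atlas_topology M) V"
      "fst z \<in> U" "fst z' \<in> V" "disjnt U V"
      using assms z unfolding Hausdorff_space_def topspace_atlas_topology points_tangent_bundle by metis
    then show ?thesis
      using z openin_bundle_preimage[OF UV(1)] openin_bundle_preimage[OF UV(2)]
      by (intro exI[of _ "{z \<in> points (tangent_bundle M). fst z \<in> U}"]
          exI[of _ "{z \<in> points (tangent_bundle M). fst z \<in> V}"]) (auto simp: disjnt_iff)
  next
    case True
    obtain \<phi> where \<phi>: "\<phi> \<in> M" "fst z \<in> fst \<phi>" using z unfolding points_tangent_bundle by (auto simp: points_def)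
    let ?\<Phi> = "tangent_chart M \<phi>"
    have in_\<Phi>: "z \<in> fst ?\<Phi>" "z' \<in> fst ?\<Phi>" using z \<phi> True by (auto simp: points_tangent_bundle fst_tangent_chart)
    then have "snd ?\<Phi> z \<noteq> snd ?\<Phi> z'" using inj_onD[OF tangent_chart_inj[OF \<phi>(1)]] z by metis
    then obtain A B where AB: "open A" "open B" "snd ?\<Phi> z \<in> A" "snd ?\<Phi> z' \<in> B" "A \<inter> B = {}"
      by (metis hausdorff)
    have "?\<Phi> \<in> tangent_bundle M" using \<phi> by (simp add: tangent_bundle_def)
    then show ?thesis
      using in_\<Phi> AB TM.openin_chart_preimage[of ?\<Phi> A] TM.openin_chart_preimage[of ?\<Phi> B]
      by (intro exI[of _ "{z \<in> fst ?\<Phi>. snd ?\<Phi> z \<in> A}"] exI[of _ "{z \<in> fst ?\<Phi>. snd ?\<Phi> z \<in> B}"])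
        (auto simp: disjnt_iff)
  qed
qed

text \<open>A countable base of the tangent bundle is built from a countable base of the model space in each
  of countably many charts.\<close>

lemma countable_subatlas:
  assumes "second_countable (atlas_topology M)"
  obtains C where "countable C" "C \<subseteq> M" "\<And>p. p \<in> points M \<Longrightarrow> \<exists>\<phi>\<in>C. p \<in> fst \<phi>"
proof -
  obtain \<B> where \<B>: "countable \<B>"
    "\<And>U p. openin (atlas_topology M) U \<Longrightarrow> p \<in> U \<Longrightarrow> \<exists>V\<in>\<B>. p \<in> V \<and> V \<subseteq> U"
    using assms unfolding second_countable_def by meson
  define pick where "pick V = (SOME \<phi>. \<phi> \<in> M \<and> V \<subseteq> fst \<phi>)" for V
  define C where "C = pick ` {V \<in> \<B>. \<exists>\<phi>\<in>M. V \<subseteq> fst \<phi>}"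
  have pick: "pick V \<in> M \<and> V \<subseteq> fst (pick V)" if V: "\<exists>\<phi>\<in>M. V \<subseteq> fst \<phi>" for V
    unfolding pick_def using V by (metis (mono_tags, lifting) someI_ex)
  show thesis
  proof
    show "countable C" unfolding C_def using \<B>(1) by auto
    show "C \<subseteq> M" unfolding C_def using pick by blast
    fix p assume "p \<in> points M"
    then obtain \<phi> where \<phi>: "\<phi> \<in> M" "p \<in> fst \<phi>" unfolding points_def by blast
    obtain V where V: "V \<in> \<B>" "p \<in> V" "V \<subseteq> fst \<phi>" using \<B>(2)[OF openin_chart_domain[OF \<phi>(1)] \<phi>(2)] by blast
    then have "pick V \<in> C" unfolding C_def using \<phi> by blast
    moreover have "p \<in> fst (pick V)" using pick V \<phi> by blast
    ultimately show "\<exists>\<phi>\<in>C. p \<in> fst \<phi>" by blast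
  qed
qed

lemma second_countable_tangent_bundle:
  assumes "second_countable (atlas_topology M)"
  shows "second_countable (atlas_topology (tangent_bundle M))"
proof -
  obtain C where C: "countable C" "C \<subseteq> M" "\<And>p. p \<in> points M \<Longrightarrow> \<exists>\<phi>\<in>C. p \<in> fst \<phi>"
    using countable_subatlas[OF assms] by blast
  obtain B :: "('e \<times> 'e) set set" where B: "countable B" "topological_basis B"
    using ex_countable_basis by blast
  define \<B> where "\<B> = (\<lambda>(\<phi>, Q). {z \<in> fst (tangent_chart M \<phi>). snd (tangent_chart M \<phi>) z \<in> Q}) ` (C \<times> B)"
  have countable_\<B>: "countable \<B>" unfolding \<B>_def using C B by auto
  have open_\<B>: "openin (atlas_topology (tangent_bundle M)) V" if "V \<in> \<B>" for V
  proof -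
    from that obtain \<phi> Q where V: "\<phi> \<in> C" "Q \<in> B"
      "V = {z \<in> fst (tangent_chart M \<phi>). snd (tangent_chart M \<phi>) z \<in> Q}" unfolding \<B>_def by auto
    show ?thesis unfolding V(3)
      by (rule TM.openin_chart_preimage)
        (use V C(2) topological_basis_open[OF B(2)] in \<open>auto simp: tangent_bundle_def\<close>)
  qed
  have base: "\<exists>V\<in>\<B>. z \<in> V \<and> V \<subseteq> U" if U: "openin (atlas_topology (tangent_bundle M)) U" and z: "z \<in> U" for U z
  proof -
    have zp: "z \<in> points (tangent_bundle M)" using U z unfolding TM.openin_atlas_topology by blast
    then obtain \<phi> where \<phi>: "\<phi> \<in> C" "fst z \<in> fst \<phi>" using C(3) unfolding points_tangent_bundle by blast
    let ?\<Phi> = "tangent_chart M \<phi>"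
    have \<phi>M: "\<phi> \<in> M" using \<phi> C by auto
    have z\<Phi>: "z \<in> fst ?\<Phi>" using zp \<phi> by (simp add: points_tangent_bundle fst_tangent_chart)
    have "open (snd ?\<Phi> ` (U \<inter> fst ?\<Phi>))"
      using U[unfolded TM.openin_atlas_topology] \<phi>M by (simp add: tangent_bundle_def)
    then obtain Q where Q: "Q \<in> B" "snd ?\<Phi> z \<in> Q" "Q \<subseteq> snd ?\<Phi> ` (U \<inter> fst ?\<Phi>)"
      using topological_basisE[OF B(2)] z z\<Phi> by (metis IntI image_eqI)
    have "{z \<in> fst ?\<Phi>. snd ?\<Phi> z \<in> Q} \<subseteq> U"
      using Q(3) inj_onD[OF tangent_chart_inj[OF \<phi>M]] by blast
    moreover have "{z \<in> fst ?\<Phi>. snd ?\<Phi> z \<in> Q} \<in> \<B>" unfolding \<B>_def using \<phi> Q by auto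
    ultimately show ?thesis
      using z\<Phi> Q(2) by (intro bexI[of _ "{z \<in> fst ?\<Phi>. snd ?\<Phi> z \<in> Q}"]) simp_all
  qed
  show ?thesis
    unfolding second_countable_def
  proof (intro exI[of _ \<B>] conjI ballI allI impI)
    fix U z assume "openin (atlas_topology (tangent_bundle M)) U \<and> z \<in> U"
    then show "\<exists>V\<in>\<B>. z \<in> V \<and> V \<subseteq> U" by (elim conjE) (rule base)
  qed (fact countable_\<B>, rule open_\<B>)
qed

end

lemma smooth_manifold_tangent_bundle:
  assumes "smooth_manifold M"
  shows "smooth_manifold (tangent_bundle M)"
proof -
  interpret atlas M using assms by unfold_locales (simp add: smooth_manifold_def)
  show ?thesis
    using assms smooth_atlas_tangent_bundle Hausdorff_tangent_bundle second_countable_tangent_bundle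
    by (simp add: smooth_manifold_def)
qed

section \<open>Change of coordinates for the Levi-Civita connection\<close>

text \<open>The Koszul expressions of isometric metrics differ by the terms in which the derivative falls on
  the Jacobian. By symmetry of second derivatives all but two of these terms cancel.\<close>

lemma christoffel_transform:
  assumes g: "local_metric S g" and g': "local_metric S' g'"
    and U: "open U" "U \<subseteq> S" "\<tau> ` U \<subseteq> S'" "smooth_on \<tau> U"
    and iso: "\<And>y u v. y \<in> U \<Longrightarrow> g y u v = g' (\<tau> y) (dir_deriv \<tau> y u) (dir_deriv \<tau> y v)"
    and y: "y \<in> U" and surj: "\<And>w. \<exists>v. dir_deriv \<tau> y v = w"
  shows "dir_deriv \<tau> y (christoffel g y u v) =
    christoffel g' (\<tau> y) (dir_deriv \<tau> y u) (dir_deriv \<tau> y v) + dir_deriv (\<lambda>z. dir_deriv \<tau> z v) y u"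
proof -
  interpret A: local_metric S g by (rule g)
  interpret B: local_metric S' g' by (rule g')
  define J where "J = dir_deriv \<tau> y"
  define H where "H u v = dir_deriv (\<lambda>z. dir_deriv \<tau> z v) y u" for u v
  have yS: "y \<in> S" "\<tau> y \<in> S'" using y U by auto
  have H_sym: "H u v = H v u" for u v
    unfolding H_def by (rule mixed_dir_deriv_commute[OF U(1,4) y])
  have d: "dir_deriv (\<lambda>z. g z v w) y u =
      g' (\<tau> y) (H u v) (J w) + g' (\<tau> y) (J v) (H u w) + dir_deriv (\<lambda>x. g' x (J v) (J w)) (\<tau> y) (J u)" for u v w
  proof -
    have "dir_deriv (\<lambda>z. g z v w) y u = dir_deriv (\<lambda>z. g' (\<tau> z) (dir_deriv \<tau> z v) (dir_deriv \<tau> z w)) y u"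
      by (rule dir_deriv_cong_open[OF U(1) y iso])
    also have "\<dots> = g' (\<tau> y) (H u v) (J w) + g' (\<tau> y) (J v) (H u w) + dir_deriv (\<lambda>x. g' x (J v) (J w)) (\<tau> y) (J u)"
      unfolding H_def J_def
      by (rule dir_deriv_eq[OF B.product_rule[OF U(1) y U(3)]])
        (intro has_derivative_dir_deriv smooth_on_differentiable[OF _ y] smooth_on_dir_deriv U(4))+
    finally show ?thesis .
  qed
  have koszul: "koszul g y u v w = koszul g' (\<tau> y) (J u) (J v) (J w) + 2 * g' (\<tau> y) (H u v) (J w)" for w
    unfolding koszul_def d
    by (simp add: H_sym[of v u] H_sym[of w] B.sym[OF yS(2), of "J u"] B.sym[OF yS(2), of "J v"])
  have "J (christoffel g y u v) = christoffel g' (\<tau> y) (J u) (J v) + H u v"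
  proof (rule B.nondegenerate[OF yS(2)])
    fix c
    obtain w where c: "c = J w" using surj[of c] unfolding J_def by blast
    have "2 * g' (\<tau> y) (J (christoffel g y u v)) c = 2 * g y (christoffel g y u v) w"
      using iso[OF y] by (simp add: c J_def)
    also have "\<dots> = 2 * g' (\<tau> y) (christoffel g' (\<tau> y) (J u) (J v)) c + 2 * g' (\<tau> y) (H u v) c"
      unfolding A.christoffel_koszul[OF yS(1)] B.christoffel_koszul[OF yS(2)] koszul c ..
    finally show "g' (\<tau> y) (J (christoffel g y u v)) c = g' (\<tau> y) (christoffel g' (\<tau> y) (J u) (J v) + H u v) c"
      by (simp add: B.add_left[OF yS(2)])
  qed
  then show ?thesis by (simp add: J_def H_def)
qed

section \<open>The lifted metric on the tangent bundle of a Riemannian manifold\<close>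

lemma linear_of_combination:
  fixes f :: "'v::real_vector \<Rightarrow> real"
  assumes "\<And>r u v. f (r *\<^sub>R u + v) = r * f u + f v"
  shows "linear f"
  using assms[of 1] assms[of _ _ 0] assms[of 1 0 0] by (intro linearI) auto

locale riemannian_atlas = atlas M
  for M :: "('a, 'e::euclidean_space) atlas" +
  fixes g :: "('a, 'e) tensor2"
  assumes metric: "riemannian_metric M g"
begin

interpretation TM: atlas "tangent_bundle M"
  by unfold_locales (rule smooth_atlas_tangent_bundle)

lemma
  assumes p: "p \<in> points M" and u: "u \<in> tangent_space M p" and v: "v \<in> tangent_space M p" 
  shows metric_combination: "w \<in> tangent_space M p \<Longrightarrow> g p (\<lambda>\<phi>. r *\<^sub>R u \<phi> + v \<phi>) w = r * g p u w + g p v w"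
    and metric_sym: "g p u v = g p v u"
    and metric_pos: "u \<noteq> (\<lambda>_. 0) \<Longrightarrow> g p u u > 0"
  using metric p u v unfolding riemannian_metric_def pseudo_riemannian_metric_def by blast+

lemma metric_smooth: "\<phi> \<in> M \<Longrightarrow> smooth_on (\<lambda>y. tensor_rep M g \<phi> y u v) (chart_image \<phi>)"
  using metric unfolding riemannian_metric_def pseudo_riemannian_metric_def by blast

lemma local_metric_chart:
  assumes \<phi>: "\<phi> \<in> M"
  shows "local_metric (chart_image \<phi>) (tensor_rep M g \<phi>)"
proof
  show "open (chart_image \<phi>)" using \<phi> by (rule open_chart_image)
  show "smooth_on (\<lambda>y. tensor_rep M g \<phi> y u v) (chart_image \<phi>)" for u v
    using \<phi> by (rule metric_smooth)
  fix y assume "y \<in> chart_image \<phi>"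
  then have p: "chart_inv \<phi> y \<in> fst \<phi>" by (rule chart_inv_in)
  then have pM: "chart_inv \<phi> y \<in> points M" using \<phi> by (auto simp: points_def)
  note cv = chart_vector_in[OF \<phi> p]
  show sym: "tensor_rep M g \<phi> y u v = tensor_rep M g \<phi> y v u" for u v
    unfolding tensor_rep_def Let_def by (rule metric_sym[OF pM cv cv])
  have lin: "linear (\<lambda>u. tensor_rep M g \<phi> y u v)" for v
    by (rule linear_of_combination)
      (simp add: tensor_rep_def Let_def chart_vector_combination[OF \<phi> p] metric_combination[OF pM cv cv cv])
  moreover have "tensor_rep M g \<phi> y u = (\<lambda>v. tensor_rep M g \<phi> y v u)" for u
    by (rule ext) (rule sym)
  ultimately show "bilinear (tensor_rep M g \<phi> y)" unfolding bilinear_def by metis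
  show "0 < tensor_rep M g \<phi> y u u" if "u \<noteq> 0" for u
  proof -
    have "chart_vector M \<phi> (chart_inv \<phi> y) u \<noteq> (\<lambda>_. 0)"
      using chart_vector_component[OF \<phi> p, of u] that by auto
    then show ?thesis unfolding tensor_rep_def Let_def by (rule metric_pos[OF pM cv cv])
  qed
qed

lemma metric_in_chart:
  assumes "\<phi> \<in> M" "p \<in> fst \<phi>" "u \<in> tangent_space M p" "v \<in> tangent_space M p"
  shows "g p u v = tensor_rep M g \<phi> (snd \<phi> p) (u \<phi>) (v \<phi>)"
  using assms by (simp add: tensor_rep_def chart_inv_chart chart_vector_tangent)

lemma christoffel_chart_change:
  assumes c: "\<phi> \<in> M" "\<psi> \<in> M" "p \<in> fst \<phi>" "p \<in> fst \<psi>"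
  defines "J \<equiv> dir_deriv (transition \<phi> \<psi>) (snd \<phi> p)"
  shows "J (christoffel (tensor_rep M g \<phi>) (snd \<phi> p) u v) =
    christoffel (tensor_rep M g \<psi>) (snd \<psi> p) (J u) (J v) +
    dir_deriv (\<lambda>y. dir_deriv (transition \<phi> \<psi>) y v) (snd \<phi> p) u"
  unfolding J_def transition_chart[OF c(1,3), of \<psi>, symmetric]
proof (rule christoffel_transform[OF local_metric_chart[OF c(1)] local_metric_chart[OF c(2)] open_overlap[OF c(1,2)]
      _ _ smooth_transition[OF c(1,2)]])
  show "snd \<phi> ` (fst \<phi> \<inter> fst \<psi>) \<subseteq> chart_image \<phi>" by (auto simp: chart_image_def)
  show "transition \<phi> \<psi> ` snd \<phi> ` (fst \<phi> \<inter> fst \<psi>) \<subseteq> chart_image \<psi>"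
    using c(1) by (auto simp: chart_image_def transition_chart)
  show "snd \<phi> p \<in> snd \<phi> ` (fst \<phi> \<inter> fst \<psi>)" using c by auto
  show "\<exists>v. dir_deriv (transition \<phi> \<psi>) (snd \<phi> p) v = w" for w
    using jacobian_inverse[OF c] by blast
  fix y u v assume "y \<in> snd \<phi> ` (fst \<phi> \<inter> fst \<psi>)"
  then obtain q where q: "y = snd \<phi> q" "q \<in> fst \<phi>" "q \<in> fst \<psi>" by auto
  then show "tensor_rep M g \<phi> y u v = tensor_rep M g \<psi> (transition \<phi> \<psi> y)
      (dir_deriv (transition \<phi> \<psi>) y u) (dir_deriv (transition \<phi> \<psi>) y v)"
    using c by (simp add: tensor_rep_def chart_inv_chart transition_chart chart_vector_transition)
qed

lemma tangent_chart_in: "\<phi> \<in> M \<Longrightarrow> tangent_chart M \<phi> \<in> tangent_bundle M"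
  by (simp add: tangent_bundle_def)

lemma bundle_chart_component:
  assumes "\<phi> \<in> M" "\<psi> \<in> M" "p \<in> fst \<phi>" "p \<in> fst \<psi>" "u \<in> tangent_space M p"
  shows "chart_vector (tangent_bundle M) (tangent_chart M \<phi>) (p, u) (A, B) (tangent_chart M \<psi>) =
    (dir_deriv (transition \<phi> \<psi>) (snd \<phi> p) A,
     dir_deriv (transition \<phi> \<psi>) (snd \<phi> p) B + dir_deriv (\<lambda>y. dir_deriv (transition \<phi> \<psi>) y (u \<phi>)) (snd \<phi> p) A)"
  using assms by (simp add: chart_vector_def tangent_chart_in fst_tangent_chart snd_tangent_chart tangent_jacobian)

text \<open>The prescribed components in the induced charts do define a tangent vector, because the second
  derivative in the Jacobian of the induced coordinate change cancels against the one in the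
  transformation law of the Christoffel symbols.\<close>

lemma horizontal_lift_chart:
  assumes \<phi>: "\<phi> \<in> M" "p \<in> fst \<phi>" and u: "u \<in> tangent_space M p" and X: "X \<in> tangent_space M p"
  shows "horizontal_lift M g (p, u) X = chart_vector (tangent_bundle M) (tangent_chart M \<phi>) (p, u)
    (X \<phi>, - christoffel (tensor_rep M g \<phi>) (snd \<phi> p) (u \<phi>) (X \<phi>))" (is "_ = ?\<xi>")
proof -
  have z: "(p, u) \<in> fst (tangent_chart M \<phi>)" using \<phi> u by (simp add: fst_tangent_chart)
  have in_T: "?\<xi> \<in> tangent_space (tangent_bundle M) (p, u)"
    by (rule TM.chart_vector_in[OF tangent_chart_in[OF \<phi>(1)] z])
  have comp: "?\<xi> (tangent_chart M \<psi>) = (X \<psi>, - christoffel (tensor_rep M g \<psi>) (snd \<psi> p) (u \<psi>) (X \<psi>))"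
    if \<psi>: "\<psi> \<in> M" "p \<in> fst \<psi>" for \<psi>
  proof -
    interpret A: local_metric "chart_image \<phi>" "tensor_rep M g \<phi>" by (rule local_metric_chart[OF \<phi>(1)])
    interpret B: local_metric "chart_image \<psi>" "tensor_rep M g \<psi>" by (rule local_metric_chart[OF \<psi>(1)])
    note c = \<phi>(1) \<psi>(1) \<phi>(2) \<psi>(2)
    show ?thesis
      unfolding bundle_chart_component[OF c u] tangent_component[OF X c] tangent_component[OF u c]
      using christoffel_chart_change[OF c, of "X \<phi>" "u \<phi>"]
      by (simp add: linear_neg[OF linear_jacobian[OF c]]
          A.christoffel_sym[OF chart_in_image[OF \<phi>(2)], of "u \<phi>"]
          B.christoffel_sym[OF chart_in_image[OF \<psi>(2)], of "dir_deriv (transition \<phi> \<psi>) (snd \<phi> p) (u \<phi>)"])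
  qed
  have "(THE \<xi>. \<xi> \<in> tangent_space (tangent_bundle M) (p, u) \<and>
      (\<forall>\<phi>\<in>M. p \<in> fst \<phi> \<longrightarrow> \<xi> (tangent_chart M \<phi>) =
         (X \<phi>, - christoffel (tensor_rep M g \<phi>) (snd \<phi> p) (u \<phi>) (X \<phi>)))) = ?\<xi>"
  proof (rule the_equality)
    fix \<xi> assume "\<xi> \<in> tangent_space (tangent_bundle M) (p, u) \<and>
      (\<forall>\<phi>\<in>M. p \<in> fst \<phi> \<longrightarrow> \<xi> (tangent_chart M \<phi>) =
         (X \<phi>, - christoffel (tensor_rep M g \<phi>) (snd \<phi> p) (u \<phi>) (X \<phi>)))"
    then show "\<xi> = ?\<xi>"
      using comp[OF \<phi>] \<phi> by (intro TM.tangent_eqI[OF _ in_T tangent_chart_in[OF \<phi>(1)] z]) auto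
  qed (use in_T comp in blast)
  then show ?thesis by (simp add: horizontal_lift_def)
qed

lemma vertical_lift_chart:
  assumes \<phi>: "\<phi> \<in> M" "p \<in> fst \<phi>" and u: "u \<in> tangent_space M p" and X: "X \<in> tangent_space M p"
  shows "vertical_lift M (p, u) X = chart_vector (tangent_bundle M) (tangent_chart M \<phi>) (p, u) (0, X \<phi>)"
    (is "_ = ?\<xi>")
proof -
  have z: "(p, u) \<in> fst (tangent_chart M \<phi>)" using \<phi> u by (simp add: fst_tangent_chart)
  have in_T: "?\<xi> \<in> tangent_space (tangent_bundle M) (p, u)"
    by (rule TM.chart_vector_in[OF tangent_chart_in[OF \<phi>(1)] z])
  have comp: "?\<xi> (tangent_chart M \<psi>) = (0, X \<psi>)"
    if \<psi>: "\<psi> \<in> M" "p \<in> fst \<psi>" for \<psi>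
  proof -
    note c = \<phi>(1) \<psi>(1) \<phi>(2) \<psi>(2)
    have "(\<lambda>y. dir_deriv (transition \<phi> \<psi>) y (u \<phi>)) differentiable at (snd \<phi> p)"
      using c by (intro smooth_on_differentiable[OF smooth_on_dir_deriv[OF smooth_transition[OF c(1,2)]]]) auto
    then show ?thesis
      unfolding bundle_chart_component[OF c u] tangent_component[OF X c]
      by (simp add: linear_0[OF linear_jacobian[OF c]] linear_0[OF linear_dir_deriv])
  qed
  have "(THE \<xi>. \<xi> \<in> tangent_space (tangent_bundle M) (p, u) \<and>
      (\<forall>\<phi>\<in>M. p \<in> fst \<phi> \<longrightarrow> \<xi> (tangent_chart M \<phi>) = (0, X \<phi>))) = ?\<xi>"
  proof (rule the_equality)
    fix \<xi> assume "\<xi> \<in> tangent_space (tangent_bundle M) (p, u) \<and>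
      (\<forall>\<phi>\<in>M. p \<in> fst \<phi> \<longrightarrow> \<xi> (tangent_chart M \<phi>) = (0, X \<phi>))"
    then show "\<xi> = ?\<xi>"
      using comp[OF \<phi>] \<phi> by (intro TM.tangent_eqI[OF _ in_T tangent_chart_in[OF \<phi>(1)] z]) auto
  qed (use in_T comp in blast)
  then show ?thesis by (simp add: vertical_lift_def)
qed

lemma lift_parts_chart:
  assumes \<phi>: "\<phi> \<in> M" "p \<in> fst \<phi>" and u: "u \<in> tangent_space M p"
    and \<xi>: "\<xi> \<in> tangent_space (tangent_bundle M) (p, u)"
  shows "lift_parts M g (p, u) \<xi> =
    (chart_vector M \<phi> p (fst (\<xi> (tangent_chart M \<phi>))),
     chart_vector M \<phi> p (snd (\<xi> (tangent_chart M \<phi>)) +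
       christoffel (tensor_rep M g \<phi>) (snd \<phi> p) (u \<phi>) (fst (\<xi> (tangent_chart M \<phi>)))))"
    (is "_ = (?X, ?Y)")
proof -
  let ?\<Phi> = "tangent_chart M \<phi>" and ?\<Gamma> = "christoffel (tensor_rep M g \<phi>) (snd \<phi> p) (u \<phi>)"
  have z: "(p, u) \<in> fst ?\<Phi>" using \<phi> u by (simp add: fst_tangent_chart)
  note \<Phi> = tangent_chart_in[OF \<phi>(1)]
  note cv = TM.chart_vector_in[OF \<Phi> z] TM.chart_vector_component[OF \<Phi> z]
  have sum: "(\<lambda>\<Psi>. horizontal_lift M g (p, u) X \<Psi> + vertical_lift M (p, u) Y \<Psi>) \<in> tangent_space (tangent_bundle M) (p, u)"
    "horizontal_lift M g (p, u) X ?\<Phi> + vertical_lift M (p, u) Y ?\<Phi> = (X \<phi>, Y \<phi> - ?\<Gamma> (X \<phi>))"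
    if "X \<in> tangent_space M p" "Y \<in> tangent_space M p" for X Y
    using TM.tangent_combination[OF cv(1) cv(1), of 1]
    by (simp_all add: horizontal_lift_chart[OF \<phi> u that(1)] vertical_lift_chart[OF \<phi> u that(2)] cv(2))
  have XY: "?X \<in> tangent_space M p" "?Y \<in> tangent_space M p" by (intro chart_vector_in \<phi>)+
  show ?thesis
    unfolding lift_parts_def fst_conv
  proof (rule the_equality)
    show "case (?X, ?Y) of (X, Y) \<Rightarrow> X \<in> tangent_space M p \<and> Y \<in> tangent_space M p \<and>
        \<xi> = (\<lambda>\<Psi>. horizontal_lift M g (p, u) X \<Psi> + vertical_lift M (p, u) Y \<Psi>)"
      using XY sum[OF XY]
      by (auto simp: chart_vector_component[OF \<phi>] intro!: TM.tangent_eqI[OF \<xi> _ \<Phi> z])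
    fix P assume "case P of (X, Y) \<Rightarrow> X \<in> tangent_space M p \<and> Y \<in> tangent_space M p \<and>
        \<xi> = (\<lambda>\<Psi>. horizontal_lift M g (p, u) X \<Psi> + vertical_lift M (p, u) Y \<Psi>)"
    then obtain X Y where P: "P = (X, Y)" and T: "X \<in> tangent_space M p" "Y \<in> tangent_space M p"
      and eq: "\<xi> = (\<lambda>\<Psi>. horizontal_lift M g (p, u) X \<Psi> + vertical_lift M (p, u) Y \<Psi>)"
      by auto
    have "\<xi> ?\<Phi> = (X \<phi>, Y \<phi> - ?\<Gamma> (X \<phi>))" using sum(2)[OF T] by (simp add: eq)
    then show "P = (?X, ?Y)"
      unfolding P using T \<phi> by (simp add: chart_vector_tangent)
  qed
qed

end


section \<open>Locality of the coordinate expressions\<close>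

lemma christoffel_cong_open:
  assumes S: "open S" and y: "y \<in> S" and eq: "\<And>z. z \<in> S \<Longrightarrow> h z = h' z"
  shows "christoffel h y u v = christoffel h' y u v"
proof -
  have "dir_deriv (\<lambda>z. h z u v) y w = dir_deriv (\<lambda>z. h' z u v) y w" for u v w
    by (rule dir_deriv_cong_open[OF S y]) (simp add: eq)
  then show ?thesis by (simp add: christoffel_def eq[OF y])
qed

lemma curvature_coord_cong_open:
  assumes S: "open S" and y: "y \<in> S" and eq: "\<And>z. z \<in> S \<Longrightarrow> h z = h' z"
  shows "curvature_coord h y u v w = curvature_coord h' y u v w"
proof -
  have chr: "christoffel h z u v = christoffel h' z u v" if "z \<in> S" for z u v
    by (rule christoffel_cong_open[OF S that eq])
  have "dir_deriv (\<lambda>z. christoffel h z u v) y w = dir_deriv (\<lambda>z. christoffel h' z u v) y w" for u v w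
    by (rule dir_deriv_cong_open[OF S y chr])
  then show ?thesis by (simp add: curvature_coord_def chr[OF y])
qed

lemma ricci_coord_cong_open:
  assumes "open S" "y \<in> S" "\<And>z. z \<in> S \<Longrightarrow> h z = h' z"
  shows "ricci_coord h y u v = ricci_coord h' y u v"
  unfolding ricci_coord_def using curvature_coord_cong_open[OF assms] by simp

lemma lie_deriv_coord_cong_open:
  assumes S: "open S" and y: "y \<in> S" and eq: "\<And>z. z \<in> S \<Longrightarrow> h z = h' z"
  shows "lie_deriv_coord V h y u v = lie_deriv_coord V h' y u v"
proof -
  have "dir_deriv (\<lambda>z. h z u v) y w = dir_deriv (\<lambda>z. h' z u v) y w" for w
    by (rule dir_deriv_cong_open[OF S y]) (simp add: eq)
  then show ?thesis by (simp add: lie_deriv_coord_def eq[OF y])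
qed

section \<open>Ricci solitons on the tangent bundle\<close>

locale lifted_atlas = riemannian_atlas M g
  for M :: "('a, 'e::euclidean_space) atlas" and g :: "('a, 'e) tensor2" +
  fixes a b c :: real
  assumes a_nz: "a \<noteq> 0" and det_nz: "a * (a + c) - b\<^sup>2 \<noteq> 0"
begin

interpretation TM: atlas "tangent_bundle M"
  by unfold_locales (rule smooth_atlas_tangent_bundle)

definition G :: "('a \<times> ('a, 'e) tvec, 'e \<times> 'e) tensor2" where
  "G = (\<lambda>z \<xi> \<eta>. a * sasaki_metric M g z \<xi> \<eta> + b * horizontal_lift_metric M g z \<xi> \<eta>
     + c * vertical_lift_metric M g z \<xi> \<eta>)"

lemma lifted_metric_chart: "\<phi> \<in> M \<Longrightarrow> lifted_metric (chart_image \<phi>) (tensor_rep M g \<phi>) a b c"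
  by (intro lifted_metric.intro local_metric_chart lifted_metric_axioms.intro a_nz det_nz)

abbreviation lift_chart where
  "lift_chart \<phi> \<equiv> lifted_metric.lift (tensor_rep M g \<phi>) a b c"

lemma G_in_chart:
  assumes \<phi>: "\<phi> \<in> M" and z: "z \<in> fst (tangent_chart M \<phi>)"
    and \<xi>: "\<xi> \<in> tangent_space (tangent_bundle M) z" and \<eta>: "\<eta> \<in> tangent_space (tangent_bundle M) z"
  shows "G z \<xi> \<eta> = lift_chart \<phi> (snd (tangent_chart M \<phi>) z) (\<xi> (tangent_chart M \<phi>)) (\<eta> (tangent_chart M \<phi>))"
proof -
  interpret lifted_metric "chart_image \<phi>" "tensor_rep M g \<phi>" a b c by (rule lifted_metric_chart[OF \<phi>])
  obtain p u where pu: "z = (p, u)" by (cases z)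
  have p: "p \<in> fst \<phi>" and u: "u \<in> tangent_space M p" using z by (simp_all add: pu fst_tangent_chart)
  note parts = lift_parts_chart[OF \<phi> p u]
  show ?thesis
    using parts[of \<xi>] parts[of \<eta>] \<xi> \<eta>
    by (simp add: pu G_def sasaki_metric_def horizontal_lift_metric_def vertical_lift_metric_def lift_def
        vpart_def snd_tangent_chart metric_in_chart[OF \<phi> p] chart_vector_in[OF \<phi> p] chart_vector_component[OF \<phi> p])
qed

lemma tensor_rep_G:
  assumes \<phi>: "\<phi> \<in> M" and x: "x \<in> chart_image \<phi> \<times> UNIV"
  shows "tensor_rep (tangent_bundle M) G (tangent_chart M \<phi>) x = lift_chart \<phi> x"
proof -
  have x: "x \<in> chart_image (tangent_chart M \<phi>)" using x by (simp add: tangent_chart_image[OF \<phi>])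
  note z = TM.chart_inv_in[OF x]
  note cv = TM.chart_vector_in[OF tangent_chart_in[OF \<phi>] z]
  show ?thesis
    by (intro ext) (simp add: tensor_rep_def G_in_chart[OF \<phi> z cv cv] TM.chart_chart_inv[OF x]
        TM.chart_vector_component[OF tangent_chart_in[OF \<phi>] z])
qed

lemma bundle_chartE:
  assumes "\<Phi> \<in> tangent_bundle M"
  obtains \<phi> where "\<phi> \<in> M" "\<Phi> = tangent_chart M \<phi>"
  using assms by (auto simp: tangent_bundle_def)

lemma tangent_chart_value: "\<phi> \<in> M \<Longrightarrow> z \<in> fst (tangent_chart M \<phi>) \<Longrightarrow> snd (tangent_chart M \<phi>) z \<in> chart_image \<phi> \<times> UNIV"
  using TM.chart_in_image[of z "tangent_chart M \<phi>"] by (simp add: tangent_chart_image)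

lemma pseudo_riemannian_G: "pseudo_riemannian_metric (tangent_bundle M) G"
  unfolding pseudo_riemannian_metric_def
proof (intro conjI ballI allI impI)
  fix z assume "z \<in> points (tangent_bundle M)"
  then obtain \<phi> where \<phi>: "\<phi> \<in> M" and z: "z \<in> fst (tangent_chart M \<phi>)"
    unfolding points_def tangent_bundle_def by blast
  interpret lifted_metric "chart_image \<phi>" "tensor_rep M g \<phi>" a b c by (rule lifted_metric_chart[OF \<phi>])
  note x = tangent_chart_value[OF \<phi> z] and G = G_in_chart[OF \<phi> z] and \<Phi> = tangent_chart_in[OF \<phi>]
  fix \<xi> assume \<xi>: "\<xi> \<in> tangent_space (tangent_bundle M) z"
  show "G z \<xi> \<eta> = G z \<eta> \<xi>" if "\<eta> \<in> tangent_space (tangent_bundle M) z" for \<eta>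
    using lift_sym[OF x] by (simp add: G \<xi> that)
  show "G z (\<lambda>\<phi>. r *\<^sub>R \<xi> \<phi> + \<eta> \<phi>) \<zeta> = r * G z \<xi> \<zeta> + G z \<eta> \<zeta>"
    if "\<eta> \<in> tangent_space (tangent_bundle M) z" "\<zeta> \<in> tangent_space (tangent_bundle M) z" for \<eta> \<zeta> r
    using TM.tangent_combination[OF \<xi> that(1), of r]
    by (simp add: G \<xi> that L.add_left[OF x] L.scale_left[OF x])
  assume 0: "\<forall>\<eta>\<in>tangent_space (tangent_bundle M) z. G z \<xi> \<eta> = 0"
  have "lift (snd (tangent_chart M \<phi>) z) (\<xi> (tangent_chart M \<phi>)) B = 0" for B
    using 0[rule_format, OF TM.chart_vector_in[OF \<Phi> z, of B]]
    by (simp add: G \<xi> TM.chart_vector_in[OF \<Phi> z] TM.chart_vector_component[OF \<Phi> z])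
  then have "\<xi> (tangent_chart M \<phi>) = 0"
    by (intro lift_nondegenerate[OF x]) (simp add: L.zero_left[OF x])
  then show "\<xi> = (\<lambda>_. 0)" by (intro TM.tangent_eqI[OF \<xi> TM.tangent_zero \<Phi> z]) simp
next
  fix \<Phi> A B assume "\<Phi> \<in> tangent_bundle M"
  then obtain \<phi> where \<phi>: "\<phi> \<in> M" "\<Phi> = tangent_chart M \<phi>" by (rule bundle_chartE)
  interpret lifted_metric "chart_image \<phi>" "tensor_rep M g \<phi>" a b c by (rule lifted_metric_chart[OF \<phi>(1)])
  show "smooth_on (\<lambda>y. tensor_rep (tangent_bundle M) G \<Phi> y A B) (chart_image \<Phi>)"
    unfolding \<phi>(2) tangent_chart_image[OF \<phi>(1)]
    by (rule smooth_on_cong_imp[OF open_T _ L.smooth]) (simp add: tensor_rep_G[OF \<phi>(1)])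
qed

lemma ricci_G_chart:
  assumes "\<phi> \<in> M" "z \<in> fst (tangent_chart M \<phi>)"
  shows "ricci (tangent_bundle M) G (tangent_chart M \<phi>) z \<xi> \<eta> =
    ricci_coord (lift_chart \<phi>) (snd (tangent_chart M \<phi>) z) (\<xi> (tangent_chart M \<phi>)) (\<eta> (tangent_chart M \<phi>))"
  unfolding ricci_def
  by (rule ricci_coord_cong_open[OF _ tangent_chart_value tensor_rep_G])
    (use assms in \<open>auto intro: open_Times open_chart_image\<close>)

lemma lie_deriv_G_chart:
  assumes "\<phi> \<in> M" "z \<in> fst (tangent_chart M \<phi>)"
  shows "lie_deriv (tangent_bundle M) Z G (tangent_chart M \<phi>) z \<xi> \<eta> =
    lie_deriv_coord (vfield_rep Z (tangent_chart M \<phi>)) (lift_chart \<phi>) (snd (tangent_chart M \<phi>) z)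
      (\<xi> (tangent_chart M \<phi>)) (\<eta> (tangent_chart M \<phi>))"
  unfolding lie_deriv_def
  by (rule lie_deriv_coord_cong_open[OF _ tangent_chart_value tensor_rep_G])
    (use assms in \<open>auto intro: open_Times open_chart_image\<close>)

lemma flat_chart:
  assumes "flat M g" "\<phi> \<in> M" "y \<in> chart_image \<phi>"
  shows "curvature_coord (tensor_rep M g \<phi>) y u v w = 0"
proof -
  note p = chart_inv_in[OF assms(3)]
  note cv = chart_vector_in[OF assms(2) p]
  have "curvature_coord (tensor_rep M g \<phi>) (snd \<phi> (chart_inv \<phi> y)) (chart_vector M \<phi> (chart_inv \<phi> y) u \<phi>)
      (chart_vector M \<phi> (chart_inv \<phi> y) v \<phi>) (chart_vector M \<phi> (chart_inv \<phi> y) w \<phi>) = 0"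
    using assms(1,2) p cv unfolding flat_def by blast
  then show ?thesis
    by (simp add: chart_vector_component[OF assms(2) p] chart_chart_inv[OF assms(3)])
qed

lemma ricci_G_flat:
  assumes flat: "flat M g" and \<Phi>: "\<Phi> \<in> tangent_bundle M" and z: "z \<in> fst \<Phi>"
  shows "ricci (tangent_bundle M) G \<Phi> z \<xi> \<eta> = 0"
proof -
  obtain \<phi> where \<phi>: "\<phi> \<in> M" "\<Phi> = tangent_chart M \<phi>" using \<Phi> by (rule bundle_chartE)
  interpret lifted_metric "chart_image \<phi>" "tensor_rep M g \<phi>" a b c by (rule lifted_metric_chart[OF \<phi>(1)])
  show ?thesis
    using z flat_chart[OF flat \<phi>(1)] unfolding \<phi>(2)
    by (simp add: ricci_G_chart[OF \<phi>(1)] ricci_lift_flat tangent_chart_value[OF \<phi>(1)])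
qed

lemma flat_of_soliton:
  assumes Z: "vector_field (tangent_bundle M) Z" and soliton: "ricci_soliton (tangent_bundle M) G Z lam"
  shows "flat M g"
  unfolding flat_def
proof (intro ballI)
  fix \<phi> p u v w assume \<phi>: "\<phi> \<in> M" and p: "p \<in> fst \<phi>"
  let ?\<Phi> = "tangent_chart M \<phi>"
  interpret lifted_metric "chart_image \<phi>" "tensor_rep M g \<phi>" a b c by (rule lifted_metric_chart[OF \<phi>])
  note \<Phi> = tangent_chart_in[OF \<phi>]
  show "curvature_coord (tensor_rep M g \<phi>) (snd \<phi> p) (u \<phi>) (v \<phi>) (w \<phi>) = 0"
  proof (rule flat_of_soliton_coord[OF _ _ chart_in_image[OF p]])
    show "smooth_on (vfield_rep Z ?\<Phi>) T"
      using Z \<Phi> unfolding vector_field_def tangent_chart_image[OF \<phi>, symmetric] by blast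
    fix x B B' assume "x \<in> T"
    then have x: "x \<in> chart_image ?\<Phi>" by (simp add: tangent_chart_image[OF \<phi>])
    define z where "z = chart_inv ?\<Phi> x"
    have z: "z \<in> fst ?\<Phi>" "snd ?\<Phi> z = x"
      unfolding z_def by (rule TM.chart_inv_in[OF x], rule TM.chart_chart_inv[OF x])
    let ?\<xi> = "\<lambda>B. chart_vector (tangent_bundle M) ?\<Phi> z (0, B)"
    note cv = TM.chart_vector_in[OF \<Phi> z(1)]
    have "ricci (tangent_bundle M) G ?\<Phi> z (?\<xi> B) (?\<xi> B') + 1 / 2 * lie_deriv (tangent_bundle M) Z G ?\<Phi> z (?\<xi> B) (?\<xi> B')
        = lam * G z (?\<xi> B) (?\<xi> B')"
      using soliton \<Phi> z(1) cv unfolding ricci_soliton_def by blast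
    then show "ricci_coord lift x (0, B) (0, B') + 1 / 2 * lie_deriv_coord (vfield_rep Z ?\<Phi>) lift x (0, B) (0, B') =
        lam * lift x (0, B) (0, B')"
      by (simp add: ricci_G_chart[OF \<phi> z(1)] lie_deriv_G_chart[OF \<phi> z(1)] G_in_chart[OF \<phi> z(1) cv cv]
          TM.chart_vector_component[OF \<Phi> z(1)] z(2))
  qed
qed

end

theorem theorem3:
  fixes M :: "('a, 'e::euclidean_space) atlas"
    and g :: "('a, 'e) tensor2"
    and G :: "('a \<times> ('a, 'e) tvec, 'e \<times> 'e) tensor2"
    and Z :: "('a \<times> ('a, 'e) tvec, 'e \<times> 'e) vfield"
    and a b c lam :: real
  assumes "smooth_manifold M" and "riemannian_metric M g"
    and "DIM('e) \<ge> 2"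
    and "a \<noteq> 0" and "a + c \<noteq> 0" and "a * (a + c) - b\<^sup>2 \<noteq> 0"
    and "G = (\<lambda>z \<xi> \<eta>. a * sasaki_metric M g z \<xi> \<eta> + b * horizontal_lift_metric M g z \<xi> \<eta>
                       + c * vertical_lift_metric M g z \<xi> \<eta>)"
    and "vector_field (tangent_bundle M) Z"
  shows "ricci_soliton (tangent_bundle M) G Z lam \<longleftrightarrow>
    flat M g \<and> homothetic_vector_field (tangent_bundle M) G Z lam"
proof -
  interpret L: lifted_atlas M g a b c
    using assms(1,2,4,6) by unfold_locales (simp_all add: smooth_manifold_def)
  have G: "G = L.G" unfolding assms(7) L.G_def ..
  have "homothetic_vector_field (tangent_bundle M) G Z lam \<longleftrightarrow> ricci_soliton (tangent_bundle M) G Z lam"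
    if flat: "flat M g"
    using assms(8) smooth_manifold_tangent_bundle[OF assms(1)] L.pseudo_riemannian_G
    by (simp add: G ricci_soliton_def homothetic_vector_field_def L.ricci_G_flat[OF flat] mult_ac)
  then show ?thesis using L.flat_of_soliton[OF assms(8)] unfolding G by blast
qed


end
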